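(* Let $s>0$ and let $T$ be an $s$-smooth Calderón–Zygmund operator on $\mathbb{R}^d$. Let $f\in L^\infty_c(\mathbb{R}^d)$ be supported on a cube $Q_0\subseteq\mathbb{R}^d$. Then there exist $r\in(0,1)$ depending only on $d$ and a $\frac12$-sparse family $\mathcal{S}\subset\mathscr{D}(Q_0)$ such that $$|Tf(x)|\lesssim\sum_{Q\in\mathcal{S}}\mathsf{P}^r_Q(\mathcal{M}^s_{3Q}f)\,\mathbf{1}_Q(x),\qquad x\in Q_0,$$ with implicit constant independent of $f$ and $Q_0$.
   Context: Write $s=m+\delta$ with $m\in\mathbb{N}$, $\delta\in(0,1]$. An $s$-smooth Calderón–Zygmund operator is a bounded linear $T:L^2(\mathbb{R}^d)\to L^2(\mathbb{R}^d)$ with a kernel $K$ on $\{x\ne y\}$ such that $Tf(x)=\int K(x,y)f(y)\,dy$ for $f\in L^\infty_c$ and $x\notin\mathrm{supp} f$, and for some $C_K>0$, all $x\ne y$ and $|h|\le\frac12|x-y|$: $|\partial_y^\alpha K(x,y)|\le C_K|x-y|^{-d-|\alpha|}$ for $|\alpha|\le m$; $|\partial^\alpha_yK(x,y)-\partial^\alpha_yK(x+h,y)|\le C_K|h|^\delta|x-y|^{-d-s}$ for $|\alpha|\le m$; $|\partial^\alpha_yK(x,y)-\partial^\alpha_yK(x,y+h)|\le C_K|h|^\delta|x-y|^{-d-s}$ for $|\alpha|=m$. For a cube $Q$, $\mathcal{F}_s(Q)$ is the set of $\varphi:\mathbb{R}^d\to\mathbb{R}$ supported in $Q$ with $|\partial^\alpha\varphi|\le\ell(Q)^{-|\alpha|}$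 for $|\alpha|\le m$ and $|\partial^\alpha\varphi(y)-\partial^\alpha\varphi(y')|\le|y-y'|^\delta\ell(Q)^{-s}$ for $|\alpha|=m$. For a cube $Q_1$, $\mathcal{M}^s_{Q_1}f(x)=\sup_{Q\subseteq Q_1}\sup_{\varphi\in\mathcal{F}_s(Q)}\frac1{|Q|}|\int_Qf\varphi|\,\mathbf{1}_Q(x)$, the sup over axis-parallel cubes $Q\subseteq Q_1$. $\mathsf{P}^r_Q(g):=\inf\{\lambda\in\mathbb{R}:|\{x\in Q:g(x)>\lambda\}|\le r|Q|\}$. $\mathscr{D}(Q_0)$ is the dyadic subcubes of $Q_0$; a family $\mathcal{S}$ is $\frac12$-sparse if there are pairwise disjoint $E_Q\subset Q$, $Q\in\mathcal{S}$, with $|E_Q|\ge\frac12|Q|$. *)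

theory Defs
  imports "HOL-Analysis.Analysis"
begin

definition cube_of :: "real^'n \<Rightarrow> real \<Rightarrow> (real^'n) set" where
  "cube_of a l = {x. \<forall>i. a$i \<le> x$i \<and> x$i < a$i + l}"

definition is_cube :: "(real^'n) set \<Rightarrow> bool" where
  "is_cube Q \<longleftrightarrow> (\<exists>a l. l > 0 \<and> Q = cube_of a l)"

definition sidelen :: "(real^'n) set \<Rightarrow> real" where
  "sidelen Q = measure lebesgue Q powr (1 / real CARD('n))"

definition triple :: "(real^'n) set \<Rightarrow> (real^'n) set" where
  "triple Q = (THE Q'. \<exists>a l. l > 0 \<and> Q = cube_of a l \<and>
                 Q' = cube_of (a - (\<chi> i. l)) (3 * l))"

definition dyadic_sub :: "(real^'n) set \<Rightarrow> (real^'n) set set" where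
  "dyadic_sub Q0 = {Q. \<exists>a l (k::nat) (j::'n \<Rightarrow> nat). l > 0 \<and> Q0 = cube_of a l \<and>
      (\<forall>i. j i < 2^k) \<and>
      Q = cube_of (a + (l / 2^k) *\<^sub>R (\<chi> i. real (j i))) (l / 2^k)}"

definition pd :: "'n \<Rightarrow> (real^'n \<Rightarrow> 'b::real_normed_vector) \<Rightarrow> real^'n \<Rightarrow> 'b" where
  "pd i f y = frechet_derivative f (at y) (axis i 1)"

fun pds :: "'n list \<Rightarrow> (real^'n \<Rightarrow> 'b::real_normed_vector) \<Rightarrow> real^'n \<Rightarrow> 'b" where
  "pds [] f = f"
| "pds (i # is) f = pd i (pds is f)"

(* all partial derivatives of order < m exist and are differentiable on U,
   so that all partial derivatives of order \<le> m exist on U *)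
definition diff_upto :: "nat \<Rightarrow> (real^'n \<Rightarrow> 'b::real_normed_vector) \<Rightarrow> (real^'n) set \<Rightarrow> bool" where
  "diff_upto m f U \<longleftrightarrow> (\<forall>is. length is < m \<longrightarrow> (\<forall>y\<in>U. pds is f differentiable at y))"

definition L2 :: "(real^'n \<Rightarrow> complex) \<Rightarrow> bool" where
  "L2 f \<longleftrightarrow> f \<in> borel_measurable lebesgue \<and> integrable lebesgue (\<lambda>x. (cmod (f x))^2)"

definition Linfc :: "(real^'n \<Rightarrow> complex) \<Rightarrow> bool" where
  "Linfc f \<longleftrightarrow> f \<in> borel_measurable lebesgue \<and> bounded (range f) \<and> bounded {y. f y \<noteq> 0}"

(* s-smooth Calderon-Zygmund operator, s = m + delta *)
definition CZO :: "nat \<Rightarrow> real \<Rightarrow> ((real^'n \<Rightarrow> complex) \<Rightarrow> real^'n \<Rightarrow> complex)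
                    \<Rightarrow> (real^'n \<Rightarrow> real^'n \<Rightarrow> complex) \<Rightarrow> bool" where
  "CZO m \<delta> T K \<longleftrightarrow>
    (\<exists>B. \<forall>f. L2 f \<longrightarrow> L2 (T f) \<and>
        (\<integral>x. (cmod (T f x))^2 \<partial>lebesgue) \<le> B^2 * (\<integral>x. (cmod (f x))^2 \<partial>lebesgue)) \<and>
    (\<forall>f g. L2 f \<and> L2 g \<longrightarrow> (AE x in lebesgue. T (\<lambda>y. f y + g y) x = T f x + T g x)) \<and>
    (\<forall>f c. L2 f \<longrightarrow> (AE x in lebesgue. T (\<lambda>y. c * f y) x = c * T f x)) \<and>
    (\<forall>f. Linfc f \<longrightarrow> (AE x in lebesgue. x \<notin> closure {y. f y \<noteq> 0} \<longrightarrow>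
          T f x = (\<integral>y. K x y * f y \<partial>lebesgue))) \<and>
    (\<exists>CK>0.
      (\<forall>x. diff_upto m (K x) (- {x})) \<and>
      (\<forall>x y is. x \<noteq> y \<and> length is \<le> m \<longrightarrow>
          norm (pds is (K x) y) \<le> CK * dist x y powr (- (real CARD('n) + real (length is)))) \<and>
      (\<forall>x y h is. x \<noteq> y \<and> norm h \<le> dist x y / 2 \<and> length is \<le> m \<longrightarrow>
          norm (pds is (K x) y - pds is (K (x + h)) y)
            \<le> CK * norm h powr \<delta> * dist x y powr (- (real CARD('n) + (real m + \<delta>)))) \<and>
      (\<forall>x y h is. x \<noteq> y \<and> norm h \<le> dist x y / 2 \<and> length is = m \<longrightarrow>
          norm (pds is (K x) y - pds is (K x) (y + h))
            \<le> CK * norm h powr \<delta> * dist x y powr (- (real CARD('n) + (real m + \<delta>)))))"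

definition Fs :: "nat \<Rightarrow> real \<Rightarrow> (real^'n) set \<Rightarrow> (real^'n \<Rightarrow> real) set" where
  "Fs m \<delta> Q = {\<phi>. (\<forall>y. y \<notin> Q \<longrightarrow> \<phi> y = 0) \<and> diff_upto m \<phi> UNIV \<and>
      (\<forall>is y. length is \<le> m \<longrightarrow> \<bar>pds is \<phi> y\<bar> \<le> sidelen Q powr (- real (length is))) \<and>
      (\<forall>is y y'. length is = m \<longrightarrow>
          \<bar>pds is \<phi> y - pds is \<phi> y'\<bar> \<le> dist y y' powr \<delta> * sidelen Q powr (- (real m + \<delta>)))}"

definition maxf :: "nat \<Rightarrow> real \<Rightarrow> (real^'n) set \<Rightarrow> (real^'n \<Rightarrow> complex) \<Rightarrow> real^'n \<Rightarrow> real" where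
  "maxf m \<delta> Q1 f x = Sup {cmod (LINT y:Q|lebesgue. f y * of_real (\<phi> y)) / measure lebesgue Q * indicator Q x
       | Q \<phi>. is_cube Q \<and> Q \<subseteq> Q1 \<and> \<phi> \<in> Fs m \<delta> Q}"

definition outer_meas :: "(real^'n) set \<Rightarrow> ennreal" where
  "outer_meas A = Inf {emeasure lebesgue B | B. B \<in> sets lebesgue \<and> A \<subseteq> B}"

definition Pr :: "real \<Rightarrow> (real^'n) set \<Rightarrow> (real^'n \<Rightarrow> real) \<Rightarrow> real" where
  "Pr r Q g = Inf {t. outer_meas {x\<in>Q. g x > t} \<le> ennreal (r * measure lebesgue Q)}"

definition half_sparse :: "(real^'n) set set \<Rightarrow> bool" where
  "half_sparse S \<longleftrightarrow> (\<exists>E. (\<forall>Q\<in>S. E Q \<in> sets lebesgue \<and> E Q \<subseteq> Q \<and>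
        measure lebesgue (E Q) \<ge> measure lebesgue Q / 2) \<and> disjoint_family_on E S)"

definition esum :: "'a set \<Rightarrow> ('a \<Rightarrow> real) \<Rightarrow> ennreal" where
  "esum S g = (SUP F\<in>{F. finite F \<and> F \<subseteq> S}. ennreal (\<Sum>Q\<in>F. g Q))"

end

theory Submission imports Defs
begin

text \<open>For a cube \<open>Q\<close> let \<open>\<lambda>\<^sub>Q\<close> be the quantile of \<open>M\<^sup>s\<^bsub>3Q\<^esub> f\<close> and let \<open>F\<close> be a compact part of \<open>Q\<close> of nearly
  full measure on which the maximal function is at most \<open>\<lambda>\<^sub>Q\<close>. A smooth partition of unity adapted to the distance from \<open>F\<close>
  writes \<open>f\<close>, cut off to \<open>3Q\<close>, as a good part bounded by a multiple of \<open>\<lambda>\<^sub>Q\<close> plus pieces whose size is comparable to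
  their distance from \<open>F\<close>. On a piece, the kernel \<open>K(x, _)\<close> is a multiple of an admissible test function, so \<open>f\<close> may be
  replaced there by its average at the cost of \<open>\<lambda>\<^sub>Q\<close> times a term of the Marcinkiewicz integral of the pieces. This
  integral is bounded on a large part \<open>G\<close> of \<open>F\<close>. Together with the \<open>L\<^sup>2\<close> bound for the good part this controls \<open>T\<close> of
  the cut-off \<open>f\<close> on \<open>G\<close>, as in the weak type estimate.

  The same decomposition controls the oscillation of the truncated integrals: the regularity in \<open>x\<close> is too weak to
  estimate \<open>T(f (\<eta>\<^sub>Q - \<eta>\<^sub>P))\<close> annulus by annulus against averages of the maximal function, because
  \<open>K(x, _) - K(x', _)\<close> has no decay in the top Hoelder seminorm. Instead, the base point \<open>x'\<close> is taken in \<open>G\<close>, where the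
  Marcinkiewicz integral sums the contributions of all pieces at once. The cubes in which the complement of \<open>G\<close> has
  density above \<open>2\<^bsup>-d-1\<^esup>\<close> are the stopping cubes; iterating over them yields the sparse family.\<close>

subsection \<open>Partial derivatives\<close>

text \<open>The quantile level r = 2^-(d+6) may depend on d only, so the norm and kernel constants
  of T enter through two thresholds instead: \<open>A\<close> for the Marcinkiewicz integral and
  \<open>\<beta>\<close> for the \<open>L^2\<close> estimate. Both are raised until each exceptional
  set has measure at most r |Q|. The budget in a cube Q is 2 r for the set above the quantile (an
  infimum of levels, measured by outer measure), r for passing to a closed subset, and r for each
  threshold. The total stays below 8 r = 2^-(d+3); an open enlargement of the exceptional set
  doubles this to 2^-(d+2), half of the density threshold. The same numbers keep Q from being dense
  itself, bound the union of the stopping cubes by |Q|/2, and leave in each stopping cube P a point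
  that is good for Q and for P simultaneously, because 1/2 + 1/4 < 1. At this common point the two
  local bounds control the truncated integral, and the oscillation bound carries the control to all
  of P. Every decomposition ends at a finite generation n with a remainder that is removed in the
  limit, so T is applied to finite sums only.\<close>

lemma pd_eqI: "(\<phi> has_derivative D) (at y) \<Longrightarrow> pd i \<phi> y = D (axis i 1)"
  by (simp add: pd_def frechet_derivative_at[symmetric])

lemma pd_cong_open:
  assumes "open U" "y \<in> U" "\<And>z. z \<in> U \<Longrightarrow> \<phi> z = \<psi> z"
  shows "pd i \<phi> y = pd i \<psi> y"
proof -
  have "(\<lambda>D. (\<phi> has_derivative D) (at y)) = (\<lambda>D. (\<psi> has_derivative D) (at y))"
    using has_derivative_transform_within_open[OF _ assms(1,2)] assms(3) by fastforce
  then show ?thesis by (simp add: pd_def frechet_derivative_def)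
qed

lemma differentiable_cong_open:
  assumes "open U" "y \<in> U" "\<And>z. z \<in> U \<Longrightarrow> \<phi> z = \<psi> z"
  shows "\<phi> differentiable at y \<longleftrightarrow> \<psi> differentiable at y"
  unfolding differentiable_def
  by (metis assms has_derivative_transform_within_open)

lemma pd_bounded_linear:
  assumes "bounded_linear L" "\<phi> differentiable at y"
  shows "pd i (\<lambda>z. L (\<phi> z)) y = L (pd i \<phi> y)"
  using bounded_linear.has_derivative[OF assms(1) assms(2)[unfolded frechet_derivative_works]]
  by (subst pd_eqI, assumption) (simp add: pd_def)

lemma pd_add:
  assumes "\<phi> differentiable at y" "\<psi> differentiable at y"
  shows "pd i (\<lambda>z. \<phi> z + \<psi> z) y = pd i \<phi> y + pd i \<psi> y"
  using has_derivative_add[OF assms[unfolded frechet_derivative_works]]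
  by (subst pd_eqI, assumption) (simp add: pd_def)

lemma pd_diff:
  assumes "\<phi> differentiable at y" "\<psi> differentiable at y"
  shows "pd i (\<lambda>z. \<phi> z - \<psi> z) y = pd i \<phi> y - pd i \<psi> y"
  using has_derivative_diff[OF assms[unfolded frechet_derivative_works]]
  by (subst pd_eqI, assumption) (simp add: pd_def)

lemma pd_const [simp]: "pd i (\<lambda>z. c) y = 0"
  by (simp add: pd_def)

lemma pd_scaleR:
  assumes "\<phi> differentiable at y" "\<psi> differentiable at y"
  shows "pd i (\<lambda>z. \<phi> z *\<^sub>R \<psi> z) y = \<phi> y *\<^sub>R pd i \<psi> y + pd i \<phi> y *\<^sub>R \<psi> y"
  using has_derivative_scaleR[OF assms[unfolded frechet_derivative_works]]
  by (subst pd_eqI, assumption) (simp add: pd_def)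

lemma norm_frechet_le:
  fixes \<phi> :: "real^'n \<Rightarrow> 'b::real_normed_vector"
  assumes "\<phi> differentiable at y" "\<And>i. norm (pd i \<phi> y) \<le> B"
  shows "norm (frechet_derivative \<phi> (at y) v) \<le> real CARD('n) * B * norm v"
proof -
  let ?D = "frechet_derivative \<phi> (at y)"
  have lin: "linear ?D" by (rule linear_frechet_derivative[OF assms(1)])
  have "v = (\<Sum>i\<in>UNIV. v $ i *\<^sub>R axis i 1)"
    by (simp add: basis_expansion[symmetric] scalar_mult_eq_scaleR[symmetric])
  then have "?D v = ?D (\<Sum>i\<in>UNIV. v $ i *\<^sub>R axis i 1)" by (rule arg_cong)
  also have "\<dots> = (\<Sum>i\<in>UNIV. v $ i *\<^sub>R ?D (axis i 1))"
    by (simp add: linear_sum[OF lin] linear_cmul[OF lin])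
  also have "norm \<dots> \<le> (\<Sum>i\<in>(UNIV::'n set). norm v * B)"
  proof (rule sum_norm_le)
    fix i
    have "norm (pd i \<phi> y) \<le> B" by (rule assms)
    then show "norm (v $ i *\<^sub>R ?D (axis i 1)) \<le> norm v * B"
      unfolding norm_scaleR pd_def
      by (intro mult_mono component_le_norm_cart) auto
  qed
  finally show ?thesis by (simp add: mult.commute mult.left_commute)
qed

lemma lipschitz_from_pd:
  fixes \<phi> :: "real^'n \<Rightarrow> 'b::real_normed_vector"
  assumes "convex U" "\<And>y. y \<in> U \<Longrightarrow> \<phi> differentiable at y"
    "\<And>i y. y \<in> U \<Longrightarrow> norm (pd i \<phi> y) \<le> B" "y \<in> U" "y' \<in> U"
  shows "norm (\<phi> y - \<phi> y') \<le> real CARD('n) * B * dist y y'"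
  unfolding dist_norm
proof (rule differentiable_bound[OF assms(1) _ _ assms(4,5)])
  fix x assume x: "x \<in> U"
  show "(\<phi> has_derivative frechet_derivative \<phi> (at x)) (at x within U)"
    using assms(2)[OF x] by (simp add: frechet_derivative_works has_derivative_at_withinI)
  show "onorm (frechet_derivative \<phi> (at x)) \<le> real CARD('n) * B"
    by (rule onorm_le) (rule norm_frechet_le[OF assms(2,3)[OF x]])
qed

text \<open>\<open>pds\<close> applies the head of its list last, whereas \<open>hc\<close> below
  recurses into a first derivative; this rule turns one order into the other.\<close>

lemma pds_snoc: "pds (is @ [i]) \<phi> = pds is (pd i \<phi>)"
  by (induction "is") auto

subsection \<open>A scaled Hoelder norm\<close>

text \<open>\<open>hc m \<delta> A l U \<phi>\<close> says that \<open>\<phi>\<close> has \<open>C\<^sup>m\<^sup>,\<^sup>\<delta>\<close>-norm at most \<open>A\<close> on \<open>U\<close>, measured at length scale \<open>l\<close>.\<close>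

primrec hc :: "nat \<Rightarrow> real \<Rightarrow> real \<Rightarrow> real \<Rightarrow> (real^'n) set \<Rightarrow> (real^'n \<Rightarrow> 'b::real_normed_vector) \<Rightarrow> bool" where
  "hc 0 \<delta> A l U \<phi> \<longleftrightarrow> (\<forall>y\<in>U. norm (\<phi> y) \<le> A) \<and>
     (\<forall>y\<in>U. \<forall>y'\<in>U. norm (\<phi> y - \<phi> y') \<le> A * (dist y y' / l) powr \<delta>)"
| "hc (Suc m) \<delta> A l U \<phi> \<longleftrightarrow> (\<forall>y\<in>U. norm (\<phi> y) \<le> A) \<and>
     (\<forall>y\<in>U. \<phi> differentiable at y) \<and> (\<forall>i. hc m \<delta> (A / l) l U (pd i \<phi>))"

lemma hc_bound: "hc m \<delta> A l U \<phi> \<Longrightarrow> y \<in> U \<Longrightarrow> norm (\<phi> y) \<le> A"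
  by (cases m) auto

lemma hc_mono:
  assumes "hc m \<delta> A l U \<phi>" "A \<le> A'" "0 \<le> A'" "0 < l'" "l' \<le> l" "U' \<subseteq> U" "0 < \<delta>"
  shows "hc m \<delta> A' l' U' \<phi>"
  using assms(1-3)
proof (induction m arbitrary: A A' \<phi>)
  case 0
  have "A * (dist y y' / l) powr \<delta> \<le> A' * (dist y y' / l') powr \<delta>" for y y' :: "real^'a"
    using 0 assms by (intro mult_mono powr_mono2 divide_left_mono) auto
  then have "norm (\<phi> y - \<phi> y') \<le> A' * (dist y y' / l') powr \<delta>" if "y \<in> U'" "y' \<in> U'" for y y'
    using 0(1) assms(6) that unfolding hc.simps by (blast intro: order_trans)
  moreover have "norm (\<phi> y) \<le> A'" if "y \<in> U'" for y
    using 0(1,2) assms(6) that by force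
  ultimately show ?case by simp
next
  case (Suc m)
  have "A / l \<le> A' / l'" using Suc.prems assms by (intro frac_le) auto
  moreover have "0 \<le> A' / l'" using Suc.prems assms by auto
  ultimately have "hc m \<delta> (A' / l') l' U' (pd i \<phi>)" for i
    by (intro Suc.IH[of "A / l"]) (use Suc.prems in auto)
  moreover have "norm (\<phi> y) \<le> A'" if "y \<in> U'" for y
    using Suc.prems assms(6) that by force
  ultimately show ?case using Suc.prems(1) assms(6) by auto
qed

lemma hc_cong:
  assumes "open U" "\<And>z. z \<in> U \<Longrightarrow> \<phi> z = \<psi> z"
  shows "hc m \<delta> A l U \<phi> \<longleftrightarrow> hc m \<delta> A l U \<psi>"
  using assms(2)
proof (induction m arbitrary: A \<phi> \<psi>)
  case 0
  then show ?case by auto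
next
  case (Suc m)
  have "hc m \<delta> (A/l) l U (pd i \<phi>) \<longleftrightarrow> hc m \<delta> (A/l) l U (pd i \<psi>)" for i
    by (rule Suc.IH) (rule pd_cong_open[OF assms(1) _ Suc.prems])
  then show ?case
    using Suc.prems differentiable_cong_open[OF assms(1) _ Suc.prems] by auto
qed

lemma hc_congI:
  "hc m \<delta> A l U \<psi> \<Longrightarrow> open U \<Longrightarrow> (\<And>z. z \<in> U \<Longrightarrow> \<phi> z = \<psi> z) \<Longrightarrow> hc m \<delta> A l U \<phi>"
  using hc_cong by blast

lemma hc_scale:
  assumes "hc m \<delta> A l U \<phi>" "open U"
  shows "hc m \<delta> (\<bar>c\<bar> * A) l U (\<lambda>y. c *\<^sub>R \<phi> y)"
  using assms(1)
proof (induction m arbitrary: A \<phi>)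
  case 0
  have "norm (c *\<^sub>R \<phi> y - c *\<^sub>R \<phi> y') = \<bar>c\<bar> * norm (\<phi> y - \<phi> y')" for y y'
    by (metis norm_scaleR scaleR_right_diff_distrib)
  then show ?case using 0 by (auto simp: mult_left_mono mult.assoc)
next
  case (Suc m)
  have "hc m \<delta> (\<bar>c\<bar> * A / l) l U (pd i (\<lambda>y. c *\<^sub>R \<phi> y))" for i
  proof -
    have "hc m \<delta> (\<bar>c\<bar> * (A / l)) l U (\<lambda>y. c *\<^sub>R pd i \<phi> y)"
      by (rule Suc.IH) (use Suc.prems in auto)
    moreover have "pd i (\<lambda>y. c *\<^sub>R \<phi> y) y = c *\<^sub>R pd i \<phi> y" if "y \<in> U" for y
      using Suc.prems that by (intro pd_bounded_linear bounded_linear_scaleR_right) auto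
    ultimately show ?thesis by (simp add: hc_congI[OF _ assms(2)])
  qed
  then show ?case using Suc.prems by (auto simp: mult_left_mono)
qed

lemma hc_bounded_linear:
  assumes "hc m \<delta> A l U \<phi>" "open U" "bounded_linear L" "\<And>z. norm (L z) \<le> norm z"
  shows "hc m \<delta> A l U (\<lambda>y. L (\<phi> y))"
  using assms(1)
proof (induction m arbitrary: A \<phi>)
  case 0
  have "norm (L (\<phi> y) - L (\<phi> y')) \<le> norm (\<phi> y - \<phi> y')" for y y'
    by (metis assms(3,4) bounded_linear.linear linear_diff)
  then show ?case using 0 assms(4) unfolding hc.simps by (meson order_trans)
next
  case (Suc m)
  have "hc m \<delta> (A / l) l U (pd i (\<lambda>y. L (\<phi> y)))" for i
  proof -
    have "hc m \<delta> (A / l) l U (\<lambda>y. L (pd i \<phi> y))"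
      using Suc by auto
    moreover have "pd i (\<lambda>y. L (\<phi> y)) y = L (pd i \<phi> y)" if "y \<in> U" for y
      using Suc.prems that by (intro pd_bounded_linear assms) auto
    ultimately show ?thesis by (simp add: hc_congI[OF _ assms(2)])
  qed
  moreover have "(\<lambda>y. L (\<phi> y)) differentiable at y" if "y \<in> U" for y
    using Suc.prems that bounded_linear.has_derivative[OF assms(3)]
    unfolding hc.simps differentiable_def by blast
  ultimately show ?case using Suc.prems assms(4) unfolding hc.simps by (meson order_trans)
qed

lemma hc_add:
  assumes "hc m \<delta> A l U \<phi>" "hc m \<delta> B l U \<psi>" "open U"
  shows "hc m \<delta> (A + B) l U (\<lambda>y. \<phi> y + \<psi> y)"
  using assms(1,2)
proof (induction m arbitrary: A B \<phi> \<psi>)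
  case 0
  have "norm (\<phi> y + \<psi> y - (\<phi> y' + \<psi> y')) \<le> norm (\<phi> y - \<phi> y') + norm (\<psi> y - \<psi> y')" for y y'
    by (metis add_diff_add norm_triangle_ineq)
  then have "norm (\<phi> y + \<psi> y - (\<phi> y' + \<psi> y')) \<le> (A + B) * (dist y y' / l) powr \<delta>"
    if "y \<in> U" "y' \<in> U" for y y'
  proof -
    have "norm (\<phi> y - \<phi> y') + norm (\<psi> y - \<psi> y')
        \<le> A * (dist y y' / l) powr \<delta> + B * (dist y y' / l) powr \<delta>"
      using 0 that by (intro add_mono) auto
    then show ?thesis
      by (smt (verit) add_diff_add norm_triangle_ineq distrib_right)
  qed
  then show ?case using 0 by (auto intro: norm_triangle_mono)
next
  case (Suc m)
  have "hc m \<delta> ((A + B) / l) l U (pd i (\<lambda>y. \<phi> y + \<psi> y))" for i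
  proof -
    have "hc m \<delta> (A / l + B / l) l U (\<lambda>y. pd i \<phi> y + pd i \<psi> y)"
      using Suc by auto
    moreover have "pd i (\<lambda>y. \<phi> y + \<psi> y) y = pd i \<phi> y + pd i \<psi> y" if "y \<in> U" for y
      using Suc.prems that by (intro pd_add) auto
    ultimately show ?thesis by (simp add: hc_congI[OF _ assms(3)] add_divide_distrib)
  qed
  then show ?case using Suc.prems by (auto intro: norm_triangle_mono)
qed

lemma le_powr_of_le_one: "0 \<le> t \<Longrightarrow> t \<le> 1 \<Longrightarrow> \<delta> \<le> 1 \<Longrightarrow> (t::real) \<le> t powr \<delta>"
  by (cases "t = 0") (use powr_mono'[of \<delta> 1 t] in auto)

lemma one_le_card: "1 \<le> real CARD('n::finite)"
  by (simp add: Suc_le_eq)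

text \<open>Below the scale \<open>l\<close> the Lipschitz bound wins because t \<le> t^\<delta> for
  t \<le> 1; above it the bound 2 A wins, as the factor on the right is then at least 1.\<close>

lemma holder_of_lipschitz:
  fixes y y' :: "'a::metric_space"
  assumes "x \<le> 2 * A" "x \<le> B * (dist y y' / l)" "2 * A \<le> C" "B \<le> C" "0 < l" "0 < \<delta>" "\<delta> \<le> 1" "0 \<le> A"
  shows "x \<le> C * (dist y y' / l) powr \<delta>"
proof (cases "dist y y' / l \<le> 1")
  case True
  have "x \<le> C * (dist y y' / l)"
    using assms(5) by (intro order_trans[OF assms(2)] mult_right_mono assms(4)) auto
  also have "\<dots> \<le> C * (dist y y' / l) powr \<delta>"
    using True assms by (intro mult_left_mono le_powr_of_le_one) auto
  finally show ?thesis .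
next
  case False
  then have "1 \<le> (dist y y' / l) powr \<delta>"
    using assms by (intro ge_one_powr_ge_zero) auto
  then have "C * 1 \<le> C * (dist y y' / l) powr \<delta>"
    using assms by (intro mult_left_mono) auto
  then show ?thesis using assms by simp
qed

text \<open>Convexity of \<open>U\<close> turns the bound on first derivatives into a Lipschitz
  bound, from which the Hoelder seminorm of one order less is recovered. The mean value inequality
  contributes \<open>CARD('n)\<close>, the interpolation with the sup bound the factor 2.\<close>

lemma hc_down:
  fixes \<phi> :: "real^'n \<Rightarrow> 'b::real_normed_vector"
  assumes "hc (Suc m) \<delta> A l U \<phi>" "convex U" "0 < l" "0 \<le> A" "0 < \<delta>" "\<delta> \<le> 1"
  shows "hc m \<delta> (2 * real CARD('n) * A) l U \<phi>"
  using assms(1,4)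
proof (induction m arbitrary: A \<phi>)
  case 0
  have c: "A * 1 \<le> A * real CARD('n)"
    by (rule mult_left_mono[OF one_le_card 0(2)])
  have "norm (\<phi> y - \<phi> y') \<le> 2 * real CARD('n) * A * (dist y y' / l) powr \<delta>"
    if "y \<in> U" "y' \<in> U" for y y'
  proof (rule holder_of_lipschitz[where A = A and B = "real CARD('n) * A"])
    have "norm (\<phi> y) \<le> A" "norm (\<phi> y') \<le> A" using 0 that by auto
    then show "norm (\<phi> y - \<phi> y') \<le> 2 * A"
      using norm_triangle_ineq4[of "\<phi> y" "\<phi> y'"] by linarith
    have "norm (\<phi> y - \<phi> y') \<le> real CARD('n) * (A / l) * dist y y'"
      by (rule lipschitz_from_pd[OF assms(2)]) (use 0 that in auto)
    then show "norm (\<phi> y - \<phi> y') \<le> real CARD('n) * A * (dist y y' / l)" by simp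
  qed (use assms 0 c in \<open>auto simp: mult.commute\<close>)
  moreover have "norm (\<phi> y) \<le> 2 * real CARD('n) * A" if "y \<in> U" for y
  proof -
    have "norm (\<phi> y) \<le> A" using 0 that by auto
    then show ?thesis using c 0(2) by (simp add: mult.commute)
  qed
  ultimately show ?case by auto
next
  case (Suc m)
  have "A * 1 \<le> A * real CARD('n)"
    by (rule mult_left_mono[OF one_le_card Suc.prems(2)])
  then have dA: "A \<le> A * real CARD('n)" by simp
  have "norm (\<phi> y) \<le> 2 * real CARD('n) * A" if "y \<in> U" for y
  proof -
    have "norm (\<phi> y) \<le> A" using Suc.prems that by auto
    then show ?thesis using dA Suc.prems(2) by (simp add: mult.commute)
  qed
  moreover have "hc m \<delta> (2 * real CARD('n) * (A / l)) l U (pd i \<phi>)" for i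
    by (rule Suc.IH) (use Suc.prems assms in auto)
  ultimately show ?case using Suc.prems(1) by auto
qed

text \<open>Leibniz rule by induction. Each order produces two summands, and in each of them one
  factor is lowered by \<open>hc_down\<close> at a cost of 2 d; hence the growth by 4 d per
  order.\<close>

lemma hc_mult:
  fixes \<phi> :: "real^'n \<Rightarrow> real" and \<psi> :: "real^'n \<Rightarrow> 'b::real_normed_vector"
  assumes "hc m \<delta> A l U \<phi>" "hc m \<delta> B l U \<psi>" "open U" "convex U" "0 < l" "0 \<le> A" "0 \<le> B" "0 < \<delta>" "\<delta> \<le> 1"
  shows "hc m \<delta> (2 * (4 * real CARD('n)) ^ m * (A * B)) l U (\<lambda>y. \<phi> y *\<^sub>R \<psi> y)"
  using assms(1,2,6,7)
proof (induction m arbitrary: A B \<phi> \<psi>)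
  case 0
  have "norm (\<phi> y *\<^sub>R \<psi> y - \<phi> y' *\<^sub>R \<psi> y') \<le> 2 * (A * B) * (dist y y' / l) powr \<delta>"
    if "y \<in> U" "y' \<in> U" for y y'
  proof -
    have "\<phi> y *\<^sub>R \<psi> y - \<phi> y' *\<^sub>R \<psi> y' = \<phi> y *\<^sub>R (\<psi> y - \<psi> y') + (\<phi> y - \<phi> y') *\<^sub>R \<psi> y'"
      by (simp add: algebra_simps)
    also have "norm \<dots> \<le> A * (B * (dist y y' / l) powr \<delta>) + (A * (dist y y' / l) powr \<delta>) * B"
      using 0 that by (intro norm_triangle_mono) (auto intro!: mult_mono)
    finally show ?thesis by (simp add: algebra_simps)
  qed
  moreover have "norm (\<phi> y *\<^sub>R \<psi> y) \<le> 2 * (A * B)" if "y \<in> U" for y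
  proof -
    have "\<bar>\<phi> y\<bar> * norm (\<psi> y) \<le> A * B" using 0 that by (intro mult_mono) auto
    moreover have "0 \<le> A * B" using 0 by simp
    ultimately show ?thesis unfolding norm_scaleR by linarith
  qed
  ultimately show ?case by auto
next
  case (Suc m)
  let ?d = "real CARD('n)"
  let ?c = "2 * (4 * ?d) ^ m"
  have d1: "1 \<le> ?d" by (rule one_le_card)
  have "hc m \<delta> (2 * (4 * ?d) ^ Suc m * (A * B) / l) l U (pd i (\<lambda>y. \<phi> y *\<^sub>R \<psi> y))" for i
  proof -
    have 1: "hc m \<delta> (2 * ?d * A) l U \<phi>" "hc m \<delta> (2 * ?d * B) l U \<psi>"
      using Suc.prems assms by (auto intro!: hc_down simp del: hc.simps)
    have "hc m \<delta> (?c * ((2 * ?d * A) * (B / l)) + ?c * ((A / l) * (2 * ?d * B))) l U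
       (\<lambda>y. \<phi> y *\<^sub>R pd i \<psi> y + pd i \<phi> y *\<^sub>R \<psi> y)"
      using Suc.prems assms d1 1 by (intro hc_add Suc.IH) auto
    also have "?c * ((2 * ?d * A) * (B / l)) + ?c * ((A / l) * (2 * ?d * B)) = 2 * (4 * ?d) ^ Suc m * (A * B) / l"
      by (simp add: algebra_simps)
    finally show ?thesis
      by (rule hc_congI[OF _ assms(3)]) (use Suc.prems in \<open>auto intro!: pd_scaleR\<close>)
  qed
  moreover have "norm (\<phi> y *\<^sub>R \<psi> y) \<le> 2 * (4 * ?d) ^ Suc m * (A * B)" if "y \<in> U" for y
  proof -
    have "\<bar>\<phi> y\<bar> * norm (\<psi> y) \<le> A * B" using Suc.prems that by (intro mult_mono) auto
    moreover have "1 * (A * B) \<le> 2 * (4 * ?d) ^ Suc m * (A * B)"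
    proof (rule mult_right_mono)
      have "1 \<le> (4 * ?d) ^ Suc m" using d1 by (intro one_le_power) linarith
      then show "1 \<le> 2 * (4 * ?d) ^ Suc m" by linarith
    qed (use Suc.prems in auto)
    ultimately show ?thesis unfolding norm_scaleR by linarith
  qed
  ultimately show ?case using Suc.prems by (auto simp del: power_Suc)
qed

text \<open>Each of the m derivatives costs one factor t, and the Hoelder seminorm costs t^\<delta>
  \<le> t.\<close>

lemma hc_rescale_up:
  assumes "hc m \<delta> A l U \<phi>" "1 \<le> t" "0 < l" "0 \<le> A" "0 < \<delta>" "\<delta> \<le> 1"
  shows "hc m \<delta> (A * t ^ Suc m) (t * l) U \<phi>"
  using assms(1,4)
proof (induction m arbitrary: A \<phi>)
  case 0
  have t: "t powr \<delta> \<le> t" using powr_mono[of \<delta> 1 t] assms by simp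
  have "A * (dist y y' / l) powr \<delta> \<le> A * t * (dist y y' / (t * l)) powr \<delta>" for y y' :: "real^'a"
  proof -
    have "(dist y y' / l) powr \<delta> = (t * (dist y y' / (t * l))) powr \<delta>"
      using assms by simp
    also have "\<dots> = t powr \<delta> * (dist y y' / (t * l)) powr \<delta>"
      using assms by (subst powr_mult) auto
    also have "\<dots> \<le> t * (dist y y' / (t * l)) powr \<delta>"
      using t by (intro mult_right_mono) auto
    finally have "(dist y y' / l) powr \<delta> \<le> t * (dist y y' / (t * l)) powr \<delta>" .
    from mult_left_mono[OF this 0(2)] show ?thesis by (simp add: mult.assoc)
  qed
  moreover have "A * 1 \<le> A * t" using 0 assms by (intro mult_left_mono) auto
  ultimately have "norm (\<phi> y - \<phi> y') \<le> A * t * (dist y y' / (t * l)) powr \<delta>" "norm (\<phi> y) \<le> A * t"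
    if "y \<in> U" "y' \<in> U" for y y'
    using 0(1) that unfolding hc.simps mult_1_right by (blast intro: order_trans)+
  then show ?case by auto
next
  case (Suc m)
  have "A * 1 \<le> A * t ^ Suc (Suc m)"
    using Suc.prems assms by (intro mult_left_mono one_le_power) auto
  moreover have "hc m \<delta> ((A / l) * t ^ Suc m) (t * l) U (pd i \<phi>)" for i
    by (rule Suc.IH) (use Suc.prems assms in auto)
  moreover have "A * t ^ Suc (Suc m) / (t * l) = (A / l) * t ^ Suc m"
    using assms by (simp add: field_simps)
  moreover have "norm (\<phi> y) \<le> A" if "y \<in> U" for y
    using Suc.prems(1) that by auto
  ultimately show ?case using Suc.prems(1) unfolding hc.simps mult_1_right by (auto simp del: power_Suc intro: order_trans)
qed

text \<open>The gain (l/D)^\<delta> behind the cancellation of the bad pieces. Measured at the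
  smaller scale \<open>l\<close>, a derivative of order j \<ge> 1 gains (l/D)^j \<le>
  (l/D)^\<delta>; order zero has no such gain, which is why the value at \<open>y0\<close> is
  subtracted.\<close>

lemma hc_small:
  fixes k :: "real^'n \<Rightarrow> 'b::real_normed_vector"
  assumes "hc m \<delta> A D U k" "V \<subseteq> U" "open V" "convex U" "y0 \<in> U" "0 < l" "l \<le> D" "0 \<le> A" "0 < \<delta>" "\<delta> \<le> 1"
    "1 \<le> \<tau>" "\<And>y. y \<in> V \<Longrightarrow> dist y y0 \<le> \<tau> * l"
  shows "hc m \<delta> (real CARD('n) * \<tau> * A * (l / D) powr \<delta>) l V (\<lambda>y. k y - k y0)"
proof -
  let ?d = "real CARD('n)" and ?q = "(l / D) powr \<delta>"
  have d1: "1 \<le> ?d" by (rule one_le_card)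
  have D: "0 < D" using assms by linarith
  have q: "l / D \<le> ?q" using assms D by (intro le_powr_of_le_one) auto
  have q0: "0 \<le> ?q" by simp
  have dt: "1 \<le> ?d * \<tau>" using d1 assms(11) mult_mono[of 1 ?d 1 \<tau>] by simp
  have Aq: "1 * (A * ?q) \<le> ?d * \<tau> * (A * ?q)" using dt assms by (intro mult_right_mono) auto
  show ?thesis
  proof (cases m)
    case 0
    have 1: "norm (k y - k y0) \<le> ?d * \<tau> * A * ?q" if "y \<in> V" for y
    proof -
      have "norm (k y - k y0) \<le> A * (dist y y0 / D) powr \<delta>"
        using assms(1,2,5) that 0 by auto
      also have "\<dots> \<le> A * (\<tau> * l / D) powr \<delta>"
        using assms(6-12) that D by (intro mult_left_mono powr_mono2 divide_right_mono) auto
      also have "(\<tau> * l / D) powr \<delta> = \<tau> powr \<delta> * ?q"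
        using assms D powr_mult[of \<tau> "l/D" \<delta>] by simp
      also have "A * (\<tau> powr \<delta> * ?q) \<le> A * (\<tau> * ?q)"
        using assms powr_mono[of \<delta> 1 \<tau>] by (intro mult_left_mono mult_right_mono) auto
      also have "\<dots> \<le> A * (?d * \<tau> * ?q)"
        using assms d1 by (intro mult_left_mono mult_right_mono) (auto simp: mult_ac)
      finally show ?thesis by (simp add: mult_ac)
    qed
    have 2: "norm (k y - k y') \<le> ?d * \<tau> * A * ?q * (dist y y' / l) powr \<delta>" if "y \<in> V" "y' \<in> V" for y y'
    proof -
      have "norm (k y - k y') \<le> A * (dist y y' / D) powr \<delta>"
        using assms(1,2) that 0 by auto
      also have "(dist y y' / D) powr \<delta> = ?q * (dist y y' / l) powr \<delta>"
        using assms D powr_mult[of "l/D" "dist y y' / l" \<delta>] by simp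
      also have "A * (?q * (dist y y' / l) powr \<delta>) \<le> ?d * \<tau> * A * ?q * (dist y y' / l) powr \<delta>"
        using mult_right_mono[OF Aq, of "(dist y y' / l) powr \<delta>"] by (simp add: mult_ac)
      finally show ?thesis .
    qed
    show ?thesis using 0 1 2 by auto
  next
    case (Suc n)
    have dk: "\<And>y. y \<in> U \<Longrightarrow> k differentiable at y" and hk: "\<And>i. hc n \<delta> (A / D) D U (pd i k)"
      using assms(1) Suc by auto
    have 1: "norm (k y - k y0) \<le> ?d * \<tau> * A * ?q" if "y \<in> V" for y
    proof -
      have "norm (k y - k y0) \<le> ?d * (A / D) * dist y y0"
        using that assms(2,5) hc_bound[OF hk] by (intro lipschitz_from_pd[OF assms(4) dk]) auto
      also have "\<dots> \<le> ?d * (A / D) * (\<tau> * l)"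
        using assms that D by (intro mult_left_mono) auto
      also have "\<dots> = ?d * \<tau> * A * (l / D)" by simp
      also have "\<dots> \<le> ?d * \<tau> * A * ?q" using q assms by (intro mult_left_mono) auto
      finally show ?thesis .
    qed
    have "hc n \<delta> (?d * \<tau> * A * ?q / l) l V (pd i (\<lambda>y. k y - k y0))" for i
    proof -
      have e: "A / D = A * (l / D) / l" using assms D by simp
      have "A * (l / D) \<le> ?d * \<tau> * A * ?q"
        using mult_left_mono[OF q assms(8)] Aq by (simp add: mult_ac)
      then have "A * (l / D) / l \<le> ?d * \<tau> * A * ?q / l" using assms by (intro divide_right_mono) auto
      then have "hc n \<delta> (?d * \<tau> * A * ?q / l) l V (pd i k)"
        unfolding e[symmetric] using assms d1 q0
        by (intro hc_mono[OF hk, of "?d * \<tau> * A * ?q / l" l V]) auto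
      then show ?thesis
        by (rule hc_congI[OF _ assms(3)]) (use assms(2) dk in \<open>auto simp: pd_diff\<close>)
    qed
    then show ?thesis using 1 dk assms(2) Suc by auto
  qed
qed

text \<open>Extension by zero. The critical pairs have one point in \<open>S\<close> and the other
  outside \<open>U\<close>; these are at least \<kappa> l apart, so their Hoelder quotient is
  governed by the sup bound, with \<kappa>^\<delta> \<ge> \<kappa>.\<close>

lemma hc_extend:
  fixes \<phi> :: "real^'n \<Rightarrow> 'b::real_normed_vector"
  assumes "hc m \<delta> A l U \<phi>" "open U" "closed S" "S \<subseteq> U" "\<And>y. y \<notin> S \<Longrightarrow> \<phi> y = 0"
    "\<And>y. y \<in> S \<Longrightarrow> ball y (\<kappa> * l) \<subseteq> U" "0 < \<kappa>" "\<kappa> \<le> 1" "0 < l" "0 \<le> A" "0 < \<delta>" "\<delta> \<le> 1"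
  shows "hc m \<delta> (2 * A / \<kappa>) l UNIV \<phi>"
  using assms(1,5,10)
proof (induction m arbitrary: A \<phi>)
  case 0
  have kA: "A \<le> A / \<kappa>" using 0 assms by (simp add: field_simps mult_left_le)
  have A0: "0 \<le> A / \<kappa>" using 0 assms by simp
  have far: "norm (\<phi> y) \<le> 2 * A / \<kappa> * (dist y y' / l) powr \<delta>" if "y \<in> S" "y' \<notin> U" for y y'
  proof -
    have "\<not> dist y y' < \<kappa> * l" using assms(6)[OF that(1)] that(2) by (metis mem_ball subsetD)
    then have "\<kappa> \<le> dist y y' / l" using assms by (auto simp: field_simps)
    then have "\<kappa> powr \<delta> \<le> (dist y y' / l) powr \<delta>" using assms by (intro powr_mono2) auto
    moreover have "\<kappa> \<le> \<kappa> powr \<delta>" using assms by (intro le_powr_of_le_one) auto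
    ultimately have "2 * A / \<kappa> * \<kappa> \<le> 2 * A / \<kappa> * (dist y y' / l) powr \<delta>"
      using A0 by (intro mult_left_mono) auto
    then have "2 * A \<le> 2 * A / \<kappa> * (dist y y' / l) powr \<delta>" using assms by simp
    moreover have "norm (\<phi> y) \<le> A" using 0 that assms(4) by auto
    ultimately show ?thesis using 0 by linarith
  qed
  have "norm (\<phi> y - \<phi> y') \<le> 2 * A / \<kappa> * (dist y y' / l) powr \<delta>" for y y'
  proof -
    consider "y \<in> U" "y' \<in> U" | "y \<notin> S" "y' \<notin> S" | "y \<in> S" "y' \<notin> U" | "y' \<in> S" "y \<notin> U"
      using assms(4) by blast
    then show ?thesis
    proof cases
      case 1
      then have "norm (\<phi> y - \<phi> y') \<le> A * (dist y y' / l) powr \<delta>" using 0 by auto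
      also have "\<dots> \<le> 2 * A / \<kappa> * (dist y y' / l) powr \<delta>"
        using kA A0 by (intro mult_right_mono) auto
      finally show ?thesis .
    next
      case 2
      then show ?thesis using 0 assms by auto
    next
      case 3
      then have "\<phi> y' = 0" using 0 assms(4) by auto
      then show ?thesis using far[OF 3] by simp
    next
      case 4
      then have "\<phi> y = 0" using 0 assms(4) by auto
      then show ?thesis using far[OF 4] by (simp add: dist_commute)
    qed
  qed
  moreover have "norm (\<phi> y) \<le> 2 * A / \<kappa>" for y
  proof (cases "y \<in> S")
    case True
    then have "norm (\<phi> y) \<le> A" using 0 assms(4) by auto
    then show ?thesis using kA A0 by linarith
  next
    case False
    then show ?thesis using 0 A0 by simp
  qed
  ultimately show ?case by auto
next
  case (Suc m)
  have kA: "A \<le> A / \<kappa>" using Suc.prems assms by (simp add: field_simps mult_left_le)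
  have A0: "0 \<le> A / \<kappa>" using Suc.prems assms by simp
  have op: "open (- S)" using assms by auto
  have "pd i \<phi> y = 0" if "y \<notin> S" for i y
    using pd_cong_open[OF op, of y \<phi> "\<lambda>_. 0" i] that Suc.prems by auto
  then have "hc m \<delta> (2 * (A / l) / \<kappa>) l UNIV (pd i \<phi>)" for i
    using Suc.prems assms by (intro Suc.IH) auto
  moreover have "\<phi> differentiable at y" for y
    using differentiable_cong_open[OF op, of y \<phi> "\<lambda>_. 0"] Suc.prems assms(4)
    by (cases "y \<in> S") auto
  moreover have "norm (\<phi> y) \<le> 2 * A / \<kappa>" for y
  proof (cases "y \<in> S")
    case True
    then have "norm (\<phi> y) \<le> A" using Suc.prems assms(4) by auto
    then show ?thesis using kA A0 by linarith
  next
    case False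
    then show ?thesis using Suc.prems A0 by simp
  qed
  ultimately show ?case by (auto simp: field_simps)
qed

text \<open>Unrolls the recursion into the list-indexed form in which kernels and test functions are
  specified.\<close>

lemma hc_iff:
  fixes \<phi> :: "real^'n \<Rightarrow> 'b::real_normed_vector"
  assumes "0 < l"
  shows "hc m \<delta> A l U \<phi> \<longleftrightarrow>
    (\<forall>is. length is < m \<longrightarrow> (\<forall>y\<in>U. pds is \<phi> differentiable at y)) \<and>
    (\<forall>is. length is \<le> m \<longrightarrow> (\<forall>y\<in>U. norm (pds is \<phi> y) \<le> A / l ^ length is)) \<and>
    (\<forall>is. length is = m \<longrightarrow> (\<forall>y\<in>U. \<forall>y'\<in>U.
       norm (pds is \<phi> y - pds is \<phi> y') \<le> A / l ^ m * (dist y y' / l) powr \<delta>))"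
proof (induction m arbitrary: A \<phi>)
  case 0
  then show ?case by auto
next
  case (Suc m)
  have split: "(\<forall>is. P is) \<longleftrightarrow> P [] \<and> (\<forall>i is. P (is @ [i]))" for P :: "'n list \<Rightarrow> bool"
    by (metis rev_exhaust)
  show ?case
    unfolding hc.simps Suc.IH
    by (subst (4 5 6) split) (auto simp: pds_snoc field_simps)
qed

lemma hc_continuous_on:
  fixes \<phi> :: "real^'n \<Rightarrow> 'b::real_normed_vector"
  assumes "hc m \<delta> A l U \<phi>" "0 < l" "0 < \<delta>"
  shows "continuous_on U \<phi>"
proof (cases m)
  case (Suc n)
  then show ?thesis using assms(1)
    by (auto intro!: continuous_at_imp_continuous_on differentiable_imp_continuous_within)
next
  case 0
  show ?thesis unfolding continuous_on_def
  proof
    fix x assume x: "x \<in> U"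
    have "((\<lambda>y. A * (dist y x / l) powr \<delta>) \<longlongrightarrow> A * (dist x x / l) powr \<delta>) (at x within U)"
      using assms by (intro tendsto_intros tendsto_powr') auto
    then have "((\<lambda>y. A * (dist y x / l) powr \<delta>) \<longlongrightarrow> 0) (at x within U)"
      by simp
    then show "(\<phi> \<longlongrightarrow> \<phi> x) (at x within U)"
      by (subst Lim_null, rule Lim_null_comparison[rotated])
        (use assms(1) x 0 in \<open>auto simp: eventually_at_filter\<close>)
  qed
qed

subsection \<open>Smooth bumps\<close>

lemma hc_const:
  assumes "\<bar>c\<bar> \<le> A" "0 < l"
  shows "hc m \<delta> A l U (\<lambda>y. c :: real)"
  using assms
proof (induction m arbitrary: A c)
  case 0
  then show ?case by auto
next
  case (Suc m)
  have "pd i (\<lambda>y. c) = (\<lambda>y. 0)" for i :: 'a by (rule ext) simp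
  moreover have "hc m \<delta> (A / l) l U (\<lambda>y. 0 :: real)" by (rule Suc.IH) (use Suc.prems in auto)
  ultimately show ?case using Suc.prems by auto
qed

text \<open>Bounded \<open>C^{m,1}\<close> functions on the line. The Lipschitz condition at the top
  order makes the class independent of \<delta>.\<close>

primrec cb :: "nat \<Rightarrow> (real \<Rightarrow> real) \<Rightarrow> bool" where
  "cb 0 f \<longleftrightarrow> (\<exists>B. (\<forall>t. \<bar>f t\<bar> \<le> B) \<and> (\<forall>s t. \<bar>f s - f t\<bar> \<le> B * \<bar>s - t\<bar>))"
| "cb (Suc m) f \<longleftrightarrow> (\<exists>B. \<forall>t. \<bar>f t\<bar> \<le> B) \<and> (\<exists>f'. (\<forall>t. (f has_real_derivative f' t) (at t)) \<and> cb m f')"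

lemma cb_SucI:
  "(\<And>t. \<bar>f t\<bar> \<le> B) \<Longrightarrow> (\<And>t. (f has_real_derivative f' t) (at t)) \<Longrightarrow> cb m f' \<Longrightarrow> cb (Suc m) f"
  by auto

lemma cb_affine:
  assumes "cb m f"
  shows "cb m (\<lambda>t. c * f (p * t + q))"
  using assms
proof (induction m arbitrary: f c)
  case 0
  then obtain B where B: "\<And>t. \<bar>f t\<bar> \<le> B" "\<And>s t. \<bar>f s - f t\<bar> \<le> B * \<bar>s - t\<bar>" by auto
  have B0: "0 \<le> B" using B(1)[of 0] by linarith
  define B' where "B' = \<bar>c\<bar> * B * (1 + \<bar>p\<bar>)"
  have 1: "\<bar>c * f (p * t + q)\<bar> \<le> B'" for t
  proof -
    have "\<bar>c\<bar> * \<bar>f (p * t + q)\<bar> \<le> \<bar>c\<bar> * B" using B(1) by (intro mult_left_mono) auto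
    also have "\<dots> * 1 \<le> B'" unfolding B'_def using B0 by (intro mult_left_mono) auto
    finally show ?thesis by (simp add: abs_mult)
  qed
  have 2: "\<bar>c * f (p * s + q) - c * f (p * t + q)\<bar> \<le> B' * \<bar>s - t\<bar>" for s t
  proof -
    have "\<bar>c * f (p * s + q) - c * f (p * t + q)\<bar> = \<bar>c\<bar> * \<bar>f (p * s + q) - f (p * t + q)\<bar>"
      by (simp add: abs_mult[symmetric] algebra_simps)
    also have "\<dots> \<le> \<bar>c\<bar> * (B * \<bar>(p * s + q) - (p * t + q)\<bar>)" by (intro mult_left_mono B(2)) auto
    also have "(p * s + q) - (p * t + q) = p * (s - t)" by (simp add: algebra_simps)
    also have "\<bar>c\<bar> * (B * \<bar>p * (s - t)\<bar>) = \<bar>c\<bar> * B * \<bar>p\<bar> * \<bar>s - t\<bar>" by (simp add: abs_mult)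
    also have "\<dots> \<le> B' * \<bar>s - t\<bar>" unfolding B'_def using B0 by (intro mult_right_mono mult_left_mono) auto
    finally show ?thesis .
  qed
  show ?case using 1 2 by auto
next
  case (Suc m)
  then obtain B f' where B: "\<And>t. \<bar>f t\<bar> \<le> B" and f': "\<And>t. (f has_real_derivative f' t) (at t)" "cb m f'" by auto
  have "\<bar>c * f (p * t + q)\<bar> \<le> \<bar>c\<bar> * B" for t
    using B by (auto simp: abs_mult intro!: mult_left_mono)
  moreover have "((\<lambda>t. c * f (p * t + q)) has_real_derivative (c * p) * f' (p * t + q)) (at t)" for t
    by (auto intro!: derivative_eq_intros DERIV_chain2[OF f'(1)])
  ultimately show ?case by (rule cb_SucI) (rule Suc.IH[OF f'(2)])
qed

lemma cb_diff:
  assumes "cb m f" "cb m g"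
  shows "cb m (\<lambda>t. f t - g t)"
  using assms
proof (induction m arbitrary: f g)
  case 0
  then obtain B where B: "\<And>t. \<bar>f t\<bar> \<le> B" "\<And>s t. \<bar>f s - f t\<bar> \<le> B * \<bar>s - t\<bar>" by auto
  from 0 obtain C where C: "\<And>t. \<bar>g t\<bar> \<le> C" "\<And>s t. \<bar>g s - g t\<bar> \<le> C * \<bar>s - t\<bar>" by auto
  have "\<bar>f t - g t\<bar> \<le> B + C" for t using B(1)[of t] C(1)[of t] by linarith
  moreover have "\<bar>(f s - g s) - (f t - g t)\<bar> \<le> (B + C) * \<bar>s - t\<bar>" for s t
    using B(2)[of s t] C(2)[of s t] unfolding distrib_right by linarith
  ultimately show ?case unfolding cb.simps by blast
next
  case (Suc m)
  from Suc.prems obtain B f' where f: "\<And>t. \<bar>f t\<bar> \<le> B" "\<And>t. (f has_real_derivative f' t) (at t)" "cb m f'" by auto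
  from Suc.prems obtain C g' where g: "\<And>t. \<bar>g t\<bar> \<le> C" "\<And>t. (g has_real_derivative g' t) (at t)" "cb m g'" by auto
  have "\<bar>f t - g t\<bar> \<le> B + C" for t using f(1)[of t] g(1)[of t] by linarith
  moreover have "((\<lambda>t. f t - g t) has_real_derivative f' t - g' t) (at t)" for t
    by (intro DERIV_diff f g)
  ultimately show ?case by (rule cb_SucI) (rule Suc.IH[OF f(3) g(3)])
qed

lemma cb_continuous: "cb m f \<Longrightarrow> continuous_on UNIV f"
proof (cases m)
  case 0
  assume "cb m f"
  then obtain B where B: "\<And>s t. \<bar>f s - f t\<bar> \<le> B * \<bar>s - t\<bar>" using 0 by auto
  have "B-lipschitz_on UNIV f"
    using B[of 0 1] B by (intro lipschitz_onI) (auto simp: dist_real_def)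
  then show ?thesis by (rule lipschitz_on_continuous_on)
next
  case (Suc n)
  assume "cb m f"
  then show ?thesis using Suc by (auto intro!: continuous_at_imp_continuous_on intro: DERIV_isCont)
qed

text \<open>Averaging a step over half-size windows gains one derivative and keeps the profile.\<close>

lemma smooth_step_exists: "\<exists>S. cb m S \<and> mono S \<and> (\<forall>t\<le>0. S t = 0) \<and> (\<forall>t\<ge>1. S t = 1)"
proof (induction m)
  case 0
  let ?S = "\<lambda>t::real. max 0 (min 1 t)"
  have "cb 0 ?S" unfolding cb.simps by (intro exI[of _ 1]) auto
  moreover have "mono ?S" by (auto simp: mono_def)
  ultimately show ?case by (intro exI[of _ ?S]) auto
next
  case (Suc m)
  then obtain S where S: "cb m S" "mono S" "\<And>t. t \<le> 0 \<Longrightarrow> S t = 0" "\<And>t. t \<ge> 1 \<Longrightarrow> S t = 1" by blast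
  have ct: "continuous_on UNIV S" by (rule cb_continuous[OF S(1)])
  obtain G where G: "\<And>t. (G has_real_derivative S t) (at t)"
    using einterval_antiderivative[of "-\<infinity>" "\<infinity>" S] ct
    by (auto simp: has_real_derivative_iff_has_vector_derivative continuous_on_eq_continuous_at)
  define R where "R t = G (2 * t) - G (2 * t - 1)" for t
  \<comment> \<open>By the mean value theorem \<open>R t\<close> is a value of \<open>S\<close> in
    the window (2 t - 1, 2 t). This gives the bound and both constant ranges at once: the window is
    negative for t \<le> 0 and lies above 1 for t \<ge> 1.\<close>
  have R: "\<exists>z. 2 * t - 1 < z \<and> z < 2 * t \<and> R t = S z" for t
    using MVT2[of "2 * t - 1" "2 * t" G S] G by (auto simp: R_def)
  have S01: "0 \<le> S z" "S z \<le> 1" for z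
    using S(3)[of "min z 0"] S(4)[of "max z 1"] monoD[OF S(2), of "min z 0" z] monoD[OF S(2), of z "max z 1"] by auto
  have dR: "(R has_real_derivative 2 * S (2 * t) - 2 * S (2 * t - 1)) (at t)" for t
    unfolding R_def by (auto intro!: derivative_eq_intros DERIV_chain2[OF G])
  have "cb m (\<lambda>t. 2 * S (2 * t + 0) - 2 * S (2 * t + (-1)))"
    by (intro cb_diff cb_affine S)
  then have cR: "cb m (\<lambda>t. 2 * S (2 * t) - 2 * S (2 * t - 1))" by simp
  have "\<bar>R t\<bar> \<le> 1" for t using R[of t] S01 by force
  then have "cb (Suc m) R" using dR cR by (rule cb_SucI)
  moreover have "mono R"
  proof (rule monoI)
    fix s t :: real assume st: "s \<le> t"
    have "2 * S (2 * u) - 2 * S (2 * u - 1) \<ge> 0" for u using monoD[OF S(2), of "2 * u - 1" "2 * u"] by simp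
    then have "\<exists>z. (R has_real_derivative z) (at u) \<and> 0 \<le> z" for u using dR by blast
    then show "R s \<le> R t" by (intro DERIV_nonneg_imp_nondecreasing[OF st])
  qed
  moreover have "R t = 0" if "t \<le> 0" for t
  proof -
    obtain z where "z < 2 * t" "R t = S z" using R[of t] by blast
    then show ?thesis using S(3)[of z] that by simp
  qed
  moreover have "R t = 1" if "t \<ge> 1" for t
  proof -
    obtain z where "2 * t - 1 < z" "R t = S z" using R[of t] by blast
    then show ?thesis using S(4)[of z] that by simp
  qed
  ultimately show ?case by blast
qed

lemma hc_of_cb:
  fixes i :: "'n::finite"
  assumes "cb m f" "0 < \<delta>" "\<delta> \<le> 1"
  shows "\<exists>C\<ge>1. \<forall>l>0. \<forall>a. \<forall>i. hc m \<delta> C l UNIV (\<lambda>y::real^'n. f ((y $ i - a) / l))"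
  using assms(1)
proof (induction m arbitrary: f)
  case 0
  then obtain B where B: "\<And>t. \<bar>f t\<bar> \<le> B" "\<And>s t. \<bar>f s - f t\<bar> \<le> B * \<bar>s - t\<bar>" by auto
  have B0: "0 \<le> B" using B(1)[of 0] by linarith
  have "\<bar>f ((y $ i - a) / l) - f ((y' $ i - a) / l)\<bar> \<le> max 1 (2 * B) * (dist y y' / l) powr \<delta>"
    if "l > 0" for l a i and y y' :: "real^'n"
  proof (rule holder_of_lipschitz[where A = B and B = B])
    show "\<bar>f ((y $ i - a) / l) - f ((y' $ i - a) / l)\<bar> \<le> 2 * B"
      using B(1)[of "(y $ i - a) / l"] B(1)[of "(y' $ i - a) / l"] by linarith
    have "\<bar>f ((y $ i - a) / l) - f ((y' $ i - a) / l)\<bar> \<le> B * \<bar>(y $ i - a) / l - (y' $ i - a) / l\<bar>"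
      by (rule B(2))
    also have "(y $ i - a) / l - (y' $ i - a) / l = (y - y') $ i / l"
      by (simp add: diff_divide_distrib)
    also have "B * \<bar>(y - y') $ i / l\<bar> \<le> B * (dist y y' / l)"
      using that B0 component_le_norm_cart[of "y - y'" i]
      by (intro mult_left_mono) (auto simp: dist_norm divide_right_mono)
    finally show "\<bar>f ((y $ i - a) / l) - f ((y' $ i - a) / l)\<bar> \<le> B * (dist y y' / l)" .
  qed (use that assms B0 in auto)
  moreover have "\<bar>f t\<bar> \<le> max 1 (2 * B)" for t using B(1)[of t] B0 by linarith
  ultimately show ?case by (intro exI[of _ "max 1 (2 * B)"]) auto
next
  case (Suc m)
  then obtain B f' where f: "\<And>t. \<bar>f t\<bar> \<le> B" "\<And>t. (f has_real_derivative f' t) (at t)" "cb m f'" by auto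
  obtain C where C: "C \<ge> 1" "\<And>l a i. l > 0 \<Longrightarrow> hc m \<delta> C l UNIV (\<lambda>y::real^'n. f' ((y $ i - a) / l))"
    using Suc.IH[OF f(3)] by blast
  have "hc (Suc m) \<delta> (max C B) l UNIV (\<lambda>y::real^'n. f ((y $ i - a) / l))" if l: "l > 0" for l a i
  proof -
    have der: "((\<lambda>y::real^'n. f ((y $ i - a) / l)) has_derivative (\<lambda>v. (v $ i / l) * f' ((y $ i - a) / l))) (at y)" for y
    proof -
      have 1: "((\<lambda>y::real^'n. (y $ i - a) / l) has_derivative (\<lambda>v. v $ i / l)) (at y)"
        using l by (auto intro!: derivative_eq_intros bounded_linear.has_derivative[OF bounded_linear_vec_nth])
      show ?thesis
        using has_derivative_compose[OF 1 f(2)[unfolded has_field_derivative_def]]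
        by (simp add: mult.commute)
    qed
    have pdj: "pd j (\<lambda>y::real^'n. f ((y $ i - a) / l)) = (\<lambda>y. (if i = j then 1 / l else 0) *\<^sub>R f' ((y $ i - a) / l))" for j
      by (rule ext, subst pd_eqI[OF der]) (auto simp: axis_def)
    have sc: "hc m \<delta> (\<bar>if i = j then 1 / l else 0\<bar> * C) l UNIV (\<lambda>y::real^'n. (if i = j then 1 / l else 0) *\<^sub>R f' ((y $ i - a) / l))" for j
      by (rule hc_scale[OF C(2)[OF l]]) simp
    have le: "\<bar>if i = j then 1 / l else 0\<bar> * C \<le> max C B / l" "0 \<le> max C B / l" for j
      using C(1) l by (auto simp: divide_right_mono)
    have "hc m \<delta> (max C B / l) l UNIV (pd j (\<lambda>y::real^'n. f ((y $ i - a) / l)))" for j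
      unfolding pdj by (rule hc_mono[OF sc le l order_refl subset_refl assms(2)])
    moreover have "(\<lambda>y::real^'n. f ((y $ i - a) / l)) differentiable at y" for y
      using der differentiable_def by blast
    moreover have "\<bar>f t\<bar> \<le> max C B" for t using f(1)[of t] by linarith
    ultimately show ?thesis by auto
  qed
  then show ?case using C(1) by (intro exI[of _ "max C B"]) auto
qed

lemma hc_prod:
  fixes g :: "'i \<Rightarrow> real^'n \<Rightarrow> real"
  assumes "finite I" "\<And>i. i \<in> I \<Longrightarrow> hc m \<delta> A l U (g i)" "open U" "convex U" "0 < l" "1 \<le> A" "0 < \<delta>" "\<delta> \<le> 1"
  shows "hc m \<delta> ((2 * (4 * real CARD('n)) ^ m * A) ^ card I) l U (\<lambda>y. \<Prod>i\<in>I. g i y)"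
  using assms(1,2)
proof (induction I rule: finite_induct)
  case empty
  then show ?case using assms hc_const[of 1 1 l] by simp
next
  case (insert i I)
  let ?M = "2 * (4 * real CARD('n)) ^ m"
  have "hc m \<delta> (?M * (A * (?M * A) ^ card I)) l U (\<lambda>y. g i y *\<^sub>R (\<Prod>i\<in>I. g i y))"
    using insert assms by (intro hc_mult) auto
  then show ?case using insert by (simp add: mult_ac)
qed

lemma hc_tensor:
  assumes "cb m f" "0 < \<delta>" "\<delta> \<le> 1"
  shows "\<exists>C\<ge>1. \<forall>l>0. \<forall>p. hc m \<delta> C l UNIV (\<lambda>y::real^'n. \<Prod>i\<in>UNIV. f ((y $ i - p $ i) / l))"
proof -
  obtain C where C: "C \<ge> 1" "\<And>l a i. l > 0 \<Longrightarrow> hc m \<delta> C l UNIV (\<lambda>y::real^'n. f ((y $ i - a) / l))"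
    using hc_of_cb[OF assms] by blast
  let ?M = "2 * (4 * real CARD('n)) ^ m"
  have "1 \<le> (4 * real CARD('n)) ^ m"
    using one_le_card[where 'n = 'n] by (intro one_le_power) linarith
  then have "1 * 1 \<le> ?M * C" using C(1) by (intro mult_mono) auto
  then have "1 \<le> (?M * C) ^ CARD('n)" by (intro one_le_power) auto
  moreover have "hc m \<delta> ((?M * C) ^ CARD('n)) l UNIV (\<lambda>y::real^'n. \<Prod>i\<in>UNIV. f ((y $ i - p $ i) / l))"
    if "l > 0" for l p
    by (rule hc_prod) (use that assms C in auto)
  ultimately show ?thesis by blast
qed

definition step :: "nat \<Rightarrow> real \<Rightarrow> real" where
  "step m = (SOME S. cb m S \<and> mono S \<and> (\<forall>t\<le>0. S t = 0) \<and> (\<forall>t\<ge>1. S t = 1))"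

lemma step: "cb m (step m)" "mono (step m)" "t \<le> 0 \<Longrightarrow> step m t = 0" "t \<ge> 1 \<Longrightarrow> step m t = 1"
  using someI_ex[OF smooth_step_exists[of m]] unfolding step_def[symmetric] by auto

lemma step_01: "0 \<le> step m t" "step m t \<le> 1"
  using step(3)[of "min t 0" m] step(4)[of "max t 1" m] monoD[OF step(2), of "min t 0" t m] monoD[OF step(2), of t "max t 1" m]
  by auto

text \<open>Each factor is the difference of a step and its translate, so that sums over the integer
  translates telescope.\<close>

definition theta :: "nat \<Rightarrow> real \<Rightarrow> real^'n \<Rightarrow> real^'n \<Rightarrow> real" where
  "theta m l p y = (\<Prod>i\<in>UNIV. step m ((y $ i - p $ i) / l + 1) - step m ((y $ i - p $ i) / l))"

text \<open>Equal to 1 on the concentric cube of twice the side and supported in the triple. The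
  margin l/2 keeps 1 - \<open>eta\<close> away from the cube, and it places the support of the
  cutoff of a proper dyadic subcube where the cutoff of the larger cube is 1.\<close>

definition eta :: "nat \<Rightarrow> real^'n \<Rightarrow> real \<Rightarrow> real^'n \<Rightarrow> real" where
  "eta m a l y = (\<Prod>i\<in>UNIV. step m (2 * ((y $ i - a $ i) / l) + 2)) * (\<Prod>i\<in>UNIV. step m (4 - 2 * ((y $ i - a $ i) / l)))"

lemma theta_01: "0 \<le> theta m l p y" "theta m l p y \<le> 1"
proof -
  have "0 \<le> step m (t + 1) - step m t" "step m (t + 1) - step m t \<le> 1" for t
    using monoD[OF step(2), of t "t + 1" m] step_01[of m t] step_01[of m "t+1"] by auto
  then show "0 \<le> theta m l p y" "theta m l p y \<le> 1"
    unfolding theta_def by (auto intro!: prod_nonneg prod_le_1)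
qed

lemma theta_nonzero:
  assumes "theta m l p y \<noteq> 0" "l > 0"
  shows "\<bar>y $ i - p $ i\<bar> < l"
proof (rule ccontr)
  assume "\<not> ?thesis"
  then have "(y $ i - p $ i) / l \<ge> 1 \<or> (y $ i - p $ i) / l + 1 \<le> 0"
    using assms(2) by (auto simp: field_simps abs_if split: if_splits)
  then have "step m ((y $ i - p $ i) / l + 1) - step m ((y $ i - p $ i) / l) = 0"
    using step(3,4) by fastforce
  then show False using assms(1) unfolding theta_def by (metis (no_types, lifting) UNIV_I finite_code prod_zero)
qed

lemma hc_theta:
  assumes "0 < \<delta>" "\<delta> \<le> 1"
  shows "\<exists>C\<ge>1. \<forall>l>0. \<forall>p::real^'n. hc m \<delta> C l UNIV (theta m l p)"
proof -
  have "cb m (\<lambda>t. 1 * step m (1 * t + 1) - 1 * step m (1 * t + 0))"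
    by (intro cb_diff cb_affine step)
  from hc_tensor[OF this assms, where 'n = 'n] show ?thesis
    unfolding theta_def[abs_def] by simp
qed

lemma eta_01: "0 \<le> eta m a l y" "eta m a l y \<le> 1"
  unfolding eta_def
  by (intro mult_nonneg_nonneg mult_le_one prod_nonneg prod_le_1 conjI ballI step_01)+

lemma eta_nonzero:
  assumes "eta m a l y \<noteq> 0" "l > 0"
  shows "a $ i - l < y $ i" "y $ i < a $ i + 2 * l"
proof -
  have nz: "step m (2 * ((y $ i - a $ i) / l) + 2) \<noteq> 0" "step m (4 - 2 * ((y $ i - a $ i) / l)) \<noteq> 0"
    using assms(1) unfolding eta_def by (auto simp: prod_zero_iff)
  then have "\<not> 2 * ((y $ i - a $ i) / l) + 2 \<le> 0" "\<not> 4 - 2 * ((y $ i - a $ i) / l) \<le> 0"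
    using step(3) by blast+
  then show "a $ i - l < y $ i" "y $ i < a $ i + 2 * l"
    using assms(2) by (auto simp: field_simps)
qed

lemma eta_one:
  assumes "\<And>i. a $ i - l / 2 \<le> y $ i \<and> y $ i \<le> a $ i + 3 * l / 2" "l > 0"
  shows "eta m a l y = 1"
proof -
  have "step m (2 * ((y $ i - a $ i) / l) + 2) = 1" "step m (4 - 2 * ((y $ i - a $ i) / l)) = 1" for i
    using assms(1)[of i] assms(2) by (auto intro!: step simp: field_simps)
  then show ?thesis unfolding eta_def by simp
qed

lemma hc_eta:
  assumes "0 < \<delta>" "\<delta> \<le> 1"
  shows "\<exists>C\<ge>1. \<forall>l>0. \<forall>a::real^'n. hc m \<delta> C l UNIV (eta m a l)"
proof -
  have "cb m (\<lambda>t. 1 * step m (2 * t + 2))" by (intro cb_affine step)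
  from hc_tensor[OF this assms, where 'n = 'n] obtain C where
    C: "C \<ge> 1" "\<And>l p. l > 0 \<Longrightarrow> hc m \<delta> C l UNIV (\<lambda>y::real^'n. \<Prod>i\<in>UNIV. step m (2 * ((y $ i - p $ i) / l) + 2))"
    by auto
  have "cb m (\<lambda>t. 1 * step m ((-2) * t + 4))" by (intro cb_affine step)
  moreover have "(\<lambda>t. 1 * step m ((-2) * t + 4)) = (\<lambda>t. step m (4 - 2 * t))" by (simp add: algebra_simps)
  ultimately have "cb m (\<lambda>t. step m (4 - 2 * t))" by simp
  from hc_tensor[OF this assms, where 'n = 'n] obtain D where
    D: "D \<ge> 1" "\<And>l p. l > 0 \<Longrightarrow> hc m \<delta> D l UNIV (\<lambda>y::real^'n. \<Prod>i\<in>UNIV. step m (4 - 2 * ((y $ i - p $ i) / l)))"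
    by blast
  let ?M = "2 * (4 * real CARD('n)) ^ m"
  have "1 \<le> (4 * real CARD('n)) ^ m"
    using one_le_card[where 'n = 'n] by (intro one_le_power) linarith
  then have "1 * (1 * 1) \<le> ?M * (C * D)" using C(1) D(1) by (intro mult_mono) auto
  moreover have "hc m \<delta> (?M * (C * D)) l UNIV (eta m a l)" if "l > 0" for l and a :: "real^'n"
  proof -
    have "hc m \<delta> (?M * (C * D)) l UNIV (\<lambda>y. (\<Prod>i\<in>UNIV. step m (2 * ((y $ i - a $ i) / l) + 2)) *\<^sub>R (\<Prod>i\<in>UNIV. step m (4 - 2 * ((y $ i - a $ i) / l))))"
      by (rule hc_mult) (use C D that assms in auto)
    then show ?thesis unfolding eta_def[abs_def] by simp
  qed
  ultimately show ?thesis by auto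
qed

lemma sum_int_telescope:
  fixes g :: "int \<Rightarrow> real"
  assumes "p \<le> q"
  shows "(\<Sum>j\<in>{p..q}. g (j - 1) - g j) = g (p - 1) - g q"
  using assms
proof (induction q rule: int_ge_induct)
  case base
  then show ?case by simp
next
  case (step i)
  have "{p..i + 1} = insert (i + 1) {p..i}" using step by auto
  then show ?case using step by simp
qed

text \<open>The cells of generation \<open>k\<close> at side \<open>l / 2\<^sup>k\<close>, with enough indices to cover the tripled cube.\<close>

definition cells :: "nat \<Rightarrow> ('n \<Rightarrow> int) set" where
  "cells k = (\<Pi>\<^sub>E i\<in>UNIV. {- (2 ^ k) .. 2 ^ (k + 1)})"

definition cpt :: "real^'n \<Rightarrow> real \<Rightarrow> nat \<Rightarrow> ('n \<Rightarrow> int) \<Rightarrow> real^'n" where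
  "cpt a l k j = a + (l / 2 ^ k) *\<^sub>R (\<chi> i. of_int (j i))"

lemma finite_cells: "finite (cells k :: ('n::finite \<Rightarrow> int) set)"
  unfolding cells_def by (intro finite_PiE) auto

lemma sum_theta:
  fixes a :: "real^'n"
  assumes "l > 0" "\<And>i. a $ i - l \<le> y $ i \<and> y $ i \<le> a $ i + 2 * l"
  shows "(\<Sum>j\<in>cells k. theta m (l / 2 ^ k) (cpt a l k j) y) = 1"
proof -
  define h where "h = l / 2 ^ k"
  have h: "h > 0" "l = 2 ^ k * h" using assms(1) by (auto simp: h_def)
  define u where "u i = (y $ i - a $ i) / h" for i
  have e: "(y $ i - cpt a l k j $ i) / h = u i - of_int (j i)" for i j
    using h by (simp add: cpt_def u_def h_def[symmetric] field_simps)
  have u: "- (2 ^ k) \<le> u i" "u i \<le> 2 * 2 ^ k" for i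
    using assms(2)[of i] h by (auto simp: u_def field_simps)
  have "(\<Sum>j\<in>cells k. theta m h (cpt a l k j) y) =
     (\<Sum>j\<in>cells k. \<Prod>i\<in>UNIV. step m (u i - of_int (j i) + 1) - step m (u i - of_int (j i)))"
    unfolding theta_def e ..
  also have "\<dots> = (\<Prod>i\<in>UNIV. \<Sum>j\<in>{- (2 ^ k) .. 2 ^ (k + 1)}. step m (u i - of_int j + 1) - step m (u i - of_int j))"
    unfolding cells_def by (subst prod_sum_PiE) auto
  also have "\<dots> = (\<Prod>i\<in>(UNIV::'n set). 1)"
  proof (rule prod.cong[OF refl])
    fix i
    have "(\<Sum>j\<in>{- (2 ^ k) .. 2 ^ (k + 1)}. step m (u i - of_int j + 1) - step m (u i - of_int j))
      = (\<Sum>j\<in>{- (2 ^ k) .. 2 ^ (k + 1)}. step m (u i - of_int (j - 1)) - step m (u i - of_int j))"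
      by (simp add: algebra_simps)
    \<comment> \<open>The index range is just long enough for both end terms to fall into the
      constant ranges of \<open>step\<close>: u + 2^k + 1 \<ge> 1 and u - 2^(k+1) \<le> 0.\<close>
    also have "\<dots> = step m (u i - of_int (- (2 ^ k) - 1)) - step m (u i - of_int (2 ^ (k + 1)))"
      by (rule sum_int_telescope) (simp add: order_trans[of _ 0])
    also have "step m (u i - of_int (- (2 ^ k) - 1)) = 1" using u[of i] by (intro step(4)) auto
    also have "step m (u i - of_int (2 ^ (k + 1))) = 0" using u[of i] by (intro step(3)) auto
    finally show "(\<Sum>j\<in>{- (2 ^ k) .. 2 ^ (k + 1)}. step m (u i - of_int j + 1) - step m (u i - of_int j)) = 1"
      by simp
  qed
  finally show ?thesis by (simp add: h_def)
qed

subsection \<open>Cubes\<close>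

lemma mem_cube: "x \<in> cube_of a l \<longleftrightarrow> (\<forall>i. a $ i \<le> x $ i \<and> x $ i < a $ i + l)"
  by (simp add: cube_of_def)

lemma cube_of_conv: "cube_of (a::real^'n) l = (\<Inter>i. {x. a $ i \<le> x $ i} \<inter> {x. x $ i < a $ i + l})"
  by (auto simp: cube_of_def)

lemma borel_cube [measurable]: "cube_of (a::real^'n) l \<in> sets borel"
  unfolding cube_of_conv by measurable

lemma lebesgue_cube [measurable]: "cube_of (a::real^'n) l \<in> sets lebesgue"
  using borel_cube by (simp add: sets_completionI_sets)

lemma emeasure_lborel_cube [simp]:
  assumes "l \<ge> 0"
  shows "emeasure lborel (cube_of (a::real^'n) l) = ennreal (l ^ CARD('n))"
proof -
  let ?b = "a + (\<chi> i. l)"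
  have "box a ?b \<subseteq> cube_of a l" "cube_of a l \<subseteq> cbox a ?b"
    by (auto simp: mem_box_cart mem_cube less_imp_le)
  then have "emeasure lborel (box a ?b) \<le> emeasure lborel (cube_of a l)"
     "emeasure lborel (cube_of a l) \<le> emeasure lborel (cbox a ?b)"
    by (auto intro!: emeasure_mono)
  moreover have "emeasure lborel (box a ?b) = ennreal (l ^ CARD('n))"
    "emeasure lborel (cbox a ?b) = ennreal (l ^ CARD('n))"
  proof -
    have "\<And>b. b \<in> Basis \<Longrightarrow> a \<bullet> b \<le> ?b \<bullet> b"
      using assms by (auto simp: Basis_vec_def inner_axis)
    moreover have "(\<Prod>b\<in>Basis. (?b - a) \<bullet> b) = l ^ CARD('n)"
      by (subst prod.cong[OF refl, of _ _ "\<lambda>_. l"]) (auto simp: Basis_vec_def inner_axis simp flip: DIM_cart[where 'a = real, simplified])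
    ultimately show "emeasure lborel (box a ?b) = ennreal (l ^ CARD('n))"
      "emeasure lborel (cbox a ?b) = ennreal (l ^ CARD('n))"
      by (simp_all add: emeasure_lborel_box_eq emeasure_lborel_cbox_eq)
  qed
  ultimately show ?thesis by simp
qed

lemma emeasure_cube: "l \<ge> 0 \<Longrightarrow> emeasure lebesgue (cube_of (a::real^'n) l) = ennreal (l ^ CARD('n))"
  by simp

lemma measure_lborel_cube [simp]: "l \<ge> 0 \<Longrightarrow> measure lborel (cube_of (a::real^'n) l) = l ^ CARD('n)"
  by (simp add: measure_def)

lemma measure_cube: "l \<ge> 0 \<Longrightarrow> measure lebesgue (cube_of (a::real^'n) l) = l ^ CARD('n)"
  by simp

lemma lmeasurable_cube: "cube_of (a::real^'n) l \<in> lmeasurable"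
proof (cases "l \<ge> 0")
  case False
  then have "cube_of a l = {}" by (fastforce simp: cube_of_def)
  then show ?thesis by simp
qed (simp add: fmeasurable_def emeasure_cube)

lemma sidelen_cube: "l > 0 \<Longrightarrow> sidelen (cube_of (a::real^'n) l) = l"
  by (simp add: sidelen_def measure_cube powr_realpow[symmetric] powr_powr)

text \<open>Each corner lies in the other cube, so the corners agree; the sides agree through the
  volume. This gives a meaning to \<open>triple\<close> and to the later choice of corner and side
  by definite description.\<close>

lemma cube_inj:
  assumes "cube_of (a::real^'n) l = cube_of b l'" "l > 0" "l' > 0"
  shows "a = b \<and> l = l'"
proof -
  have "a \<in> cube_of b l'" "b \<in> cube_of a l"
    using assms by (metis (mono_tags, lifting) less_add_same_cancel1 mem_cube order_refl)+
  then have "a = b" by (auto simp: mem_cube vec_eq_iff intro: antisym)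
  moreover have "l = l'"
    using arg_cong[OF assms(1), of sidelen] sidelen_cube assms(2,3) by metis
  ultimately show ?thesis by simp
qed

lemma triple_cube:
  assumes "l > 0"
  shows "triple (cube_of (a::real^'n) l) = cube_of (a - (\<chi> i. l)) (3 * l)"
  unfolding triple_def
proof (rule the_equality)
  show "\<exists>a' l'. l' > 0 \<and> cube_of a l = cube_of a' l' \<and> cube_of (a - (\<chi> i. l)) (3 * l) = cube_of (a' - (\<chi> i. l')) (3 * l')"
    using assms by blast
next
  fix Q' assume "\<exists>a' l'. l' > 0 \<and> cube_of a l = cube_of a' l' \<and> Q' = cube_of (a' - (\<chi> i. l')) (3 * l')"
  then show "Q' = cube_of (a - (\<chi> i. l)) (3 * l)" using cube_inj[of a l] assms by blast
qed

lemma mem_triple: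
  "l > 0 \<Longrightarrow> x \<in> triple (cube_of (a::real^'n) l) \<longleftrightarrow> (\<forall>i. a $ i - l \<le> x $ i \<and> x $ i < a $ i + 2 * l)"
  by (simp add: triple_cube mem_cube algebra_simps)

lemma norm_le_card:
  fixes x :: "real^'n"
  assumes "\<And>i. \<bar>x $ i\<bar> \<le> B"
  shows "norm x \<le> real CARD('n) * B"
proof -
  have "norm x \<le> (\<Sum>i\<in>UNIV. \<bar>x $ i\<bar>)" by (rule norm_le_l1_cart)
  also have "\<dots> \<le> real CARD('n) * B" using assms sum_bounded_above[of UNIV "\<lambda>i. \<bar>x $ i\<bar>" B] by simp
  finally show ?thesis .
qed

lemma dist_le_card:
  fixes x :: "real^'n"
  assumes "\<And>i. \<bar>x $ i - y $ i\<bar> \<le> B"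
  shows "dist x y \<le> real CARD('n) * B"
  unfolding dist_norm using assms by (intro norm_le_card) auto

lemma dist_cube: "x \<in> cube_of (a::real^'n) l \<Longrightarrow> y \<in> cube_of a l \<Longrightarrow> dist x y \<le> real CARD('n) * l"
proof (rule dist_le_card)
  fix i
  assume "x \<in> cube_of a l" "y \<in> cube_of a l"
  then have "a $ i \<le> x $ i" "x $ i < a $ i + l" "a $ i \<le> y $ i" "y $ i < a $ i + l" by (auto simp: mem_cube)
  then show "\<bar>x $ i - y $ i\<bar> \<le> l" by linarith
qed

lemma component_le_dist: "\<bar>x $ i - y $ i\<bar> \<le> dist x y"
  using component_le_norm_cart[of "x - y" i] by (simp add: dist_norm)

subsection \<open>Bounded functions with bounded support\<close>

lemma Linfc_bound: "Linfc f \<Longrightarrow> \<exists>M\<ge>0. \<forall>y. cmod (f y) \<le> M"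
proof -
  assume "Linfc f"
  then obtain M where M: "\<And>y. cmod (f y) \<le> M" by (auto simp: Linfc_def bounded_iff)
  moreover have "0 \<le> M" using M[of undefined] norm_ge_zero order_trans by blast
  ultimately show ?thesis by blast
qed

lemma bounded_subset_lmeasurable:
  assumes "bounded (S :: (real^'n) set)"
  obtains B where "B \<in> lmeasurable" "S \<subseteq> B" "bounded B"
  using assms bounded_subset_cbox_symmetric lmeasurable_cbox bounded_cbox by metis

lemma integrable_bounded_support:
  fixes f :: "real^'n \<Rightarrow> 'b::{banach, second_countable_topology}"
  assumes "f \<in> borel_measurable lebesgue" "\<And>y. norm (f y) \<le> M" "bounded {y. f y \<noteq> 0}"
  shows "integrable lebesgue f"
proof -
  obtain B where B: "B \<in> lmeasurable" "{y. f y \<noteq> 0} \<subseteq> B" using bounded_subset_lmeasurable[OF assms(3)] .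
  have "integrable lebesgue (\<lambda>y. indicat_real B y *\<^sub>R M)"
    using B by (intro integrable_scaleR_left) (auto simp: fmeasurable_def integrable_indicator_iff)
  then show ?thesis
  proof (rule Bochner_Integration.integrable_bound[OF _ assms(1)], intro AE_I2)
    fix y show "norm (f y) \<le> norm (indicat_real B y *\<^sub>R M)"
      using assms(2)[of y] B(2) by (auto simp: indicator_def)
  qed
qed

lemma integrable_Linfc: "Linfc f \<Longrightarrow> integrable lebesgue f"
  using Linfc_bound[of f] integrable_bounded_support unfolding Linfc_def by blast

lemma L2_Linfc:
  assumes "Linfc f" shows "L2 f"
proof -
  obtain M where M: "M \<ge> 0" "\<And>y. cmod (f y) \<le> M" using Linfc_bound[OF assms] by blast
  have "integrable lebesgue (\<lambda>x. (cmod (f x))\<^sup>2)"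
  proof (rule integrable_bounded_support[of _ "M\<^sup>2"])
    have "f \<in> borel_measurable lebesgue" using assms by (simp add: Linfc_def)
    then show "(\<lambda>x. (cmod (f x))\<^sup>2) \<in> borel_measurable lebesgue" by measurable
  qed (use assms M in \<open>auto simp: Linfc_def intro!: power_mono\<close>)
  then show ?thesis using assms by (simp add: L2_def Linfc_def)
qed

lemma Linfc_mult:
  assumes "Linfc f" "g \<in> borel_measurable lebesgue" "\<And>y. f y \<noteq> 0 \<Longrightarrow> norm (g y) \<le> M"
  shows "Linfc (\<lambda>y. f y * g y)"
proof -
  obtain N where N: "N \<ge> 0" "\<And>y. cmod (f y) \<le> N" using Linfc_bound[OF assms(1)] by blast
  have "norm (f y * g y) \<le> N * max 0 M" for y
    using N assms(3)[of y] by (cases "f y = 0") (auto simp: norm_mult intro!: mult_mono)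
  moreover have "{y. f y * g y \<noteq> 0} \<subseteq> {y. f y \<noteq> 0}" by auto
  ultimately show ?thesis
    using assms bounded_subset unfolding Linfc_def bounded_iff by (auto intro!: borel_measurable_times)
qed

lemma Linfc_add: "Linfc f \<Longrightarrow> Linfc g \<Longrightarrow> Linfc (\<lambda>y. f y + g y)"
proof -
  assume f: "Linfc f" and g: "Linfc g"
  obtain M where M: "\<And>y. cmod (f y) \<le> M" using Linfc_bound[OF f] by blast
  obtain N where N: "\<And>y. cmod (g y) \<le> N" using Linfc_bound[OF g] by blast
  have "norm (f y + g y) \<le> M + N" for y using M N by (intro norm_triangle_mono)
  moreover have "{y. f y + g y \<noteq> 0} \<subseteq> {y. f y \<noteq> 0} \<union> {y. g y \<noteq> 0}" by auto
  moreover have "bounded ({y. f y \<noteq> 0} \<union> {y. g y \<noteq> 0})" using f g by (simp add: Linfc_def)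
  ultimately have "bounded {y. f y + g y \<noteq> 0}" "bounded (range (\<lambda>y. f y + g y))"
    using bounded_subset by (blast, auto simp: bounded_iff)
  then show ?thesis using f g by (auto simp: Linfc_def intro!: borel_measurable_add)
qed

lemma measurable_continuous_lebesgue:
  fixes g :: "real^'n \<Rightarrow> 'b::{real_normed_vector, second_countable_topology}"
  shows "continuous_on UNIV g \<Longrightarrow> g \<in> borel_measurable lebesgue"
  using borel_measurable_continuous_onI measurable_completion by (metis sets_lborel measurable_cong_sets)

text \<open>No measurability of \<open>f\<close> enters: a function that is not integrable has
  integral 0 by default, and the bound persists.\<close>

lemma norm_integral_le_bound:
  fixes f :: "'a \<Rightarrow> 'b::{banach, second_countable_topology}"
  assumes "integrable M g" "\<And>x. norm (f x) \<le> g x"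
  shows "norm (integral\<^sup>L M f) \<le> integral\<^sup>L M g"
proof (cases "integrable M f")
  case True
  have "norm (integral\<^sup>L M f) \<le> (\<integral>x. norm (f x) \<partial>M)" by (rule integral_norm_bound)
  also have "\<dots> \<le> integral\<^sup>L M g"
    by (rule integral_mono) (use True assms in auto)
  finally show ?thesis .
next
  case False
  have "0 \<le> g x" for x using assms(2)[of x] norm_ge_zero[of "f x"] by linarith
  then show ?thesis using False by (simp add: not_integrable_integral_eq)
qed

subsection \<open>The smooth maximal function\<close>

lemma Fs_memI:
  assumes "hc m \<delta> 1 L UNIV \<phi>" "L > 0" "\<And>y. y \<notin> cube_of b L \<Longrightarrow> \<phi> y = 0"
  shows "\<phi> \<in> Fs m \<delta> (cube_of b L)"
proof -
  have h: "\<And>is y. length is < m \<Longrightarrow> pds is \<phi> differentiable at y"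
    "\<And>is y. length is \<le> m \<Longrightarrow> \<bar>pds is \<phi> y\<bar> \<le> 1 / L ^ length is"
    "\<And>is y y'. length is = m \<Longrightarrow> \<bar>pds is \<phi> y - pds is \<phi> y'\<bar> \<le> 1 / L ^ m * (dist y y' / L) powr \<delta>"
    using assms(1) unfolding hc_iff[OF assms(2)] by auto
  have 1: "1 / L ^ n = L powr (- real n)" for n
    using assms(2) by (simp add: powr_minus powr_realpow divide_inverse)
  have 2: "1 / L ^ m * (dist y y' / L) powr \<delta> = dist y y' powr \<delta> * L powr (- (real m + \<delta>))" for y y' :: "real^'a"
  proof -
    have "(dist y y' / L) powr \<delta> = dist y y' powr \<delta> * L powr (- \<delta>)"
      using assms(2) powr_divide[of "dist y y'" L \<delta>] by (simp add: powr_minus divide_inverse)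
    then show ?thesis unfolding 1 by (simp add: powr_add[symmetric])
  qed
  show ?thesis
    unfolding Fs_def diff_upto_def sidelen_cube[OF assms(2)]
    using h(1) h(2)[unfolded 1] h(3)[unfolded 2] assms(3) by blast
qed

text \<open>A uniform bound on the candidates, so that the real-valued supremum in
  \<open>maxf\<close> is a genuine one.\<close>

lemma maxf_candidate_le:
  fixes Q :: "(real^'n) set"
  assumes Q: "is_cube Q" "\<phi> \<in> Fs m \<delta> Q" and M: "M \<ge> 0" "\<And>y. cmod (f y) \<le> M"
  shows "cmod (LINT y:Q|lebesgue. f y * of_real (\<phi> y)) / measure lebesgue Q * indicator Q z \<le> M"
proof -
  obtain a l where al: "l > 0" "Q = cube_of a l" using Q(1) by (auto simp: is_cube_def)
  have \<phi>: "\<bar>\<phi> y\<bar> \<le> 1" for y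
  proof -
    have "\<forall>is y. length is \<le> m \<longrightarrow> \<bar>pds is \<phi> y\<bar> \<le> sidelen Q powr (- real (length is))"
      using Q(2) by (simp add: Fs_def)
    from this[rule_format, of "[]" y] show ?thesis using al by (simp add: sidelen_cube)
  qed
  have mp: "measure lebesgue Q > 0" using al by (simp add: measure_cube)
  have "cmod (LINT y:Q|lebesgue. f y * of_real (\<phi> y)) \<le> (\<integral>y. indicat_real Q y * M \<partial>lebesgue)"
    unfolding set_lebesgue_integral_def
  proof (rule norm_integral_le_bound)
    show "integrable lebesgue (\<lambda>y. indicat_real Q y * M)"
      using lmeasurable_cube[of a l] al by (auto simp: fmeasurable_def integrable_indicator_iff)
  next
    fix y show "norm (indicat_real Q y *\<^sub>R (f y * of_real (\<phi> y))) \<le> indicat_real Q y * M"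
      using M(2)[of y] \<phi>[of y] M(1) mult_mono[of "cmod (f y)" M "\<bar>\<phi> y\<bar>" 1]
      by (auto simp: indicator_def norm_mult)
  qed
  also have "\<dots> = measure lebesgue Q * M"
    using lmeasurable_cube[of a l] al by simp
  finally have "cmod (LINT y:Q|lebesgue. f y * of_real (\<phi> y)) / measure lebesgue Q \<le> M"
    using mp by (simp add: field_simps)
  then show ?thesis using M by (auto simp: indicator_def)
qed

lemma maxf_ge:
  assumes f: "Linfc f" and "L > 0" "cube_of b L \<subseteq> Q1" "\<phi> \<in> Fs m \<delta> (cube_of b L)" "z \<in> cube_of b L"
  shows "cmod (LINT y:cube_of b L|lebesgue. f y * of_real (\<phi> y)) / L ^ CARD('n) \<le> maxf m \<delta> Q1 f (z::real^'n)"
proof -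
  let ?S = "{cmod (LINT y:Q|lebesgue. f y * of_real (\<phi> y)) / measure lebesgue Q * indicator Q z
       | Q \<phi>. is_cube Q \<and> Q \<subseteq> Q1 \<and> \<phi> \<in> Fs m \<delta> Q}"
  obtain M where M: "M \<ge> 0" "\<And>y. cmod (f y) \<le> M" using Linfc_bound[OF f] by blast
  have "bdd_above ?S"
    using maxf_candidate_le[where f = f, OF _ _ M] by (intro bdd_aboveI[of _ M]) blast
  moreover have "cmod (LINT y:cube_of b L|lebesgue. f y * of_real (\<phi> y)) / L ^ CARD('n) \<in> ?S"
    using assms measure_cube[of L b] unfolding is_cube_def
    by (intro CollectI exI[of _ "cube_of b L"] exI[of _ \<phi>]) auto
  ultimately show ?thesis unfolding maxf_def by (rule cSup_upper[rotated])
qed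

lemma maxf_le:
  assumes "L > 0" "cube_of b L \<subseteq> Q1" and M: "M \<ge> 0" "\<And>y. cmod (f y) \<le> M"
  shows "maxf m \<delta> Q1 f (z::real^'n) \<le> M"
proof -
  have "(\<lambda>_. 0) \<in> Fs m \<delta> (cube_of b L)" by (intro Fs_memI hc_const assms) auto
  moreover have "is_cube (cube_of b L)" using assms(1) by (auto simp: is_cube_def)
  ultimately show ?thesis unfolding maxf_def
    using assms(2) maxf_candidate_le[where f = f, OF _ _ M] by (intro cSup_least) blast+
qed

lemma maxf_nonneg:
  assumes "Linfc f" "L > 0" "cube_of b L \<subseteq> Q1" "z \<in> cube_of b L"
  shows "0 \<le> maxf m \<delta> Q1 f (z::real^'n)"
proof -
  have "(\<lambda>_. 0) \<in> Fs m \<delta> (cube_of b L)" by (intro Fs_memI hc_const assms) auto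
  from maxf_ge[OF assms(1-3) this assms(4)] show ?thesis by simp
qed

text \<open>The gateway from arbitrary smooth functions to the maximal function: real and imaginary
  part of \<open>g\<close>, divided by their norm, are admissible test functions. The factor 2
  accounts for the two parts, t^(m+1) for passing from the scale \<open>l\<close> of regularity to
  the side \<open>L\<close> of the enclosing cube.\<close>

lemma pairing_bound:
  fixes g :: "real^'n \<Rightarrow> complex"
  assumes f: "Linfc f" and L: "L > 0" "cube_of b L \<subseteq> Q1" "z \<in> cube_of b L"
    and g: "hc m \<delta> A l UNIV g" "\<And>y. y \<notin> cube_of b L \<Longrightarrow> g y = 0"
    and l: "0 < l" "L \<le> t * l" "1 \<le> t" "0 \<le> A" "0 < \<delta>" "\<delta> \<le> 1"
  shows "cmod (\<integral>y. f y * g y \<partial>lebesgue) \<le> 2 * (A * t ^ Suc m) * L ^ CARD('n) * maxf m \<delta> Q1 f z"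
proof -
  let ?A = "A * t ^ Suc m" and ?Mf = "maxf m \<delta> Q1 f z"
  have M0: "0 \<le> ?Mf" by (rule maxf_nonneg[OF f L])
  have cg: "continuous_on UNIV g" by (rule hc_continuous_on[OF g(1) l(1) l(5)])
  have gb: "norm (g y) \<le> A" for y by (rule hc_bound[OF g(1)]) simp
  have real_case: "cmod (\<integral>y. f y * of_real (h y) \<partial>lebesgue) \<le> ?A * L ^ CARD('n) * ?Mf"
    if h: "hc m \<delta> A l UNIV h" "\<And>y. y \<notin> cube_of b L \<Longrightarrow> h y = 0" for h
  proof (cases "A = 0")
    case True
    then have "h y = 0" for y using hc_bound[OF h(1), of y] by simp
    then show ?thesis using M0 True by simp
  next
    case False
    then have A: "?A > 0" using l by simp
    have "hc m \<delta> ?A L UNIV h"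
      by (rule hc_mono[OF hc_rescale_up[OF h(1)]]) (use l L A in auto)
    then have "hc m \<delta> (\<bar>1 / ?A\<bar> * ?A) L UNIV (\<lambda>y. (1 / ?A) *\<^sub>R h y)" by (rule hc_scale) simp
    moreover have "\<bar>1 / ?A\<bar> * ?A = 1" using A by (metis abs_of_pos divide_pos_pos nonzero_eq_divide_eq less_irrefl zero_less_one)
    ultimately have h1: "hc m \<delta> 1 L UNIV (\<lambda>y. h y / ?A)" by (simp del: power_Suc)
    have "(\<lambda>y. h y / ?A) \<in> Fs m \<delta> (cube_of b L)" by (rule Fs_memI[OF h1 L(1)]) (use h in auto)
    from maxf_ge[OF f L(1,2) this L(3)]
    have "cmod (LINT y:cube_of b L|lebesgue. f y * of_real (h y / ?A)) \<le> L ^ CARD('n) * ?Mf"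
      using L(1) by (simp add: field_simps)
    moreover have "(LINT y:cube_of b L|lebesgue. f y * of_real (h y / ?A)) = (\<integral>y. f y * of_real (h y) / of_real ?A \<partial>lebesgue)"
      unfolding set_lebesgue_integral_def
      by (rule Bochner_Integration.integral_cong) (use h in \<open>auto simp: indicator_def\<close>)
    moreover have "\<dots> = (\<integral>y. f y * of_real (h y) \<partial>lebesgue) / of_real ?A" by simp
    moreover have "cmod ((\<integral>y. f y * of_real (h y) \<partial>lebesgue) / of_real ?A) = cmod (\<integral>y. f y * of_real (h y) \<partial>lebesgue) / ?A"
      using A by (simp only: norm_divide norm_of_real abs_of_pos)
    ultimately have "cmod (\<integral>y. f y * of_real (h y) \<partial>lebesgue) / ?A \<le> L ^ CARD('n) * ?Mf"
      by (simp only:)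
    then show ?thesis using A by (simp add: field_simps del: power_Suc)
  qed
  have hR: "hc m \<delta> A l UNIV (\<lambda>y. Re (g y))" "hc m \<delta> A l UNIV (\<lambda>y. Im (g y))"
    by (auto intro!: hc_bounded_linear[OF g(1)] bounded_linear_Re bounded_linear_Im simp: abs_Re_le_cmod abs_Im_le_cmod)
  have int: "integrable lebesgue (\<lambda>y. f y * of_real (h (g y)))"
    if "continuous_on UNIV h" "\<And>z. \<bar>h z\<bar> \<le> cmod z" for h
  proof (rule integrable_Linfc, rule Linfc_mult[OF f])
    show "(\<lambda>y. complex_of_real (h (g y))) \<in> borel_measurable lebesgue"
      by (intro measurable_continuous_lebesgue continuous_on_of_real continuous_on_compose2[OF that(1) cg]) auto
    show "norm (complex_of_real (h (g y))) \<le> A" for y using that(2)[of "g y"] gb[of y] by simp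
  qed
  have "(\<integral>y. f y * g y \<partial>lebesgue) = (\<integral>y. f y * of_real (Re (g y)) + \<i> * (f y * of_real (Im (g y))) \<partial>lebesgue)"
    by (rule Bochner_Integration.integral_cong) (simp_all add: complex_eq_iff algebra_simps)
  also have "\<dots> = (\<integral>y. f y * of_real (Re (g y)) \<partial>lebesgue) + \<i> * (\<integral>y. f y * of_real (Im (g y)) \<partial>lebesgue)"
    by (subst Bochner_Integration.integral_add)
      (auto intro!: int continuous_intros simp: abs_Re_le_cmod abs_Im_le_cmod)
  also have "cmod \<dots> \<le> ?A * L ^ CARD('n) * ?Mf + ?A * L ^ CARD('n) * ?Mf"
    by (rule norm_triangle_mono) (use hR g(2) in \<open>auto simp: norm_mult intro!: real_case simp del: power_Suc\<close>)
  finally show ?thesis by (simp add: mult_ac del: power_Suc)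
qed

lemma hc_zero:
  assumes "0 \<le> A" "0 < l"
  shows "hc m \<delta> A l U (\<lambda>y. 0 :: 'b::real_normed_vector)"
  using assms
proof (induction m arbitrary: A)
  case (Suc m)
  have "pd i (\<lambda>y. 0 :: 'b) = (\<lambda>y. 0)" for i :: 'a by (rule ext) simp
  moreover have "hc m \<delta> (A / l) l U (\<lambda>y. 0 :: 'b)" by (rule Suc.IH) (use Suc.prems in auto)
  ultimately show ?case using Suc.prems by auto
qed auto

subsection \<open>Integral of the tail of a Calderon-Zygmund kernel\<close>

text \<open>Dyadic shells about x. The k-th shell lies in a cube of side 6 * 2^k \<rho> and
  contributes at most 6^d (2^k \<rho>)^-\<delta>; the denominator is that of the geometric series
  with ratio 2^-\<delta>.\<close>

lemma nn_integral_tail: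
  fixes x :: "real^'n"
  assumes \<rho>: "\<rho> > 0" and \<delta>: "\<delta> > 0"
  shows "(\<integral>\<^sup>+y. ennreal (indicat_real {y. \<rho> \<le> dist x y} y * dist x y powr (- (real CARD('n) + \<delta>))) \<partial>lebesgue)
     \<le> ennreal (6 ^ CARD('n) / (1 - 2 powr (- \<delta>)) * \<rho> powr (- \<delta>))"
proof -
  let ?d = "real CARD('n)"
  define R where "R k = 2 ^ k * \<rho>" for k :: nat
  define Q where "Q k = cube_of (x - (\<chi> i. R (Suc k))) (3 * R (Suc k))" for k
  have R: "R k > 0" for k using \<rho> by (simp add: R_def)
  have pw: "ennreal (indicat_real {y. \<rho> \<le> dist x y} y * dist x y powr (- (?d + \<delta>)))
     \<le> (\<Sum>k. ennreal (R k powr (- (?d + \<delta>))) * indicator (Q k) y)" for y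
  proof (cases "\<rho> \<le> dist x y")
    case True
    define k where "k = nat \<lfloor>log 2 (dist x y / \<rho>)\<rfloor>"
    have ge1: "1 \<le> dist x y / \<rho>" using True \<rho> by simp
    then have l0: "0 \<le> log 2 (dist x y / \<rho>)" by simp
    have "real k \<le> log 2 (dist x y / \<rho>)" "log 2 (dist x y / \<rho>) < real k + 1"
      using l0 unfolding k_def by linarith+
    then have "2 powr real k \<le> dist x y / \<rho>" "dist x y / \<rho> < 2 powr (real k + 1)"
      using ge1 by (simp_all add: le_log_iff log_less_iff)
    then have k: "R k \<le> dist x y" "dist x y < R (Suc k)"
      using \<rho> by (auto simp: R_def powr_realpow powr_add field_simps)
    have "y \<in> Q k"
      unfolding Q_def mem_cube
    proof (intro allI)
      fix i
      have "\<bar>x $ i - y $ i\<bar> < R (Suc k)" using component_le_dist[of x i y] k by linarith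
      then show "(x - (\<chi> i. R (Suc k))) $ i \<le> y $ i \<and> y $ i < (x - (\<chi> i. R (Suc k))) $ i + 3 * R (Suc k)"
        by (auto simp: abs_less_iff)
    qed
    moreover have "dist x y powr (- (?d + \<delta>)) \<le> R k powr (- (?d + \<delta>))"
      using k R[of k] \<delta> by (intro powr_mono2') auto
    ultimately have "ennreal (indicat_real {y. \<rho> \<le> dist x y} y * dist x y powr (- (?d + \<delta>)))
       \<le> ennreal (R k powr (- (?d + \<delta>))) * indicator (Q k) y"
      by (auto simp: indicator_def intro: ennreal_leI)
    also have "\<dots> \<le> (\<Sum>k. ennreal (R k powr (- (?d + \<delta>))) * indicator (Q k) y)"
    proof -
      have "F k \<le> suminf F" for F :: "nat \<Rightarrow> ennreal"
        using sum_le_suminf[of F "{k}"] by simp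
      then show ?thesis .
    qed
    finally show ?thesis .
  qed simp
  have q: "2 powr (- \<delta>) < (1::real)" using \<delta> by (simp add: powr_less_one)
  have trm: "ennreal (R k powr (- (?d + \<delta>))) * emeasure lebesgue (Q k)
     = ennreal (6 ^ CARD('n) * \<rho> powr (- \<delta>) * (2 powr (- \<delta>)) ^ k)" for k
  proof -
    have "ennreal (R k powr (- (?d + \<delta>))) * emeasure lebesgue (Q k) = ennreal (R k powr (- (?d + \<delta>)) * (3 * R (Suc k)) ^ CARD('n))"
      unfolding Q_def using R[of "Suc k"] by (subst emeasure_cube) (auto simp: ennreal_mult)
    also have "3 * R (Suc k) = 6 * R k" by (simp add: R_def)
    also have "R k powr (- (?d + \<delta>)) * (6 * R k) ^ CARD('n) = 6 ^ CARD('n) * R k powr (- \<delta>)"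
    proof -
      have "R k powr (- (?d + \<delta>)) * R k ^ CARD('n) = R k powr (- \<delta>)"
        using R[of k] by (simp add: powr_realpow[symmetric] powr_add[symmetric])
      then show ?thesis by (simp add: power_mult_distrib mult_ac)
    qed
    also have "R k powr (- \<delta>) = \<rho> powr (- \<delta>) * (2 powr (- \<delta>)) ^ k"
      using \<rho> by (simp add: R_def powr_mult powr_realpow[symmetric] powr_powr mult.commute)
    finally show ?thesis by (simp add: mult.assoc)
  qed
  have "(\<integral>\<^sup>+y. ennreal (indicat_real {y. \<rho> \<le> dist x y} y * dist x y powr (- (?d + \<delta>))) \<partial>lebesgue)
     \<le> (\<integral>\<^sup>+y. (\<Sum>k. ennreal (R k powr (- (?d + \<delta>))) * indicator (Q k) y) \<partial>lebesgue)"
    by (intro nn_integral_mono pw)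
  also have "\<dots> = (\<Sum>k. \<integral>\<^sup>+y. ennreal (R k powr (- (?d + \<delta>))) * indicator (Q k) y \<partial>lebesgue)"
    unfolding Q_def by (intro nn_integral_suminf borel_measurable_times borel_measurable_indicator lebesgue_cube) auto
  also have "\<dots> = (\<Sum>k. ennreal (R k powr (- (?d + \<delta>))) * emeasure lebesgue (Q k))"
    unfolding Q_def by (subst nn_integral_cmult_indicator) (auto intro: lebesgue_cube)
  also have "\<dots> = (\<Sum>k. ennreal (6 ^ CARD('n) * \<rho> powr (- \<delta>) * (2 powr (- \<delta>)) ^ k))"
    unfolding trm ..
  also have "\<dots> = ennreal (6 ^ CARD('n) * \<rho> powr (- \<delta>) * (1 / (1 - 2 powr (- \<delta>))))"
  proof (rule suminf_ennreal_eq)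
    show "(\<lambda>k. 6 ^ CARD('n) * \<rho> powr (- \<delta>) * (2 powr (- \<delta>)) ^ k) sums (6 ^ CARD('n) * \<rho> powr (- \<delta>) * (1 / (1 - 2 powr (- \<delta>))))"
      using q by (intro sums_mult geometric_sums) auto
  qed auto
  finally show ?thesis by (simp add: mult_ac)
qed

lemma measurable_dist_powr [measurable]:
  fixes x :: "real^'n"
  shows "(\<lambda>y. indicat_real {y. \<rho> \<le> dist x y} y * dist x y powr e) \<in> borel_measurable lebesgue"
proof -
  have "(\<lambda>y. indicat_real {y. \<rho> \<le> dist x y} y * dist x y powr e) \<in> borel_measurable borel" by measurable
  then show ?thesis by (simp add: measurable_completion)
qed

lemma integral_tail:
  fixes x :: "real^'n"
  assumes \<rho>: "\<rho> > 0" and \<delta>: "\<delta> > 0"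
  shows "integrable lebesgue (\<lambda>y. indicat_real {y. \<rho> \<le> dist x y} y * dist x y powr (- (real CARD('n) + \<delta>)))" (is "integrable _ ?f")
    and "(\<integral>y. indicat_real {y. \<rho> \<le> dist x y} y * dist x y powr (- (real CARD('n) + \<delta>)) \<partial>lebesgue)
       \<le> 6 ^ CARD('n) / (1 - 2 powr (- \<delta>)) * \<rho> powr (- \<delta>)"
proof -
  have q: "2 powr (- \<delta>) < (1::real)" using \<delta> by (simp add: powr_less_one)
  note nn = nn_integral_tail[OF assms, of x]
  show int: "integrable lebesgue ?f"
  proof (rule integrableI_nonneg)
    show "?f \<in> borel_measurable lebesgue" by (rule measurable_dist_powr)
    show "(\<integral>\<^sup>+y. ennreal (?f y) \<partial>lebesgue) < \<infinity>" using nn by (rule order_le_less_trans) simp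
  qed auto
  have "ennreal (integral\<^sup>L lebesgue ?f) = (\<integral>\<^sup>+y. ennreal (?f y) \<partial>lebesgue)"
    by (rule nn_integral_eq_integral[symmetric, OF int]) auto
  with nn have "ennreal (integral\<^sup>L lebesgue ?f) \<le> ennreal (6 ^ CARD('n) / (1 - 2 powr (- \<delta>)) * \<rho> powr (- \<delta>))" by simp
  then show "integral\<^sup>L lebesgue ?f \<le> 6 ^ CARD('n) / (1 - 2 powr (- \<delta>)) * \<rho> powr (- \<delta>)"
    using q by (subst (asm) ennreal_le_iff) auto
qed

subsection \<open>Kernel estimates\<close>

locale cz_kernel =
  fixes m :: nat and \<delta> CK :: real and K :: "real^'n \<Rightarrow> real^'n \<Rightarrow> complex"
  assumes \<delta>: "0 < \<delta>" "\<delta> \<le> 1" and CK: "CK > 0"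
    and K_diff: "\<And>x. diff_upto m (K x) (- {x})"
    and K_size: "\<And>x y is. x \<noteq> y \<Longrightarrow> length is \<le> m \<Longrightarrow>
          norm (pds is (K x) y) \<le> CK * dist x y powr (- (real CARD('n) + real (length is)))"
    and K_x: "\<And>x y h is. x \<noteq> y \<Longrightarrow> norm h \<le> dist x y / 2 \<Longrightarrow> length is = m \<Longrightarrow>
          norm (pds is (K x) y - pds is (K (x + h)) y)
            \<le> CK * norm h powr \<delta> * dist x y powr (- (real CARD('n) + (real m + \<delta>)))"
    and K_y: "\<And>x y h is. x \<noteq> y \<Longrightarrow> norm h \<le> dist x y / 2 \<Longrightarrow> length is = m \<Longrightarrow>
          norm (pds is (K x) y - pds is (K x) (y + h))
            \<le> CK * norm h powr \<delta> * dist x y powr (- (real CARD('n) + (real m + \<delta>)))"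
begin

text \<open>The condition on \<open>x\<close>-differences is scale invariant only for derivatives of top order;
  the lower orders are recovered by integrating along the ray that leads from \<open>y\<close> away from \<open>x\<close> to infinity.\<close>

lemma K_x_step:
  assumes IH: "\<And>x y h is. x \<noteq> y \<Longrightarrow> norm h \<le> dist x y / 2 \<Longrightarrow> length is = Suc j \<Longrightarrow>
      norm (pds is (K x) y - pds is (K (x + h)) y)
        \<le> C * norm h powr \<delta> * dist x y powr (- (real CARD('n) + (real (Suc j) + \<delta>)))"
    and j: "Suc j \<le> m" and C: "C \<ge> 0"
    and xy: "x \<noteq> y" "norm h \<le> dist x y / 2" "length is = j"
  shows "norm (pds is (K x) y - pds is (K (x + h)) y)
        \<le> real CARD('n) * C * norm h powr \<delta> * dist x y powr (- (real CARD('n) + (real j + \<delta>)))"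
proof -
  let ?d = "real CARD('n)"
  have d1: "1 \<le> ?d" by (rule one_le_card)
  define r where "r = dist x y"
  have r: "r > 0" using xy by (simp add: r_def)
  \<comment> \<open>Unit direction of the ray. Along it the distance from x grows at unit speed, and
    the distance from x + h stays at least r/2 + t.\<close>
  define v where "v = (1 / r) *\<^sub>R (y - x)"
  have nv: "norm v = 1" using r by (simp add: v_def r_def dist_norm norm_minus_commute)
  define G where "G z = pds is (K x) z - pds is (K (x + h)) z" for z
  define y' where "y' t = y + t *\<^sub>R v" for t
  have dxy: "dist x (y' t) = r + t" if "t \<ge> 0" for t
  proof -
    have "y' t - x = (1 + t / r) *\<^sub>R (y - x)"
      using r by (simp add: y'_def v_def algebra_simps)
    then have "norm (y' t - x) = (1 + t / r) * r"
      using r that by (simp add: r_def dist_norm norm_minus_commute)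
    then show ?thesis using r by (simp add: dist_norm norm_minus_commute algebra_simps)
  qed
  have dxh: "dist (x + h) (y' t) \<ge> r / 2 + t" if "t \<ge> 0" for t
  proof -
    have "dist x (y' t) \<le> dist x (x + h) + dist (x + h) (y' t)" by (rule dist_triangle)
    also have "dist x (x + h) = norm h" by (simp add: dist_norm)
    finally show ?thesis using dxy[OF that] xy(2) unfolding r_def by linarith
  qed
  have ne: "x \<noteq> y' t" "x + h \<noteq> y' t" if "t \<ge> 0" for t
    using dxy[OF that] dxh[OF that] r that by auto
  have diff1: "pds is (K x) differentiable at (y' t)" "pds is (K (x + h)) differentiable at (y' t)" if "t \<ge> 0" for t
    using K_diff[of x] K_diff[of "x + h"] ne[OF that] j xy(3) unfolding diff_upto_def by auto
  define e where "e = ?d + real j + \<delta>"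
  have e1: "e \<ge> 1" unfolding e_def using d1 \<delta> of_nat_0_le_iff[of j, where 'a = real] by linarith
  define B where "B = ?d * C * norm h powr \<delta>"
  have B: "B \<ge> 0" using C by (simp add: B_def)
  have Gd: "G differentiable at (y' t)" and Gb: "norm (frechet_derivative G (at (y' t)) v) \<le> B * (r + t) powr (- e - 1)"
    if "t \<ge> 0" for t
  proof -
    show Gd: "G differentiable at (y' t)" unfolding G_def using diff1[OF that] by (rule differentiable_diff)
    have "norm (frechet_derivative G (at (y' t)) v) \<le> ?d * (C * norm h powr \<delta> * (r + t) powr (- (?d + (real (Suc j) + \<delta>)))) * norm v"
    proof (rule norm_frechet_le[OF Gd])
      fix i
      have "pd i G (y' t) = pds (i # is) (K x) (y' t) - pds (i # is) (K (x + h)) (y' t)"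
        unfolding G_def using pd_diff[OF diff1[OF that]] by simp
      also have "norm \<dots> \<le> C * norm h powr \<delta> * dist x (y' t) powr (- (?d + (real (Suc j) + \<delta>)))"
      proof (rule IH)
        show "norm h \<le> dist x (y' t) / 2" using xy(2) dxy[OF that] that unfolding r_def by linarith
      qed (use ne[OF that] xy in auto)
      finally show "norm (pd i G (y' t)) \<le> C * norm h powr \<delta> * (r + t) powr (- (?d + (real (Suc j) + \<delta>)))"
        unfolding dxy[OF that] .
    qed
    also have "- (?d + (real (Suc j) + \<delta>)) = - e - 1" by (simp add: e_def)
    finally show "norm (frechet_derivative G (at (y' t)) v) \<le> B * (r + t) powr (- e - 1)"
      unfolding nv B_def by (simp only: mult.assoc mult_1_right)
  qed
  have gder: "((\<lambda>t. G (y' t)) has_vector_derivative frechet_derivative G (at (y' t)) v) (at t)" if "t \<ge> 0" for t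
  proof -
    have "(y' has_derivative (\<lambda>s. s *\<^sub>R v)) (at t)"
      unfolding y'_def by (auto intro!: derivative_eq_intros)
    from has_derivative_compose[OF this Gd[OF that, unfolded frechet_derivative_works]]
    show ?thesis
      unfolding has_vector_derivative_def
      using linear_cmul[OF linear_frechet_derivative[OF Gd[OF that]]] by simp
  qed
  have bnd: "norm (G y) \<le> B * r powr (- e) + 2 * CK / T" if T: "T \<ge> 1" for T
  proof -
    \<comment> \<open>An antiderivative of the derivative bound along the ray; its increment is at
      most (B/e) r^-e, and e \<ge> 1.\<close>
    define \<phi> where "\<phi> t = - (B / e) * (r + t) powr (- e)" for t
    have \<phi>der: "(\<phi> has_vector_derivative B * (r + t) powr (- e - 1)) (at t)" if "t \<ge> 0" for t
      unfolding \<phi>_def has_real_derivative_iff_has_vector_derivative[symmetric]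
      using r that e1 by (auto intro!: derivative_eq_intros simp: field_simps)
    have "norm (G (y' T) - G (y' 0)) \<le> \<phi> T - \<phi> 0"
    proof (rule differentiable_bound_general[where f' = "\<lambda>t. frechet_derivative G (at (y' t)) v" and \<phi>' = "\<lambda>t. B * (r + t) powr (- e - 1)"])
      show "continuous_on {0..T} (\<lambda>t. G (y' t))"
        using gder has_vector_derivative_continuous by (intro continuous_at_imp_continuous_on) fastforce
      show "continuous_on {0..T} \<phi>"
        using \<phi>der has_vector_derivative_continuous by (intro continuous_at_imp_continuous_on) fastforce
    qed (use T gder \<phi>der Gb in auto)
    also have "\<dots> \<le> (B / e) * r powr (- e)"
      using B e1 by (simp add: \<phi>_def)
    also have "\<dots> \<le> B * r powr (- e)"
      using B e1 by (intro mult_right_mono) (auto simp: divide_le_eq mult_left_mono[of 1 e B, simplified])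
    finally have 1: "norm (G (y' T) - G (y' 0)) \<le> B * r powr (- e)" .
    \<comment> \<open>As d \<ge> 1, the size condition makes both kernels decay at least like 1/T at
      the far end, so the boundary term disappears as T grows.\<close>
    have aux: "CK * D powr (- (?d + real j)) \<le> CK / T" if "D \<ge> T" for D
    proof -
      have "- (?d + real j) \<le> - 1" using d1 of_nat_0_le_iff[of j, where 'a = real] by linarith
      then have "D powr (- (?d + real j)) \<le> D powr (- 1)" by (rule powr_mono) (use that T in linarith)
      also have "\<dots> = 1 / D" using that T by (simp add: powr_minus divide_inverse)
      also have "\<dots> \<le> 1 / T" using that T by (intro divide_left_mono) auto
      finally show ?thesis using CK mult_left_mono[of _ "1 / T" CK] by simp
    qed
    have T0: "T \<ge> 0" using T by simp
    have "norm (pds is (K x) (y' T)) \<le> CK / T"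
      using K_size[OF ne(1)[OF T0], of "is"] xy(3) j aux[of "dist x (y' T)"] dxy[OF T0] r by auto
    moreover have "norm (pds is (K (x + h)) (y' T)) \<le> CK / T"
      using K_size[OF ne(2)[OF T0], of "is"] xy(3) j aux[of "dist (x + h) (y' T)"] dxh[OF T0] r by auto
    ultimately have "norm (G (y' T)) \<le> CK / T + CK / T"
      unfolding G_def using norm_triangle_ineq4[of "pds is (K x) (y' T)" "pds is (K (x + h)) (y' T)"] by linarith
    moreover have "norm (G (y' 0)) \<le> norm (G (y' T)) + norm (G (y' T) - G (y' 0))"
      by (metis norm_triangle_sub norm_minus_commute)
    moreover have "y' 0 = y" by (simp add: y'_def)
    ultimately show ?thesis using 1 by simp
  qed
  have "norm (G y) \<le> B * r powr (- e)"
  proof (rule field_le_epsilon)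
    fix \<epsilon> :: real assume \<epsilon>: "\<epsilon> > 0"
    define T where "T = max 1 (2 * CK / \<epsilon>)"
    have "2 * CK / T \<le> \<epsilon>" using \<epsilon> CK by (auto simp: T_def field_simps max_def)
    then show "norm (G y) \<le> B * r powr (- e) + \<epsilon>" using bnd[of T] by (simp add: T_def)
  qed
  then show ?thesis by (simp add: G_def B_def e_def r_def add.assoc)
qed

text \<open>Descends from order m to order 0 by \<open>K_x_step\<close>, at a factor d for each
  order.\<close>

lemma K_x0:
  assumes xy: "x \<noteq> y" "norm h \<le> dist x y / 2"
  shows "norm (K x y - K (x + h) y)
        \<le> CK * real CARD('n) ^ m * norm h powr \<delta> * dist x y powr (- (real CARD('n) + \<delta>))"
proof -
  have "\<forall>x y h is. x \<noteq> y \<longrightarrow> norm h \<le> dist x y / 2 \<longrightarrow> length is = m - n \<longrightarrow>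
      norm (pds is (K x) y - pds is (K (x + h)) y)
        \<le> CK * real CARD('n) ^ n * norm h powr \<delta> * dist x y powr (- (real CARD('n) + (real (m - n) + \<delta>)))"
    if "n \<le> m" for n
    using that
  proof (induction n)
    case 0
    then show ?case using K_x by auto
  next
    case (Suc n)
    have s: "m - n = Suc (m - Suc n)" using Suc.prems by simp
    show ?case
    proof (intro allI impI)
      fix x y h :: "real^'n" and "is" :: "'n list"
      assume a: "x \<noteq> y" "norm h \<le> dist x y / 2" "length is = m - Suc n"
      have "norm (pds is (K x) y - pds is (K (x + h)) y)
        \<le> real CARD('n) * (CK * real CARD('n) ^ n) * norm h powr \<delta> * dist x y powr (- (real CARD('n) + (real (m - Suc n) + \<delta>)))"
        by (rule K_x_step[OF _ _ _ a]) (use Suc s CK in auto)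
      then show "norm (pds is (K x) y - pds is (K (x + h)) y)
        \<le> CK * real CARD('n) ^ Suc n * norm h powr \<delta> * dist x y powr (- (real CARD('n) + (real (m - Suc n) + \<delta>)))"
        by (simp add: mult_ac)
    qed
  qed
  from this[of m, rule_format, of x y h "[]"] xy show ?thesis by simp
qed

lemma powr_neg_nat: "D > 0 \<Longrightarrow> D powr (- (real n + real k)) = 1 / (D ^ n * D ^ k)"
  by (subst powr_minus) (simp add: powr_add powr_realpow divide_inverse)

text \<open>Close pairs y, y' are treated by the regularity in y, distant ones by the size bound
  alone. The factor 4/c beyond the size bound pays for the distant pairs, where (|y -
  y'|/D)^\<delta> \<ge> c/2, and also absorbs c^-\<delta> \<le> 1/c for the close ones.\<close>

lemma hc_K:
  assumes D: "0 < D" and c: "0 < c" "c \<le> 1" and far: "\<And>y. y \<in> U \<Longrightarrow> c * D \<le> dist x y"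
  shows "hc m \<delta> (4 * CK / c ^ (CARD('n) + m + 1) / D ^ CARD('n)) D U (K x)"
  unfolding hc_iff[OF D]
proof (intro conjI allI impI ballI)
  let ?d = "CARD('n)"
  let ?A = "4 * CK / c ^ (?d + m + 1) / D ^ ?d"
  have ne: "x \<noteq> y" if "y \<in> U" for y
  proof
    assume "x = y"
    then have "c * D \<le> 0" using far[OF that] by simp
    then show False using mult_pos_pos[OF c(1) D] by linarith
  qed
  have size: "norm (pds is (K x) y) \<le> CK / c ^ (?d + m) / D ^ ?d / D ^ length is"
    if "length is \<le> m" "y \<in> U" for "is" y
  proof -
    have "norm (pds is (K x) y) \<le> CK * dist x y powr (- (real ?d + real (length is)))"
      by (rule K_size[OF ne[OF that(2)] that(1)])
    also have "\<dots> \<le> CK * (c * D) powr (- (real ?d + real (length is)))"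
      using CK far[OF that(2)] D c by (intro mult_left_mono powr_mono2') auto
    also have "\<dots> = CK / c ^ (?d + length is) / D ^ ?d / D ^ length is"
      by (subst powr_neg_nat) (use D c in \<open>auto simp: power_add power_mult_distrib\<close>)
    also have "\<dots> \<le> CK / c ^ (?d + m) / D ^ ?d / D ^ length is"
      using D c CK that(1) by (intro divide_right_mono divide_left_mono power_decreasing) auto
    finally show ?thesis .
  qed
  have CA: "CK / c ^ (?d + m) / D ^ ?d \<le> c / 4 * ?A" using c CK D by (simp add: field_simps)
  have A0: "0 \<le> ?A" using CK c D by simp
  have quarter: "a / 4 \<le> a" if "0 \<le> a" for a :: real using that by simp
  fix "is" :: "'n list"
  show "pds is (K x) differentiable at y" if "length is < m" "y \<in> U" for y
    using K_diff[of x] that ne[OF that(2)] unfolding diff_upto_def by auto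
  show "norm (pds is (K x) y) \<le> ?A / D ^ length is" if "length is \<le> m" "y \<in> U" for y
  proof -
    have "c / 4 * ?A \<le> 1 * ?A" using c A0 by (intro mult_right_mono) auto
    then have "CK / c ^ (?d + m) / D ^ ?d \<le> ?A" using CA by linarith
    then have "CK / c ^ (?d + m) / D ^ ?d / D ^ length is \<le> ?A / D ^ length is"
      by (rule divide_right_mono) (use D in simp)
    then show ?thesis using size[OF that] by linarith
  qed
  show "norm (pds is (K x) y - pds is (K x) y') \<le> ?A / D ^ m * (dist y y' / D) powr \<delta>"
    if l: "length is = m" "y \<in> U" "y' \<in> U" for y y'
  proof (cases "dist y y' \<le> dist x y / 2")
    case True
    have "norm (pds is (K x) y - pds is (K x) (y + (y' - y)))
       \<le> CK * norm (y' - y) powr \<delta> * dist x y powr (- (real ?d + (real m + \<delta>)))"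
      by (rule K_y[OF ne[OF l(2)] _ l(1)]) (use True in \<open>simp add: dist_norm norm_minus_commute\<close>)
    also have "\<dots> \<le> CK * norm (y' - y) powr \<delta> * (c * D) powr (- (real ?d + (real m + \<delta>)))"
      using CK far[OF l(2)] D c \<delta> by (intro mult_left_mono powr_mono2') auto
    also have "(c * D) powr (- (real ?d + (real m + \<delta>))) = (c * D) powr (- (real ?d + real m)) * (c * D) powr (- \<delta>)"
      by (simp add: powr_add[symmetric] algebra_simps)
    also have "(c * D) powr (- (real ?d + real m)) = 1 / c ^ (?d + m) / D ^ ?d / D ^ m"
      by (subst powr_neg_nat) (use D c in \<open>auto simp: power_add power_mult_distrib\<close>)
    also have "(c * D) powr (- \<delta>) = c powr (- \<delta>) * D powr (- \<delta>)" using c D by (simp add: powr_mult)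
    also have "CK * norm (y' - y) powr \<delta> * (1 / c ^ (?d + m) / D ^ ?d / D ^ m * (c powr (- \<delta>) * D powr (- \<delta>)))
      = c powr (- \<delta>) * (CK / c ^ (?d + m) / D ^ ?d) / D ^ m * (norm (y' - y) powr \<delta> * D powr (- \<delta>))"
      by simp
    also have "norm (y' - y) powr \<delta> * D powr (- \<delta>) = (dist y y' / D) powr \<delta>"
      using D powr_divide[of "dist y y'" D \<delta>] by (simp add: dist_norm norm_minus_commute powr_minus divide_inverse)
    also have "c powr (- \<delta>) * (CK / c ^ (?d + m) / D ^ ?d) / D ^ m * (dist y y' / D) powr \<delta>
       \<le> ?A / D ^ m * (dist y y' / D) powr \<delta>"
    proof (intro mult_right_mono divide_right_mono)
      have "c powr (- \<delta>) \<le> c powr (- 1)" using c \<delta> by (intro powr_mono') auto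
      also have "\<dots> = 1 / c" using c by (simp add: powr_minus divide_inverse)
      finally have "c powr (- \<delta>) * (CK / c ^ (?d + m) / D ^ ?d) \<le> 1 / c * (c / 4 * ?A)"
        using CA CK c D by (intro mult_mono) auto
      also have "\<dots> = ?A / 4" using c by (simp add: field_simps)
      also have "\<dots> \<le> ?A" by (rule quarter[OF A0])
      finally show "c powr (- \<delta>) * (CK / c ^ (?d + m) / D ^ ?d) \<le> ?A" .
    qed (use D in auto)
    finally show ?thesis by simp
  next
    case False
    then have "c / 2 \<le> dist y y' / D" using far[OF l(2)] D by (simp add: field_simps)
    then have "(c / 2) powr \<delta> \<le> (dist y y' / D) powr \<delta>" using c \<delta> by (intro powr_mono2) auto
    moreover have "c / 2 \<le> (c / 2) powr \<delta>" using c \<delta> by (intro le_powr_of_le_one) auto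
    ultimately have p: "c / 2 \<le> (dist y y' / D) powr \<delta>" by linarith
    have "norm (pds is (K x) y - pds is (K x) y') \<le> norm (pds is (K x) y) + norm (pds is (K x) y')"
      by (rule norm_triangle_ineq4)
    also have "\<dots> \<le> c / 4 * ?A / D ^ m + c / 4 * ?A / D ^ m"
    proof (intro add_mono)
      have sz: "norm (pds is (K x) z) \<le> c / 4 * ?A / D ^ m" if "z \<in> U" for z
      proof -
        have "norm (pds is (K x) z) \<le> CK / c ^ (?d + m) / D ^ ?d / D ^ m" using size[of "is" z] l(1) that by simp
        also have "\<dots> \<le> c / 4 * ?A / D ^ m" by (rule divide_right_mono[OF CA]) (use D in simp)
        finally show ?thesis .
      qed
      show "norm (pds is (K x) y) \<le> c / 4 * ?A / D ^ m" "norm (pds is (K x) y') \<le> c / 4 * ?A / D ^ m"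
        using sz l by blast+
    qed
    also have "\<dots> = ?A / D ^ m * (c / 2)" by (simp add: field_simps)
    also have "\<dots> \<le> ?A / D ^ m * (dist y y' / D) powr \<delta>"
      by (rule mult_left_mono[OF p divide_nonneg_nonneg[OF A0]]) (use D in simp)
    finally show ?thesis .
  qed
qed

text \<open>\<open>sk x' C k\<close>: the function \<open>k\<close> has the size and regularity of a Calderon-Zygmund kernel with pole \<open>x'\<close>.\<close>

definition sk :: "real^'n \<Rightarrow> real \<Rightarrow> (real^'n \<Rightarrow> complex) \<Rightarrow> bool" where
  "sk x' C k \<longleftrightarrow> (\<forall>y0. y0 \<noteq> x' \<longrightarrow>
     hc m \<delta> (C / dist x' y0 ^ CARD('n)) (dist x' y0) (ball y0 (dist x' y0 / (16 * real CARD('n)))) k)"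

lemma sk_K: "sk x (4 * CK * 2 ^ (CARD('n) + m + 1)) (K x)"
  unfolding sk_def
proof (intro allI impI)
  fix y0 :: "real^'n" assume "y0 \<noteq> x"
  then have D: "0 < dist x y0" by simp
  have d1: "1 \<le> real CARD('n)" by (rule one_le_card)
  have e: "4 * CK / (1 / 2) ^ N = 4 * CK * 2 ^ N" for N by (simp add: power_one_over)
  have "1 / 2 * dist x y0 \<le> dist x y" if "y \<in> ball y0 (dist x y0 / (16 * real CARD('n)))" for y
  proof -
    have "dist x y0 / (16 * real CARD('n)) \<le> dist x y0 / 16"
      using d1 D by (intro divide_left_mono) auto
    moreover have "dist y0 y < dist x y0 / (16 * real CARD('n))" using that by simp
    ultimately show ?thesis using dist_triangle[of x y0 y] dist_commute[of y y0] D by linarith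
  qed
  then have "hc m \<delta> (4 * CK / (1 / 2) ^ (CARD('n) + m + 1) / dist x y0 ^ CARD('n)) (dist x y0)
      (ball y0 (dist x y0 / (16 * real CARD('n)))) (K x)"
    by (intro hc_K[OF D]) auto
  then show "hc m \<delta> (4 * CK * 2 ^ (CARD('n) + m + 1) / dist x y0 ^ CARD('n)) (dist x y0)
      (ball y0 (dist x y0 / (16 * real CARD('n)))) (K x)"
    by (simp only: e)
qed

text \<open>The far field of the kernel seen from a cube. It is the kernel of the difference between
  the operators localised to a cube and to a subcube; the smooth cutoff keeps it usable as a test
  function.\<close>

definition Kt :: "real^'n \<Rightarrow> real \<Rightarrow> real^'n \<Rightarrow> real^'n \<Rightarrow> complex" where
  "Kt b p x y = (1 - eta m b p y) *\<^sub>R K x y"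

text \<open>The pole may be moved from x to any x' in the same cube. Where the ball around
  \<open>y0\<close> comes close to the cube, the truncation makes the kernel vanish; elsewhere the
  ball keeps from x a fixed fraction of its distance D from x'.\<close>

lemma sk_Kt_exists:
  "\<exists>C\<ge>1. \<forall>b p x x'. p > 0 \<longrightarrow> x \<in> cube_of b p \<longrightarrow> x' \<in> cube_of b p \<longrightarrow> sk x' C (Kt b p x)"
proof -
  let ?d = "real CARD('n)"
  have d1: "1 \<le> ?d" by (rule one_le_card)
  obtain E where E: "E \<ge> 1" "\<And>l a. l > 0 \<Longrightarrow> hc m \<delta> E l UNIV (eta m (a::real^'n) l)"
    using hc_eta[OF \<delta>, of m, where 'n = 'n] by blast
  define c where "c = 1 / (16 * ?d)"
  have c: "0 < c" "c \<le> 1 / 16" "c * ?d = 1 / 16" using d1 by (auto simp: c_def field_simps)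
  have d8: "1 \<le> 8 * ?d" using d1 by linarith
  define E' where "E' = 1 + E * (8 * ?d) ^ Suc m"
  have E'1: "1 \<le> E'" using E by (simp add: E'_def)
  define A where "A = 4 * CK / c ^ (CARD('n) + m + 1)"
  have A: "A > 0" using CK c by (simp add: A_def)
  define C where "C = max 1 (2 * (4 * ?d) ^ m * (E' * A))"
  have C1: "1 \<le> C" by (simp add: C_def)
  have "sk x' C (Kt b p x)" if p: "p > 0" and x: "x \<in> cube_of b p" and x': "x' \<in> cube_of b p" for b p x x'
    unfolding sk_def
  proof (intro allI impI)
    fix y0 :: "real^'n" assume "y0 \<noteq> x'"
    define D where "D = dist x' y0"
    have D: "0 < D" using \<open>y0 \<noteq> x'\<close> by (simp add: D_def)
    define U where "U = ball y0 (c * D)"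
    have U: "open U" "convex U" by (auto simp: U_def)
    have "hc m \<delta> (C / D ^ CARD('n)) D U (Kt b p x)"
    proof (cases "\<exists>q\<in>cube_of b p. dist y0 q < 2 * c * D")
      case True
      then obtain q where q: "q \<in> cube_of b p" "dist y0 q < 2 * c * D" by blast
      have "D \<le> dist x' q + dist q y0" unfolding D_def by (rule dist_triangle)
      also have "dist x' q \<le> ?d * p" by (rule dist_cube[OF x' q(1)])
      finally have "D \<le> ?d * p + 2 * c * D" using q(2) by (simp add: dist_commute)
      moreover have "c * D \<le> 1 / 16 * D" using c D by (intro mult_right_mono) auto
      ultimately have "D \<le> 8 / 7 * (?d * p)" by linarith
      then have "c * D \<le> c * (8 / 7 * (?d * p))" using c by (intro mult_left_mono) auto
      also have "\<dots> = p / 14" using c(3) by (simp add: algebra_simps)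
      finally have cD: "c * D \<le> p / 14" .
      have "eta m b p y = 1" if "y \<in> U" for y
      proof (rule eta_one[OF _ p])
        fix i
        have "dist y q < 3 * c * D"
          using that q(2) dist_triangle[of y q y0] by (simp add: U_def dist_commute)
        then have "\<bar>y $ i - q $ i\<bar> \<le> p / 2" using component_le_dist[of y i q] cD p by linarith
        moreover have "b $ i \<le> q $ i" "q $ i < b $ i + p" using q(1) by (auto simp: mem_cube)
        ultimately show "b $ i - p / 2 \<le> y $ i \<and> y $ i \<le> b $ i + 3 * p / 2" by linarith
      qed
      then have z: "Kt b p x y = 0" if "y \<in> U" for y using that by (simp add: Kt_def)
      have "hc m \<delta> (C / D ^ CARD('n)) D U (\<lambda>y. 0 :: complex)"
        using C1 D by (intro hc_zero) auto
      then show ?thesis by (rule hc_congI[OF _ U(1)]) (simp add: z)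
    next
      case False
      have far: "c * D \<le> dist x y" if "y \<in> U" for y
      proof -
        have "\<not> dist y0 x < 2 * c * D" using False x by blast
        then show ?thesis using that dist_triangle[of y0 x y] by (simp add: U_def dist_commute)
      qed
      have hK: "hc m \<delta> (A / D ^ CARD('n)) D U (K x)"
        unfolding A_def using hc_K[OF D c(1) _ far] c(2) by simp
      \<comment> \<open>Up to D = 8 d p the cutoff is regular at scale D after enlarging its
        constant; beyond that the ball misses the support of the cutoff and the factor is 1.\<close>
      have he: "hc m \<delta> E' D U (\<lambda>y. 1 - eta m b p y)"
      proof (cases "D \<le> 8 * ?d * p")
        case True
        have "hc m \<delta> (E * (8 * ?d) ^ Suc m) (8 * ?d * p) UNIV (eta m b p)"
          by (rule hc_rescale_up[OF E(2)[OF p] d8]) (use p E \<delta> in auto)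
        then have "hc m \<delta> (E * (8 * ?d) ^ Suc m) D U (eta m b p)"
          by (rule hc_mono) (use True D E \<delta> d1 in auto)
        then have "hc m \<delta> (\<bar>- 1\<bar> * (E * (8 * ?d) ^ Suc m)) D U (\<lambda>y. (- 1) *\<^sub>R eta m b p y)"
          by (rule hc_scale[OF _ U(1)])
        then have "hc m \<delta> (1 + \<bar>- 1\<bar> * (E * (8 * ?d) ^ Suc m)) D U (\<lambda>y. 1 + (- 1) *\<^sub>R eta m b p y)"
          by (intro hc_add hc_const D U(1)) auto
        then show ?thesis by (simp add: E'_def del: power_Suc)
      next
        case False
        have "eta m b p y = 0" if "y \<in> U" for y
        proof (rule ccontr)
          assume nz: "eta m b p y \<noteq> 0"
          have "dist x' y \<le> ?d * (2 * p)"
          proof (rule dist_le_card)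
            fix i show "\<bar>x' $ i - y $ i\<bar> \<le> 2 * p"
              using eta_nonzero[OF nz p, of i] x'[unfolded mem_cube, rule_format, of i] p by linarith
          qed
          moreover have "D \<le> dist x' y + c * D"
            using that dist_triangle[of x' y0 y] by (simp add: U_def D_def dist_commute)
          moreover have "c * D \<le> 1 / 16 * D" using c D by (intro mult_right_mono) auto
          ultimately show False using False D by linarith
        qed
        moreover have "hc m \<delta> E' D U (\<lambda>y. 1::real)" using hc_const[of 1 E' D] E'1 D by simp
        ultimately show ?thesis by (elim hc_congI[OF _ U(1)]) auto
      qed
      have "hc m \<delta> (2 * (4 * ?d) ^ m * (E' * (A / D ^ CARD('n)))) D U (\<lambda>y. (1 - eta m b p y) *\<^sub>R K x y)"
        by (rule hc_mult[OF he hK U D]) (use E'1 A D \<delta> in auto)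
      moreover have "2 * (4 * ?d) ^ m * (E' * (A / D ^ CARD('n))) \<le> C / D ^ CARD('n)"
        using divide_right_mono[of "2 * (4 * ?d) ^ m * (E' * A)" C "D ^ CARD('n)"] D by (simp add: C_def)
      ultimately show ?thesis unfolding Kt_def[abs_def]
        by (elim hc_mono) (use C1 D \<delta> in auto)
    qed
    moreover have "U = ball y0 (dist x' y0 / (16 * ?d))" by (simp add: U_def c_def D_def)
    ultimately show "hc m \<delta> (C / dist x' y0 ^ CARD('n)) (dist x' y0) (ball y0 (dist x' y0 / (16 * ?d))) (Kt b p x)"
      unfolding D_def by simp
  qed
  then show ?thesis using C1 by blast
qed

lemma Kt_nonzero_far:
  assumes p: "p > 0" and x: "x \<in> cube_of b p" and nz: "1 - eta m b p y \<noteq> 0"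
  shows "p / 2 \<le> dist x y"
proof -
  have "\<not> (\<forall>i. b $ i - p / 2 \<le> y $ i \<and> y $ i \<le> b $ i + 3 * p / 2)"
    using eta_one[OF _ p, of b y m] nz by auto
  then obtain i where "\<not> (b $ i - p / 2 \<le> y $ i \<and> y $ i \<le> b $ i + 3 * p / 2)" by blast
  then have "p / 2 \<le> \<bar>x $ i - y $ i\<bar>" using x[unfolded mem_cube, rule_format, of i] by linarith
  then show ?thesis using component_le_dist[of x i y] by linarith
qed

text \<open>The cutoff is common to both kernels, so only K x - K x' matters. If |x - x'| \<le> r/2
  the regularity in x applies; otherwise r \<le> 2 d p, and the size bound suffices because the
  truncation keeps y at distance at least p/2 from both points.\<close>

lemma Kt_diff_bound:
  assumes p: "p > 0" and x: "x \<in> cube_of b p" and x': "x' \<in> cube_of b p"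
  shows "cmod (Kt b p x y - Kt b p x' y) \<le> CK * (4 * real CARD('n)) ^ (CARD('n) + m + 1) * p powr \<delta> *
    (indicat_real {y. p / 2 \<le> dist x y} y * dist x y powr (- (real CARD('n) + \<delta>)))"
proof (cases "1 - eta m b p y = 0")
  case True
  then show ?thesis using CK by (simp add: Kt_def)
next
  case False
  let ?d = "real CARD('n)"
  have d1: "1 \<le> ?d" by (rule one_le_card)
  have d4: "1 \<le> 4 * ?d" using d1 by linarith
  have far: "p / 2 \<le> dist x y" "p / 2 \<le> dist x' y"
    using Kt_nonzero_far[OF p x False] Kt_nonzero_far[OF p x' False] by auto
  define r where "r = dist x y"
  have "0 < p / 2" using p by simp
  then have "0 < dist x y" "0 < dist x' y" using far less_le_trans by blast+
  then have ne: "x \<noteq> y" "x' \<noteq> y" by auto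
  have r: "r > 0" using ne by (simp add: r_def)
  have h: "norm (x' - x) \<le> ?d * p" using dist_cube[OF x' x] by (simp add: dist_norm)
  let ?M = "CK * (4 * ?d) ^ (CARD('n) + m + 1)"
  have M: "CK * ?d ^ m * ?d \<le> ?M"
  proof -
    have "?d ^ m * ?d = ?d ^ (m + 1)" by simp
    also have "\<dots> \<le> (4 * ?d) ^ (m + 1)" using d1 by (intro power_mono) auto
    also have "\<dots> \<le> (4 * ?d) ^ (CARD('n) + m + 1)" using d4 by (intro power_increasing) auto
    finally show ?thesis using CK by (simp add: mult.assoc)
  qed
  have "cmod (K x y - K x' y) \<le> ?M * p powr \<delta> * r powr (- (?d + \<delta>))"
  proof (cases "norm (x' - x) \<le> r / 2")
    case True
    have "cmod (K x y - K (x + (x' - x)) y) \<le> CK * ?d ^ m * norm (x' - x) powr \<delta> * r powr (- (?d + \<delta>))"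
      unfolding r_def by (rule K_x0[OF ne(1)]) (use True in \<open>simp add: r_def\<close>)
    also have "\<dots> \<le> CK * ?d ^ m * (?d * p powr \<delta>) * r powr (- (?d + \<delta>))"
    proof (intro mult_right_mono mult_left_mono)
      have "norm (x' - x) powr \<delta> \<le> (?d * p) powr \<delta>" using h \<delta> by (intro powr_mono2) auto
      also have "\<dots> = ?d powr \<delta> * p powr \<delta>" using p d1 by (simp add: powr_mult)
      also have "\<dots> \<le> ?d powr 1 * p powr \<delta>" using d1 \<delta> by (intro mult_right_mono powr_mono) auto
      finally show "norm (x' - x) powr \<delta> \<le> ?d * p powr \<delta>" using d1 by simp
    qed (use CK in auto)
    also have "\<dots> = (CK * ?d ^ m * ?d) * (p powr \<delta> * r powr (- (?d + \<delta>)))" by simp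
    also have "\<dots> \<le> ?M * (p powr \<delta> * r powr (- (?d + \<delta>)))" using M by (intro mult_right_mono) auto
    finally show ?thesis by (simp add: mult.assoc)
  next
    case False
    then have rp: "r \<le> 2 * (?d * p)" using h by linarith
    have sz: "cmod (K z y) \<le> CK * (p / 2) powr (- ?d)" if "z \<noteq> y" "p / 2 \<le> dist z y" for z
    proof -
      have "cmod (K z y) \<le> CK * dist z y powr (- ?d)" using K_size[OF that(1), of "[]"] by simp
      also have "\<dots> \<le> CK * (p / 2) powr (- ?d)" using CK that(2) p by (intro mult_left_mono powr_mono2') auto
      finally show ?thesis .
    qed
    have "cmod (K x y - K x' y) \<le> CK * (p / 2) powr (- ?d) + CK * (p / 2) powr (- ?d)"
      using sz[OF ne(1) far(1)] sz[OF ne(2) far(2)] norm_triangle_ineq4[of "K x y" "K x' y"] by linarith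
    also have "\<dots> = 2 * CK * (p / 2) powr (- ?d)" by simp
    also have "(p / 2) powr (- ?d) \<le> (4 * ?d) ^ CARD('n) * (2 * ?d) * (p powr \<delta> * r powr (- (?d + \<delta>)))"
    proof -
      have "(p / 2) powr (- ?d) = (4 * ?d) ^ CARD('n) * (2 * (?d * p)) powr (- ?d)"
        using p d1 by (simp add: powr_minus powr_realpow power_mult_distrib power_divide field_simps)
          (simp flip: power_mult_distrib)
      also have "(2 * (?d * p)) powr (- ?d) = (2 * (?d * p)) powr \<delta> * (2 * (?d * p)) powr (- (?d + \<delta>))"
        by (simp add: powr_add[symmetric])
      also have "(2 * (?d * p)) powr \<delta> * (2 * (?d * p)) powr (- (?d + \<delta>)) \<le> ((2 * ?d) * p powr \<delta>) * r powr (- (?d + \<delta>))"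
      proof (intro mult_mono)
        have pm: "(2 * ?d) powr \<delta> \<le> (2 * ?d) powr 1" by (rule powr_mono) (use d1 \<delta> in linarith)+
        have "(2 * (?d * p)) powr \<delta> = (2 * ?d) powr \<delta> * p powr \<delta>" using p d1 powr_mult[of "2 * ?d" p \<delta>] by (simp add: mult.assoc)
        also have "\<dots> \<le> (2 * ?d) powr 1 * p powr \<delta>" by (rule mult_right_mono[OF pm]) simp
        finally show "(2 * (?d * p)) powr \<delta> \<le> (2 * ?d) * p powr \<delta>" using d1 by simp
        show "(2 * (?d * p)) powr (- (?d + \<delta>)) \<le> r powr (- (?d + \<delta>))"
          using rp r \<delta> by (intro powr_mono2') auto
      qed auto
      finally show ?thesis by (simp add: mult_left_mono mult.assoc)
    qed
    also have "2 * CK * ((4 * ?d) ^ CARD('n) * (2 * ?d) * (p powr \<delta> * r powr (- (?d + \<delta>)))) = CK * (4 * ?d) ^ (CARD('n) + 1) * (p powr \<delta> * r powr (- (?d + \<delta>)))"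
      by simp
    also have "\<dots> \<le> ?M * (p powr \<delta> * r powr (- (?d + \<delta>)))"
      using CK d4 by (intro mult_right_mono mult_left_mono power_increasing) auto
    finally show ?thesis using CK by (simp add: mult.assoc mult_left_mono)
  qed
  moreover have "cmod (Kt b p x y - Kt b p x' y) \<le> cmod (K x y - K x' y)"
  proof -
    have "cmod (Kt b p x y - Kt b p x' y) = \<bar>1 - eta m b p y\<bar> * cmod (K x y - K x' y)"
      unfolding Kt_def by (metis norm_scaleR scaleR_diff_right)
    also have "\<dots> \<le> 1 * cmod (K x y - K x' y)"
      using eta_01[of m b p y] by (intro mult_right_mono) auto
    finally show ?thesis by simp
  qed
  ultimately show ?thesis using far by (simp add: r_def)
qed

text \<open>The factor p^\<delta> from the regularity cancels the (p/2)^-\<delta> of the tail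
  integral up to 2^\<delta> \<le> 2, so the bound is free of the scale. It serves the good part, for
  which only boundedness is known.\<close>

lemma Kt_osc_integral:
  assumes p: "p > 0" and x: "x \<in> cube_of b p" and x': "x' \<in> cube_of b p"
    and meas: "g \<in> borel_measurable lebesgue" and g: "\<And>y. cmod (g y) \<le> M" and M: "M \<ge> 0"
  shows "cmod (\<integral>y. (Kt b p x y - Kt b p x' y) * g y \<partial>lebesgue)
    \<le> CK * (4 * real CARD('n)) ^ (CARD('n) + m + 1) * (6 ^ CARD('n) / (1 - 2 powr (- \<delta>)) * 2) * M"
proof -
  let ?d = "real CARD('n)"
  let ?c = "CK * (4 * ?d) ^ (CARD('n) + m + 1)"
  let ?f = "\<lambda>y. indicat_real {y. p / 2 \<le> dist x y} y * dist x y powr (- (?d + \<delta>))"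
  note tail = integral_tail[of "p / 2" \<delta> x]
  have q: "2 powr (- \<delta>) < (1::real)" using \<delta> by (simp add: powr_less_one)
  have c0: "0 \<le> ?c" using CK by simp
  have "cmod (\<integral>y. (Kt b p x y - Kt b p x' y) * g y \<partial>lebesgue) \<le> (\<integral>y. ?c * p powr \<delta> * M * ?f y \<partial>lebesgue)"
  proof (rule norm_integral_le_bound)
    show "integrable lebesgue (\<lambda>y. ?c * p powr \<delta> * M * ?f y)"
      using tail(1) p \<delta> by (intro integrable_mult_right) auto
    fix y
    have "cmod ((Kt b p x y - Kt b p x' y) * g y) \<le> (?c * p powr \<delta> * ?f y) * M"
      unfolding norm_mult using Kt_diff_bound[OF p x x', of y] g[of y] M c0
      by (intro mult_mono) auto
    then show "cmod ((Kt b p x y - Kt b p x' y) * g y) \<le> ?c * p powr \<delta> * M * ?f y" by (simp only: mult_ac)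
  qed
  also have "\<dots> = ?c * p powr \<delta> * M * (\<integral>y. ?f y \<partial>lebesgue)" by simp
  also have "\<dots> \<le> ?c * p powr \<delta> * M * (6 ^ CARD('n) / (1 - 2 powr (- \<delta>)) * (p / 2) powr (- \<delta>))"
    using tail(2) p \<delta> M c0 by (intro mult_left_mono) auto
  also have "\<dots> = ?c * (6 ^ CARD('n) / (1 - 2 powr (- \<delta>)) * (p powr \<delta> * (p / 2) powr (- \<delta>))) * M"
    by simp
  also have "p powr \<delta> * (p / 2) powr (- \<delta>) = 2 powr \<delta>"
    using p by (simp add: powr_divide powr_minus field_simps)
  also have "?c * (6 ^ CARD('n) / (1 - 2 powr (- \<delta>)) * 2 powr \<delta>) * M \<le> ?c * (6 ^ CARD('n) / (1 - 2 powr (- \<delta>)) * 2) * M"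
  proof -
    have "(2::real) powr \<delta> \<le> 2" using powr_mono[of \<delta> 1 "2::real"] \<delta> by simp
    then show ?thesis using c0 q M by (intro mult_right_mono mult_left_mono) auto
  qed
  finally show ?thesis .
qed

lemma K_continuous: "continuous_on (- {x}) (K x)"
proof (rule continuous_at_imp_continuous_on, rule ballI)
  fix y0 assume "y0 \<in> - {x}"
  then have D: "dist x y0 > 0" "y0 \<noteq> x" by auto
  have "continuous_on (ball y0 (dist x y0 / (16 * real CARD('n)))) (K x)"
    using sk_K[of x] D \<delta> unfolding sk_def by (blast intro: hc_continuous_on)
  moreover have "y0 \<in> ball y0 (dist x y0 / (16 * real CARD('n)))"
    using D one_le_card[where 'n = 'n] by simp
  ultimately show "isCont (K x) y0" using continuous_on_eq_continuous_at open_ball by blast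
qed

lemma K_measurable: "K x \<in> borel_measurable lebesgue"
proof -
  have 1: "(\<lambda>y. indicator (- {x}) y *\<^sub>R K x y) \<in> borel_measurable borel"
    by (rule borel_measurable_continuous_on_indicator[OF _ K_continuous]) auto
  \<comment> \<open>The value of the kernel at its pole is arbitrary and is added back
    separately.\<close>
  have "(\<lambda>y. indicator (- {x}) y *\<^sub>R K x y + indicator {x} y *\<^sub>R K x x) \<in> borel_measurable borel"
    by (intro borel_measurable_add 1) measurable
  also have "(\<lambda>y. indicator (- {x}) y *\<^sub>R K x y + indicator {x} y *\<^sub>R K x x) = K x"
    by (rule ext) (simp add: indicator_def)
  finally show ?thesis by (simp add: measurable_completion)
qed

lemma Kt_measurable: "p > 0 \<Longrightarrow> Kt b p x \<in> borel_measurable lebesgue"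
proof -
  assume p: "p > 0"
  obtain E where "hc m \<delta> E p UNIV (eta m b p)" using hc_eta[OF \<delta>, of m, where 'n = 'n] p by blast
  then have "continuous_on UNIV (eta m b p)" using hc_continuous_on p \<delta> by blast
  then have "eta m b p \<in> borel_measurable lebesgue" by (rule measurable_continuous_lebesgue)
  then show ?thesis unfolding Kt_def[abs_def]
    by (intro borel_measurable_scaleR borel_measurable_diff K_measurable) auto
qed

text \<open>A crude bound that degenerates as p tends to 0; it serves integrability and dominated
  convergence for a fixed cube.\<close>

lemma Kt_bound:
  assumes p: "p > 0" and x: "x \<in> cube_of b p"
  shows "cmod (Kt b p x y) \<le> CK * (p / 2) powr (- real CARD('n))"
proof (cases "1 - eta m b p y = 0")
  case True
  then show ?thesis using CK by (simp add: Kt_def)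
next
  case False
  have far: "p / 2 \<le> dist x y" by (rule Kt_nonzero_far[OF p x False])
  then have "x \<noteq> y" using p by auto
  then have "cmod (K x y) \<le> CK * dist x y powr (- real CARD('n))" using K_size[of x y "[]"] by simp
  also have "\<dots> \<le> CK * (p / 2) powr (- real CARD('n))" using CK far p by (intro mult_left_mono powr_mono2') auto
  finally have 1: "cmod (K x y) \<le> CK * (p / 2) powr (- real CARD('n))" .
  have "cmod (Kt b p x y) \<le> 1 * cmod (K x y)"
    unfolding Kt_def norm_scaleR using eta_01[of m b p y] by (intro mult_right_mono) auto
  then show ?thesis using 1 by simp
qed

subsection \<open>The smooth Calderon-Zygmund decomposition\<close>

definition Eeta :: real where
  "Eeta = (SOME C. C \<ge> 1 \<and> (\<forall>l>0. \<forall>a::real^'n. hc m \<delta> C l UNIV (eta m a l)))"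

definition Eth :: real where
  "Eth = (SOME C. C \<ge> 1 \<and> (\<forall>l>0. \<forall>p::real^'n. hc m \<delta> C l UNIV (theta m l p)))"

definition dd :: real where "dd = real CARD('n)"

text \<open>Radius of activity in units of the cell side. It is quadratic in d because a ball of
  radius 4 d s about a piece has to fit into the ball of radius D/(16 d) on which the kernel is
  regular, where D > \<open>NN\<close> s.\<close>

definition NN :: real where "NN = 1000 * dd\<^sup>2"

definition Cm :: real where "Cm = 2 * (4 * dd) ^ m"

text \<open>A piece of side s and a nearby point of F fit into a cube of half-side (2
  \<open>NN\<close> + 6 d) s. The factor 3 covers both choices of test cube: twice this half-side,
  or the triple of Q when the half-side exceeds l.\<close>

definition tt :: real where "tt = 3 * (2 * NN + 6 * dd)"

definition Cpair :: real where "Cpair = 2 * (Cm * Eeta * tt ^ Suc m) * tt ^ CARD('n)"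

definition Cphi :: real where "Cphi = Cm * (Eth * Eth)"

text \<open>The first summand bounds the pairing of f with the cut-off kernel difference, the second
  the averages. The factor 4 dd^2 comes from \<open>hc_small\<close> with \<tau> = 4 dd, the
  additional 2 from the extension by zero.\<close>

definition Cbad :: real where "Cbad = Cpair * (2 * Cm * Cphi * (4 * dd\<^sup>2)) + Cpair * Cphi * (4 * dd\<^sup>2)"

text \<open>At most two consecutive generations have pieces whose cells contain a given point;
  within one generation the coarse partner cell has an index in a box with at most 4 d + 1 integers
  per axis.\<close>

definition OV :: nat where "OV = 2 * (4 * CARD('n) + 1) ^ CARD('n)"

lemma Eeta: "Eeta \<ge> 1" "l > 0 \<Longrightarrow> hc m \<delta> Eeta l UNIV (eta m (a::real^'n) l)"
  using someI_ex[OF hc_eta[OF \<delta>, of m, where 'n = 'n]] unfolding Eeta_def by auto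

lemma Eth: "Eth \<ge> 1" "l > 0 \<Longrightarrow> hc m \<delta> Eth l UNIV (theta m l (p::real^'n))"
  using someI_ex[OF hc_theta[OF \<delta>, of m, where 'n = 'n]] unfolding Eth_def by auto

lemma dd1: "1 \<le> dd" unfolding dd_def by (rule one_le_card)

lemma NN_ge: "1000 * dd \<le> NN"
  unfolding NN_def power2_eq_square using dd1 mult_left_mono[of 1 dd dd] by simp

lemma Cm_ge: "1 \<le> Cm"
proof -
  have "1 \<le> (4 * dd) ^ m" using dd1 by (intro one_le_power) linarith
  then show ?thesis unfolding Cm_def by linarith
qed

lemma tt_ge: "1 \<le> tt"
proof -
  have "0 \<le> NN" using NN_ge dd1 by (simp add: order_trans[of 0 "1000 * dd"])
  then have "1 \<le> 2 * NN + 6 * dd" using dd1 by (simp add: add_increasing)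
  then show ?thesis unfolding tt_def by simp
qed

lemma consts_pos: "0 \<le> Cpair" "0 \<le> Cphi" "0 \<le> Cbad"
  using Eeta(1) Eth(1) Cm_ge tt_ge unfolding Cpair_def Cphi_def Cbad_def by simp_all

lemma hc_mult':
  fixes \<phi> :: "real^'n \<Rightarrow> real" and \<psi> :: "real^'n \<Rightarrow> 'b::real_normed_vector"
  assumes "hc m \<delta> A l U \<phi>" "hc m \<delta> B l U \<psi>" "open U" "convex U" "0 < l" "0 \<le> A" "0 \<le> B"
  shows "hc m \<delta> (Cm * (A * B)) l U (\<lambda>y. \<phi> y *\<^sub>R \<psi> y)"
  using hc_mult[OF assms \<delta>] unfolding Cm_def dd_def .

end

locale cz_decomp = cz_kernel m \<delta> CK K
  for m \<delta> CK and K :: "real^'n \<Rightarrow> real^'n \<Rightarrow> complex" +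
  fixes f :: "real^'n \<Rightarrow> complex" and a :: "real^'n" and l :: real and F :: "(real^'n) set" and lam :: real
  assumes f: "Linfc f" and l: "l > 0" and F: "closed F" "F \<subseteq> cube_of a l" "F \<noteq> {}"
    and lam: "\<And>z. z \<in> F \<Longrightarrow> maxf m \<delta> (triple (cube_of a l)) f z \<le> lam"
begin

definition f1 :: "real^'n \<Rightarrow> complex" where "f1 y = f y * of_real (eta m a l y)"

definition hh :: "nat \<Rightarrow> real" where "hh k = l / 2 ^ k"

abbreviation cc :: "nat \<Rightarrow> ('n \<Rightarrow> int) \<Rightarrow> real^'n" where "cc \<equiv> cpt a l"

definition act :: "nat \<Rightarrow> ('n \<Rightarrow> int) \<Rightarrow> bool" where
  "act k j \<longleftrightarrow> (\<exists>z\<in>F. dist z (cc k j) \<le> NN * hh k)"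

text \<open>A smooth indicator of a neighbourhood of F of width comparable to \<open>hh k\<close>.
  On the tripled cube it is 1 for k = 0, and off F it vanishes for large k, so its successive
  differences decompose the complement of F.\<close>

definition ww :: "nat \<Rightarrow> real^'n \<Rightarrow> real" where
  "ww k y = (\<Sum>j\<in>cells k. (if act k j then 1 else 0) * theta m (hh k) (cc k j) y)"

text \<open>A piece \<open>(k, j, j')\<close> is a cell \<open>j\<close> of generation \<open>k + 1\<close> next to a cell \<open>j'\<close> of generation \<open>k\<close>,
  exactly one of them active; it therefore lies at distance comparable to its size from \<open>F\<close>.\<close>

definition pcs :: "nat \<Rightarrow> (('n \<Rightarrow> int) \<times> ('n \<Rightarrow> int)) set" where
  "pcs k = {(j, j') \<in> cells (Suc k) \<times> cells k. act (Suc k) j \<noteq> act k j' \<and>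
     dist (cc (Suc k) j) (cc k j') \<le> 2 * dd * hh k}"

definition pieces :: "nat \<Rightarrow> (nat \<times> ('n \<Rightarrow> int) \<times> ('n \<Rightarrow> int)) set" where
  "pieces n = Sigma {..<n} pcs"

definition side :: "nat \<times> ('n \<Rightarrow> int) \<times> ('n \<Rightarrow> int) \<Rightarrow> real" where
  "side p = hh (Suc (fst p))"

definition cen :: "nat \<times> ('n \<Rightarrow> int) \<times> ('n \<Rightarrow> int) \<Rightarrow> real^'n" where
  "cen p = cc (Suc (fst p)) (fst (snd p))"

text \<open>For a piece, the sign is the activity of the coarse cell minus that of the fine one, the
  coefficient with which the product of bumps occurs in \<open>ww k\<close> -
  \<open>ww (Suc k)\<close>.\<close>

definition phi :: "nat \<times> ('n \<Rightarrow> int) \<times> ('n \<Rightarrow> int) \<Rightarrow> real^'n \<Rightarrow> real" where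
  "phi p y = (if act (fst p) (snd (snd p)) then 1 else -1) *
     (theta m (hh (Suc (fst p))) (cc (Suc (fst p)) (fst (snd p))) y * theta m (hh (fst p)) (cc (fst p) (snd (snd p))) y)"

definition cell :: "nat \<times> ('n \<Rightarrow> int) \<times> ('n \<Rightarrow> int) \<Rightarrow> (real^'n) set" where
  "cell p = cube_of (cen p) (side p)"

definition avg :: "nat \<times> ('n \<Rightarrow> int) \<times> ('n \<Rightarrow> int) \<Rightarrow> complex" where
  "avg p = (\<integral>y. f1 y * of_real (phi p y) \<partial>lebesgue) / of_real (side p ^ CARD('n))"

definition bad :: "nat \<times> ('n \<Rightarrow> int) \<times> ('n \<Rightarrow> int) \<Rightarrow> real^'n \<Rightarrow> complex" where
  "bad p y = f1 y * of_real (phi p y) - avg p * indicator (cell p) y"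

text \<open>A discrete Marcinkiewicz integral: the sum over pieces replaces the integral of dist(y,
  F)^\<delta> / |x - y|^(d+\<delta>) over the complement of F, as a piece has side comparable to its
  distance from F.\<close>

definition marc :: "nat \<Rightarrow> real^'n \<Rightarrow> real" where
  "marc n x = (\<Sum>p\<in>pieces n. side p ^ CARD('n) * side p powr \<delta> * dist x (cen p) powr (- (dd + \<delta>)))"

lemma hh_pos: "hh k > 0" and hh_Suc: "hh k = 2 * hh (Suc k)" and hh_le: "hh k \<le> l"
proof -
  have "(1::real) \<le> 2 ^ k" by simp
  then have "l / 2 ^ k \<le> l / 1" using l by (intro divide_left_mono) auto
  then show "hh k > 0" "hh k = 2 * hh (Suc k)" "hh k \<le> l" using l by (auto simp: hh_def)
qed

lemma side_pos: "side p > 0" and side_le: "side p \<le> l"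
  by (auto simp: side_def hh_pos hh_le)

lemma finite_pieces: "finite (pieces n)"
proof -
  have "finite (pcs k)" for k
    by (rule finite_subset[of _ "cells (Suc k) \<times> cells k"]) (auto simp: pcs_def finite_cells)
  then show ?thesis by (simp add: pieces_def)
qed

lemma pieces_mono: "n \<le> n' \<Longrightarrow> pieces n \<subseteq> pieces n'"
  by (auto simp: pieces_def)

lemma lam_nonneg: "0 \<le> lam"
proof -
  obtain z where z: "z \<in> F" using F(3) by blast
  then have "z \<in> cube_of a l" using F(2) by blast
  then have "z \<in> triple (cube_of a l)" unfolding mem_triple[OF l] mem_cube using l by (smt (verit))
  then have "0 \<le> maxf m \<delta> (triple (cube_of a l)) f z"
    using maxf_nonneg[OF f, of "3 * l" "a - (\<chi> i. l)" _ z] l by (simp add: triple_cube)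
  then show ?thesis using lam[OF z] by linarith
qed

lemma in3Q: "y \<in> triple (cube_of a l) \<Longrightarrow> a $ i - l \<le> y $ i \<and> y $ i \<le> a $ i + 2 * l"
  using mem_triple[OF l, of y a] by (auto intro: less_imp_le)

lemma f1_nonzero: "f1 y \<noteq> 0 \<Longrightarrow> y \<in> triple (cube_of a l)"
proof -
  assume "f1 y \<noteq> 0"
  then have "eta m a l y \<noteq> 0" by (auto simp: f1_def)
  then show ?thesis
    unfolding mem_triple[OF l] using eta_nonzero[of m a l y, OF _ l] by (simp add: less_imp_le)
qed

lemma ww_0:
  assumes "y \<in> triple (cube_of a l)"
  shows "ww 0 y = 1"
proof -
  have "act 0 j" if j: "j \<in> cells 0" for j
  proof -
    obtain z where z: "z \<in> F" using F(3) by blast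
    have "dist z (cc 0 j) \<le> dd * (2 * l)"
      unfolding dd_def
    proof (rule dist_le_card)
      fix i
      have zi: "a $ i \<le> z $ i" "z $ i < a $ i + l" using z F(2) by (auto simp: mem_cube)
      have "-1 \<le> j i" "j i \<le> 2" using j by (auto simp: cells_def PiE_iff)
      then have "-1 \<le> real_of_int (j i)" "real_of_int (j i) \<le> 2" by simp_all
      then have "l * (-1) \<le> l * of_int (j i)" "l * of_int (j i) \<le> l * 2"
        using l by (auto simp only: intro!: mult_left_mono)
      moreover have "cc 0 j $ i = a $ i + l * of_int (j i)" by (simp add: cpt_def)
      ultimately show "\<bar>z $ i - cc 0 j $ i\<bar> \<le> 2 * l" using zi by linarith
    qed
    also have "dd * (2 * l) = (2 * dd) * l" by simp
    also have "(2 * dd) * l \<le> NN * l" using NN_ge dd1 l by (intro mult_right_mono) linarith+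
    also have "NN * l = NN * hh 0" by (simp add: hh_def)
    finally show ?thesis using z unfolding act_def by blast
  qed
  then have "ww 0 y = (\<Sum>j\<in>cells 0. theta m (l / 2 ^ 0) (cc 0 j) y)"
    by (simp add: ww_def hh_def)
  also have "\<dots> = 1" by (rule sum_theta[OF l in3Q[OF assms]])
  finally show ?thesis .
qed

lemma theta_near:
  assumes "theta m (hh k) (cc k j) y \<noteq> 0"
  shows "dist y (cc k j) \<le> dd * hh k"
  unfolding dd_def using theta_nonzero[OF assms hh_pos] by (intro dist_le_card less_imp_le)

text \<open>Each weight is multiplied by the partition of unity of the other generation, which
  equals 1. A product of two bumps then has as coefficient the difference of the activities, and
  overlapping supports force the centres to be close.\<close>

lemma ww_diff:
  assumes y: "y \<in> triple (cube_of a l)"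
  shows "ww k y - ww (Suc k) y = (\<Sum>q\<in>pcs k. phi (k, q) y)"
proof -
  let ?t = "\<lambda>k j. theta m (hh k) (cc k j) y" and ?a = "\<lambda>k j. if act k j then 1 else (0::real)"
  have s1: "(\<Sum>j\<in>cells k. ?t k j) = 1" for k unfolding hh_def by (rule sum_theta[OF l in3Q[OF y]])
  have "ww k y - ww (Suc k) y = (\<Sum>j\<in>cells (Suc k). ?t (Suc k) j) * (\<Sum>j'\<in>cells k. ?a k j' * ?t k j')
     - (\<Sum>j\<in>cells (Suc k). ?a (Suc k) j * ?t (Suc k) j) * (\<Sum>j'\<in>cells k. ?t k j')"
    unfolding s1 ww_def by simp
  also have "\<dots> = (\<Sum>j\<in>cells (Suc k). \<Sum>j'\<in>cells k. (?a k j' - ?a (Suc k) j) * (?t (Suc k) j * ?t k j'))"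
    unfolding sum_product by (simp add: sum_subtractf[symmetric] algebra_simps)
  also have "\<dots> = (\<Sum>q\<in>cells (Suc k) \<times> cells k. (?a k (snd q) - ?a (Suc k) (fst q)) * (?t (Suc k) (fst q) * ?t k (snd q)))"
    by (simp add: sum.cartesian_product case_prod_unfold)
  also have "\<dots> = (\<Sum>q\<in>pcs k. phi (k, q) y)"
  proof (rule sum.mono_neutral_cong_right)
    show "finite (cells (Suc k) \<times> cells k :: (('n \<Rightarrow> int) \<times> ('n \<Rightarrow> int)) set)" by (simp add: finite_cells)
    show "pcs k \<subseteq> cells (Suc k) \<times> cells k" by (auto simp: pcs_def)
    show "\<forall>q\<in>cells (Suc k) \<times> cells k - pcs k. (?a k (snd q) - ?a (Suc k) (fst q)) * (?t (Suc k) (fst q) * ?t k (snd q)) = 0"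
    proof (rule ballI, rule ccontr)
      fix q assume q: "q \<in> cells (Suc k) \<times> cells k - pcs k"
        and nz: "(?a k (snd q) - ?a (Suc k) (fst q)) * (?t (Suc k) (fst q) * ?t k (snd q)) \<noteq> 0"
      have "act (Suc k) (fst q) \<noteq> act k (snd q)"
      proof
        assume "act (Suc k) (fst q) = act k (snd q)"
        then have "?a k (snd q) - ?a (Suc k) (fst q) = 0" by simp
        then show False using nz by simp
      qed
      moreover have "dist (cc (Suc k) (fst q)) (cc k (snd q)) \<le> 2 * dd * hh k"
      proof -
        have "?t (Suc k) (fst q) \<noteq> 0" "?t k (snd q) \<noteq> 0" using nz by auto
        then have "dist y (cc (Suc k) (fst q)) \<le> dd * hh (Suc k)" "dist y (cc k (snd q)) \<le> dd * hh k"
          by (blast intro: theta_near)+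
        moreover have "dd * hh (Suc k) \<le> dd * hh k" using hh_Suc[of k] hh_pos[of "Suc k"] dd1 by (intro mult_left_mono) auto
        ultimately show ?thesis using dist_triangle3[of "cc (Suc k) (fst q)" "cc k (snd q)" y] by linarith
      qed
      ultimately have "q \<in> pcs k" using q by (auto simp: pcs_def case_prod_unfold)
      then show False using q by blast
    qed
  next
    fix q assume "q \<in> pcs k"
    then show "(?a k (snd q) - ?a (Suc k) (fst q)) * (?t (Suc k) (fst q) * ?t k (snd q)) = phi (k, q) y"
      by (auto simp: pcs_def phi_def)
  qed
  finally show ?thesis .
qed

text \<open>A telescoping sum. Keeping n finite leaves the remainder with \<open>ww n\<close> but
  avoids infinite sums under T.\<close>

lemma f1_decomp: "f1 y = (\<Sum>p\<in>pieces n. f1 y * of_real (phi p y)) + f1 y * of_real (ww n y)"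
proof (cases "f1 y = 0")
  case False
  note y = f1_nonzero[OF False]
  have "(\<Sum>p\<in>pieces n. phi p y) = (\<Sum>k<n. \<Sum>q\<in>pcs k. phi (k, q) y)"
    unfolding pieces_def
    by (subst sum.Sigma) (auto simp: finite_cells pcs_def intro: finite_subset[of _ "cells (Suc _) \<times> cells _"])
  also have "\<dots> = (\<Sum>k<n. ww k y - ww (Suc k) y)" by (simp add: ww_diff[OF y])
  also have "\<dots> = ww 0 y - ww n y" by (induction n) auto
  also have "ww 0 y = 1" by (rule ww_0[OF y])
  finally have "(\<Sum>p\<in>pieces n. phi p y) + ww n y = 1" by simp
  then have "f1 y = f1 y * of_real ((\<Sum>p\<in>pieces n. phi p y) + ww n y)" by simp
  then show ?thesis by (simp add: sum_distrib_left algebra_simps)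
qed simp

text \<open>The active cell of the pair supplies the nearby point, the inactive one the lower bound.
  Switching between the two centres costs 4 d sides, which 4 d \<le> \<open>NN\<close>
  absorbs.\<close>

lemma piece_near:
  assumes "p \<in> pieces n"
  shows "\<exists>z\<in>F. dist z (cen p) \<le> (2 * NN + 4 * dd) * side p"
    and "z \<in> F \<Longrightarrow> NN * side p < dist z (cen p)"
proof -
  obtain k j j' where p: "p = (k, j, j')" by (cases p)
  have q: "act (Suc k) j \<noteq> act k j'" "dist (cc (Suc k) j) (cc k j') \<le> 2 * dd * hh k"
    using assms by (auto simp: p pieces_def pcs_def)
  have s: "side p = hh (Suc k)" "cen p = cc (Suc k) j" "hh k = 2 * side p"
    using hh_Suc[of k] by (auto simp: p side_def cen_def)
  have s0: "side p > 0" by (rule side_pos)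
  have NN0: "NN \<ge> 0" "4 * dd \<le> NN" using NN_ge dd1 by auto
  have mono: "NN * side p \<ge> 0" "dd * side p \<ge> 0" "4 * (dd * side p) \<le> NN * side p"
    using NN0 dd1 s0 mult_right_mono[OF NN0(2), of "side p"] by (auto simp: mult.assoc)
  show "\<exists>z\<in>F. dist z (cen p) \<le> (2 * NN + 4 * dd) * side p"
  proof (cases "act (Suc k) j")
    case True
    then obtain z where z: "z \<in> F" "dist z (cen p) \<le> NN * side p" unfolding act_def s by blast
    then have "dist z (cen p) \<le> (2 * NN + 4 * dd) * side p" using mono by (simp add: distrib_right)
    then show ?thesis using z by blast
  next
    case False
    then obtain z where z: "z \<in> F" "dist z (cc k j') \<le> NN * hh k" using q(1) unfolding act_def[of k] by blast
    have "dist z (cen p) \<le> dist z (cc k j') + dist (cc k j') (cen p)" by (rule dist_triangle)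
    also have "\<dots> \<le> NN * (2 * side p) + 2 * dd * (2 * side p)"
      using z(2) q(2) unfolding s by (intro add_mono) (simp_all add: dist_commute)
    also have "\<dots> = (2 * NN + 4 * dd) * side p" by (simp add: algebra_simps)
    finally show ?thesis using z(1) by blast
  qed
  show "NN * side p < dist z (cen p)" if z: "z \<in> F"
  proof (cases "act (Suc k) j")
    case False
    then show ?thesis using z unfolding act_def s not_le[symmetric] by blast
  next
    case True
    then have "NN * hh k < dist z (cc k j')" using q(1) z unfolding act_def[of k] not_le[symmetric] by blast
    also have "\<dots> \<le> dist z (cen p) + dist (cen p) (cc k j')" by (rule dist_triangle)
    also have "dist (cen p) (cc k j') \<le> 2 * dd * hh k" using q(2) s by simp
    finally have "NN * (2 * side p) < dist z (cen p) + 2 * dd * (2 * side p)" unfolding s by linarith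
    then show ?thesis using mono by (simp add: algebra_simps)
  qed
qed

lemma phi_near: "phi p y \<noteq> 0 \<Longrightarrow> dist y (cen p) \<le> dd * side p"
  unfolding phi_def side_def cen_def by (intro theta_near) auto

lemma cell_near: "y \<in> cell p \<Longrightarrow> dist y (cen p) \<le> dd * side p"
  unfolding cell_def dd_def using side_pos[of p]
  by (intro dist_cube[of _ "cen p" "side p"]) (auto simp: mem_cube)

lemma hc_phi: "hc m \<delta> Cphi (side p) UNIV (phi p)"
proof -
  have 1: "hc m \<delta> Eth (side p) UNIV (theta m (hh (Suc (fst p))) (cc (Suc (fst p)) (fst (snd p))))"
    unfolding side_def by (rule Eth(2)[OF hh_pos])
  have 2: "hc m \<delta> Eth (side p) UNIV (theta m (hh (fst p)) (cc (fst p) (snd (snd p))))"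
    by (rule hc_mono[OF Eth(2)[OF hh_pos]]) (use Eth(1) side_pos[of p] hh_Suc[of "fst p"] \<delta> in \<open>auto simp: side_def\<close>)
  have "hc m \<delta> (\<bar>if act (fst p) (snd (snd p)) then 1 else -1\<bar> * Cphi) (side p) UNIV (\<lambda>y. (if act (fst p) (snd (snd p)) then 1 else -1) *\<^sub>R
     (theta m (hh (Suc (fst p))) (cc (Suc (fst p)) (fst (snd p))) y *\<^sub>R theta m (hh (fst p)) (cc (fst p) (snd (snd p))) y))"
    unfolding Cphi_def by (intro hc_scale hc_mult' 1 2 side_pos) (use Eth(1) in auto)
  then show ?thesis unfolding phi_def[abs_def] by (simp split: if_splits)
qed

text \<open>The test cube has to contain z and the support, and to stay inside 3Q. For \<rho> \<le>
  l the cube of half-side \<rho> about z will do, since z lies in Q; for larger \<rho> it is 3Q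
  itself, outside which the cutoff in \<open>f1\<close> vanishes.\<close>

lemma pair:
  fixes g :: "real^'n \<Rightarrow> complex"
  assumes g: "hc m \<delta> A s UNIV g" "\<And>y. g y \<noteq> 0 \<Longrightarrow> dist y c \<le> dd * s"
    and s: "0 < s" "s \<le> l" and A: "0 \<le> A" and z: "z \<in> F" "dist z c \<le> (2 * NN + 4 * dd) * s"
  shows "cmod (\<integral>y. f1 y * g y \<partial>lebesgue) \<le> Cpair * A * s ^ CARD('n) * lam"
proof -
  define \<rho> where "\<rho> = (2 * NN + 6 * dd) * s"
  have \<rho>: "\<rho> > 0" using NN_ge dd1 s by (simp add: \<rho>_def)
  have heta: "hc m \<delta> Eeta s UNIV (eta m a l)"
    by (rule hc_mono[OF Eeta(2)[OF l]]) (use Eeta(1) s \<delta> in auto)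
  have G: "hc m \<delta> (Cm * (Eeta * A)) s UNIV (\<lambda>y. eta m a l y *\<^sub>R g y)"
    by (rule hc_mult'[OF heta g(1)]) (use Eeta(1) s A in auto)
  have zQ: "a $ i \<le> z $ i" "z $ i < a $ i + l" for i using z(1) F(2) by (auto simp: mem_cube)
  have near: "\<bar>y $ i - z $ i\<bar> < \<rho>" if "g y \<noteq> 0" for y i
  proof -
    have "\<bar>y $ i - z $ i\<bar> \<le> dist y z" by (rule component_le_dist)
    also have "\<dots> \<le> dist y c + dist z c" by (rule dist_triangle2)
    also have "\<dots> \<le> dd * s + (2 * NN + 4 * dd) * s" using g(2)[OF that] z(2) by linarith
    also have "\<dots> < \<rho>" using dd1 s by (simp add: \<rho>_def algebra_simps)
    finally show ?thesis .
  qed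
  obtain b L where bL: "L > 0" "cube_of b L \<subseteq> triple (cube_of a l)" "z \<in> cube_of b L" "L \<le> tt * s"
    "\<And>y. y \<notin> cube_of b L \<Longrightarrow> eta m a l y *\<^sub>R g y = 0"
  proof (cases "\<rho> \<le> l")
    case True
    show ?thesis
    proof (rule that[of "2 * \<rho>" "z - (\<chi> i. \<rho>)"])
      show "cube_of (z - (\<chi> i. \<rho>)) (2 * \<rho>) \<subseteq> triple (cube_of a l)"
      proof
        fix y assume "y \<in> cube_of (z - (\<chi> i. \<rho>)) (2 * \<rho>)"
        then have y: "z $ i - \<rho> \<le> y $ i" "y $ i < z $ i + \<rho>" for i by (auto simp: mem_cube algebra_simps)
        show "y \<in> triple (cube_of a l)" unfolding mem_triple[OF l]
        proof
          fix i show "a $ i - l \<le> y $ i \<and> y $ i < a $ i + 2 * l" using y[of i] zQ[of i] True by linarith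
        qed
      qed
      show "z \<in> cube_of (z - (\<chi> i. \<rho>)) (2 * \<rho>)" using \<rho> by (simp add: mem_cube)
      have "2 * \<rho> \<le> 3 * \<rho>" using \<rho> by simp
      also have "3 * \<rho> = tt * s" by (simp add: tt_def \<rho>_def)
      finally show "2 * \<rho> \<le> tt * s" .
      show "eta m a l y *\<^sub>R g y = 0" if "y \<notin> cube_of (z - (\<chi> i. \<rho>)) (2 * \<rho>)" for y
      proof (rule ccontr)
        assume "eta m a l y *\<^sub>R g y \<noteq> 0"
        then have "g y \<noteq> 0" by auto
        then have "\<bar>y $ i - z $ i\<bar> < \<rho>" for i by (rule near)
        then have "z $ i - \<rho> \<le> y $ i \<and> y $ i < z $ i - \<rho> + 2 * \<rho>" for i
          by (smt (verit, best))
        then have "y \<in> cube_of (z - (\<chi> i. \<rho>)) (2 * \<rho>)" unfolding mem_cube by simp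
        then show False using that by blast
      qed
    qed (use \<rho> in simp)
  next
    case False
    show ?thesis
    proof (rule that[of "3 * l" "a - (\<chi> i. l)"])
      show "z \<in> cube_of (a - (\<chi> i. l)) (3 * l)"
        unfolding triple_cube[OF l, symmetric] mem_triple[OF l] using zQ l by (smt (verit))
      have "3 * l \<le> 3 * \<rho>" using False by simp
      also have "3 * \<rho> = tt * s" by (simp add: tt_def \<rho>_def)
      finally show "3 * l \<le> tt * s" .
      show "eta m a l y *\<^sub>R g y = 0" if "y \<notin> cube_of (a - (\<chi> i. l)) (3 * l)" for y
      proof (rule ccontr)
        assume "eta m a l y *\<^sub>R g y \<noteq> 0"
        then have nz: "eta m a l y \<noteq> 0" by simp
        show False using that eta_nonzero[OF nz l] unfolding triple_cube[OF l, symmetric] mem_triple[OF l]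
          by (simp add: less_imp_le)
      qed
    qed (use l triple_cube[OF l] in auto)
  qed
  have "cmod (\<integral>y. f y * (eta m a l y *\<^sub>R g y) \<partial>lebesgue)
     \<le> 2 * (Cm * (Eeta * A) * tt ^ Suc m) * L ^ CARD('n) * maxf m \<delta> (triple (cube_of a l)) f z"
    by (rule pairing_bound[OF f bL(1-3) G bL(5) s(1) bL(4) tt_ge]) (use Cm_ge Eeta(1) A \<delta> in auto)
  also have "\<dots> \<le> 2 * (Cm * (Eeta * A) * tt ^ Suc m) * (tt * s) ^ CARD('n) * lam"
    using bL lam[OF z(1)] lam_nonneg Cm_ge Eeta(1) A tt_ge s
      maxf_nonneg[OF f bL(1,2,3), of m \<delta>]
    by (intro mult_mono mult_left_mono power_mono) auto
  also have "\<dots> = Cpair * A * s ^ CARD('n) * lam"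
    by (simp add: Cpair_def power_mult_distrib mult_ac del: power_Suc)
  finally show ?thesis by (simp add: f1_def scaleR_conv_of_real mult.assoc)
qed

lemma piece_pair:
  fixes g :: "real^'n \<Rightarrow> complex"
  assumes "hc m \<delta> A (side p) UNIV g" "\<And>y. g y \<noteq> 0 \<Longrightarrow> phi p y \<noteq> 0" "0 \<le> A" "p \<in> pieces n"
  shows "cmod (\<integral>y. f1 y * g y \<partial>lebesgue) \<le> Cpair * A * side p ^ CARD('n) * lam"
proof -
  obtain z where "z \<in> F" "dist z (cen p) \<le> (2 * NN + 4 * dd) * side p"
    using piece_near(1)[OF assms(4)] by blast
  then show ?thesis
    using assms phi_near side_pos side_le by (intro pair[of A "side p" g "cen p"]) auto
qed

lemma avg_bound:
  assumes "p \<in> pieces n"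
  shows "cmod (avg p) \<le> Cpair * Cphi * lam"
proof -
  have "cmod (\<integral>y. f1 y * of_real (phi p y) \<partial>lebesgue) \<le> Cpair * Cphi * side p ^ CARD('n) * lam"
    by (rule piece_pair[OF hc_bounded_linear[OF hc_phi] _ _ assms]) (auto intro: bounded_linear_of_real consts_pos)
  then show ?thesis using side_pos[of p] by (simp add: avg_def norm_divide norm_power field_simps)
qed

lemma Linfc_f1: "Linfc f1"
proof -
  have "continuous_on UNIV (eta m a l)" using hc_continuous_on[OF Eeta(2)[OF l] l \<delta>(1)] .
  then show ?thesis unfolding f1_def[abs_def]
    by (intro Linfc_mult[OF f, of _ 1] measurable_continuous_lebesgue continuous_on_of_real)
      (auto simp: eta_01)
qed

lemma phi_continuous: "continuous_on UNIV (phi p)"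
  using hc_continuous_on[OF hc_phi side_pos \<delta>(1)] .

lemma f1_cont_integrable:
  fixes g :: "real^'n \<Rightarrow> complex"
  assumes "hc m \<delta> A s UNIV g" "0 < s"
  shows "integrable lebesgue (\<lambda>y. f1 y * g y)"
  using hc_continuous_on[OF assms \<delta>(1)] hc_bound[OF assms(1)]
  by (intro integrable_Linfc Linfc_mult[OF Linfc_f1, of _ A] measurable_continuous_lebesgue) auto

text \<open>As \<open>bad p\<close> has integral zero, k may be replaced by k - k c, which has norm
  of order D^-d (s/D)^\<delta> at the scale s of the piece. Multiplied by \<open>phi p\<close> it
  becomes an admissible test function against f; against the average its sup bound is
  enough.\<close>

lemma bad_kernel_bound:
  assumes p: "p \<in> pieces n" and x': "x' \<in> F" and k: "sk x' Ck k" "k \<in> borel_measurable lebesgue" and Ck: "0 \<le> Ck"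
  shows "integrable lebesgue (\<lambda>y. k y * bad p y)"
    and "cmod (\<integral>y. k y * bad p y \<partial>lebesgue)
      \<le> Cbad * Ck * lam * (side p ^ CARD('n) * side p powr \<delta> * dist x' (cen p) powr (- (dd + \<delta>)))"
proof -
  define s where "s = side p"
  define c where "c = cen p"
  define D where "D = dist x' c"
  have s: "0 < s" by (simp add: s_def side_pos)
  have DN: "NN * s < D" using piece_near(2)[OF p x'] by (simp add: D_def s_def c_def)
  have "1 * s \<le> NN * s" using NN_ge dd1 s by (intro mult_right_mono) linarith+
  then have D: "0 < D" "s \<le> D" using DN s by linarith+
  \<comment> \<open>This is the place where \<open>NN\<close> has to be quadratic in d.\<close>
  have rad: "4 * dd * s < D / (16 * dd)"
  proof -
    have "4 * dd * s * (16 * dd) \<le> NN * s" using s by (simp add: NN_def power2_eq_square)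
    then have "4 * dd * s * (16 * dd) < D" using DN by linarith
    then show ?thesis using dd1 by (simp add: field_simps)
  qed
  define V where "V = ball c (4 * dd * s)"
  define U where "U = ball c (D / (16 * dd))"
  define A where "A = dd * (4 * dd) * (Ck / D ^ CARD('n)) * (s / D) powr \<delta>"
  have A0: "0 \<le> A" using dd1 Ck D by (simp add: A_def)
  have hk: "hc m \<delta> (Ck / D ^ CARD('n)) D U k"
    using k(1) D(1) unfolding sk_def D_def U_def dd_def by (auto simp: dist_commute)
  have hV: "hc m \<delta> A s V (\<lambda>y. k y - k c)"
    unfolding A_def dd_def
  proof (rule hc_small[OF hk])
    have "1 \<le> 4 * dd" using dd1 by linarith
    then show "1 \<le> 4 * real CARD('n)" by (simp only: dd_def)
  qed (use rad D s Ck \<delta> dd1 in \<open>auto simp: U_def V_def dd_def dist_commute\<close>)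
  define G where "G y = phi p y *\<^sub>R (k y - k c)" for y
  have hpV: "hc m \<delta> Cphi s V (phi p)"
    by (rule hc_mono[OF hc_phi]) (use s consts_pos \<delta> in \<open>auto simp: s_def\<close>)
  have GV: "hc m \<delta> (Cm * (Cphi * A)) s V G"
    unfolding G_def[abs_def] by (rule hc_mult'[OF hpV hV]) (use s consts_pos A0 in \<open>auto simp: V_def\<close>)
  \<comment> \<open>The kernel is controlled only on V. The support of \<open>phi p\<close> keeps a
    distance s from the complement of V, so the extension by zero is made with \<kappa> = 1.\<close>
  have hG: "hc m \<delta> (2 * (Cm * (Cphi * A)) / 1) s UNIV G"
  proof (rule hc_extend[OF GV, where S = "cball c (dd * s)"])
    have ds: "dd * s < 4 * dd * s" "dd * s + s \<le> 4 * dd * s"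
      using dd1 s mult_right_mono[of 1 dd s] mult_pos_pos[of dd s] by (auto simp: mult.assoc)
    show "cball c (dd * s) \<subseteq> V"
    proof
      fix w assume "w \<in> cball c (dd * s)"
      then have "dist c w \<le> dd * s" by simp
      then have "dist c w < 4 * dd * s" using ds(1) by linarith
      then show "w \<in> V" by (simp add: V_def)
    qed
    show "G y = 0" if "y \<notin> cball c (dd * s)" for y
      using phi_near[of p y] that by (auto simp: G_def s_def c_def dist_commute)
    show "ball y (1 * s) \<subseteq> V" if "y \<in> cball c (dd * s)" for y
    proof
      fix w assume "w \<in> ball y (1 * s)"
      then have "dist y w < s" "dist c y \<le> dd * s" using that by auto
      then have "dist c w < 4 * dd * s" using ds(2) dist_triangle[of c w y] by linarith
      then show "w \<in> V" by (simp add: V_def)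
    qed
  qed (use s Cm_ge consts_pos A0 \<delta> in \<open>auto simp: V_def\<close>)
  have Rnear: "dist y c \<le> dd * s" if "y \<in> cell p" for y using cell_near[OF that] by (simp add: c_def s_def)
  have RV: "cell p \<subseteq> V"
  proof
    fix y assume "y \<in> cell p"
    then have "dist y c \<le> dd * s" by (rule Rnear)
    moreover have "0 < dd * s" using dd1 s by (intro mult_pos_pos) auto
    ultimately show "y \<in> V" by (simp add: V_def dist_commute)
  qed
  have kb: "norm (k y - k c) \<le> A" if "y \<in> cell p" for y using hc_bound[OF hV] RV that by blast
  have mcell: "cell p \<in> lmeasurable" "measure lebesgue (cell p) = s ^ CARD('n)"
    using s by (auto simp: cell_def lmeasurable_cube measure_cube s_def)
  have int1: "integrable lebesgue (\<lambda>y. f1 y * G y)" by (rule f1_cont_integrable[OF hG s])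
  have intind: "integrable lebesgue (\<lambda>y. indicat_real (cell p) y * A)"
    using mcell by (auto simp: fmeasurable_def integrable_indicator_iff)
  have int2: "integrable lebesgue (\<lambda>y. indicator (cell p) y * (k y - k c))"
  proof (rule Bochner_Integration.integrable_bound[OF intind])
    show "(\<lambda>y. indicator (cell p) y * (k y - k c)) \<in> borel_measurable lebesgue"
      using mcell k(2) by (intro borel_measurable_times borel_measurable_diff borel_measurable_indicator) auto
    show "AE y in lebesgue. norm (indicator (cell p) y * (k y - k c)) \<le> norm (indicat_real (cell p) y * A)"
      using kb A0 by (intro AE_I2) (auto simp: indicator_def)
  qed
  have int3: "integrable lebesgue (\<lambda>y. f1 y * of_real (phi p y))"
    by (rule f1_cont_integrable[OF hc_bounded_linear[OF hc_phi] side_pos]) (auto intro: bounded_linear_of_real)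
  have int4: "integrable lebesgue (\<lambda>y. indicator (cell p) y :: complex)"
  proof -
    have "integrable lebesgue (\<lambda>y. complex_of_real (indicat_real (cell p) y))"
      using mcell by (intro integrable_of_real integrable_real_indicator) (auto simp: fmeasurable_def)
    moreover have "(\<lambda>y. complex_of_real (indicat_real (cell p) y)) = (\<lambda>y. indicator (cell p) y)"
      by (auto simp: indicator_def)
    ultimately show ?thesis by simp
  qed
  have int5: "(\<integral>y. (indicator (cell p) y :: complex) \<partial>lebesgue) = of_real (s ^ CARD('n))"
  proof -
    have "(\<integral>y. (indicator (cell p) y :: complex) \<partial>lebesgue) = (\<integral>y. complex_of_real (indicat_real (cell p) y) \<partial>lebesgue)"
      by (rule Bochner_Integration.integral_cong) (auto simp: indicator_def)
    also have "\<dots> = of_real (measure lebesgue (cell p))" using mcell(1) by simp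
    finally show ?thesis using mcell(2) by simp
  qed
  \<comment> \<open>The last summand is a constant multiple of a function with integral zero; the
    first two carry the small factor k y - k c.\<close>
  have expand: "k y * bad p y = f1 y * G y - avg p * (indicator (cell p) y * (k y - k c))
     + k c * (f1 y * of_real (phi p y) - avg p * indicator (cell p) y)" for y
    unfolding bad_def G_def scaleR_conv_of_real by (simp add: algebra_simps)
  show "integrable lebesgue (\<lambda>y. k y * bad p y)"
    unfolding expand using int1 int2 int3 int4 by auto
  have "(\<integral>y. f1 y * of_real (phi p y) - avg p * indicator (cell p) y \<partial>lebesgue)
     = (\<integral>y. f1 y * of_real (phi p y) \<partial>lebesgue) - avg p * of_real (s ^ CARD('n))"
    using int3 int4 by (subst Bochner_Integration.integral_diff) (auto simp: int5)
  also have "\<dots> = 0" using s by (simp add: avg_def s_def)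
  finally have mean0: "(\<integral>y. f1 y * of_real (phi p y) - avg p * indicator (cell p) y \<partial>lebesgue) = 0" .
  have "(\<integral>y. k y * bad p y \<partial>lebesgue) = (\<integral>y. f1 y * G y \<partial>lebesgue) - avg p * (\<integral>y. indicator (cell p) y * (k y - k c) \<partial>lebesgue)"
    unfolding expand
    using int1 int2 int3 int4 mean0 by (subst Bochner_Integration.integral_add) auto
  also have "cmod \<dots> \<le> cmod (\<integral>y. f1 y * G y \<partial>lebesgue) + cmod (avg p * (\<integral>y. indicator (cell p) y * (k y - k c) \<partial>lebesgue))"
    by (rule norm_triangle_ineq4)
  also have "\<dots> \<le> Cpair * (2 * (Cm * (Cphi * A))) * s ^ CARD('n) * lam + (Cpair * Cphi * lam) * (s ^ CARD('n) * A)"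
  proof (rule add_mono)
    show "cmod (\<integral>y. f1 y * G y \<partial>lebesgue) \<le> Cpair * (2 * (Cm * (Cphi * A))) * s ^ CARD('n) * lam"
    proof -
      have 1: "hc m \<delta> (2 * (Cm * (Cphi * A))) (side p) UNIV G" using hG by (simp add: s_def)
      have 2: "phi p y \<noteq> 0" if "G y \<noteq> 0" for y using that by (auto simp: G_def)
      have 3: "0 \<le> 2 * (Cm * (Cphi * A))" using Cm_ge consts_pos A0 by simp
      show ?thesis unfolding s_def by (rule piece_pair[OF 1 2 3 p])
    qed
    have "cmod (\<integral>y. indicator (cell p) y * (k y - k c) \<partial>lebesgue) \<le> (\<integral>y. indicat_real (cell p) y * A \<partial>lebesgue)"
      by (rule norm_integral_le_bound[OF intind]) (use kb A0 in \<open>auto simp: indicator_def\<close>)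
    also have "\<dots> = s ^ CARD('n) * A" using mcell by simp
    finally show "cmod (avg p * (\<integral>y. indicator (cell p) y * (k y - k c) \<partial>lebesgue)) \<le> (Cpair * Cphi * lam) * (s ^ CARD('n) * A)"
      unfolding norm_mult using avg_bound[OF p] consts_pos lam_nonneg by (intro mult_mono) auto
  qed
  also have "\<dots> = Cbad * Ck * lam * (s ^ CARD('n) * ((s / D) powr \<delta> / D ^ CARD('n)))"
    by (simp add: Cbad_def A_def power2_eq_square algebra_simps)
  also have "(s / D) powr \<delta> / D ^ CARD('n) = s powr \<delta> * D powr (- (dd + \<delta>))"
  proof -
    have "D powr (- (dd + \<delta>)) = inverse (D ^ CARD('n) * D powr \<delta>)"
      by (subst powr_minus) (use D in \<open>simp add: powr_add powr_realpow dd_def\<close>)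
    moreover have "(s / D) powr \<delta> = s powr \<delta> / D powr \<delta>" by (rule powr_divide)
    ultimately show ?thesis by (simp add: divide_inverse mult_ac)
  qed
  finally show "cmod (\<integral>y. k y * bad p y \<partial>lebesgue)
      \<le> Cbad * Ck * lam * (side p ^ CARD('n) * side p powr \<delta> * dist x' (cen p) powr (- (dd + \<delta>)))"
    by (simp add: s_def c_def D_def mult_ac)
qed

lemma bad_sum_bound:
  assumes x': "x' \<in> F" and k: "sk x' Ck k" "k \<in> borel_measurable lebesgue" and Ck: "0 \<le> Ck"
  shows "(\<Sum>p\<in>pieces n. cmod (\<integral>y. k y * bad p y \<partial>lebesgue)) \<le> Cbad * Ck * lam * marc n x'"
  unfolding marc_def sum_distrib_left by (rule sum_mono) (rule bad_kernel_bound(2)[OF _ x' k Ck])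

end

section \<open>Lebesgue points and the pointwise bound by the maximal function\<close>

lemma One_nth [simp]: "(One :: real^'n) $ i = 1"
proof -
  have "(One :: real^'n) $ i = (\<Sum>b\<in>Basis. b \<bullet> (axis i 1 :: real^'n))"
    by (simp add: cart_eq_inner_axis inner_sum_left)
  also have "\<dots> = (\<Sum>b\<in>Basis. if b = (axis i 1 :: real^'n) then 1 else 0)"
    by (rule sum.cong) (auto simp: inner_Basis)
  finally show ?thesis by simp
qed

lemma Linfc_cbox_integrable:
  assumes "Linfc f"
  shows "integrable lebesgue (\<lambda>y. indicat_real (cbox u v) y * cmod (f y - q))"
proof -
  obtain M where M: "M \<ge> 0" "\<And>y. cmod (f y) \<le> M" using Linfc_bound[OF assms] by blast
  have fm: "f \<in> borel_measurable lebesgue" using assms by (simp add: Linfc_def)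
  show ?thesis
  proof (rule integrable_bounded_support[where M = "M + cmod q"])
    show "(\<lambda>y. indicat_real (cbox u v) y * cmod (f y - q)) \<in> borel_measurable lebesgue"
      using fm by (intro borel_measurable_times borel_measurable_indicator borel_measurable_norm borel_measurable_diff) auto
    show "norm (indicat_real (cbox u v) y * cmod (f y - q)) \<le> M + cmod q" for y
      using M(2)[of y] M(1) norm_triangle_ineq4[of "f y" q] by (auto simp: indicator_def)
    show "bounded {y. indicat_real (cbox u v) y * cmod (f y - q) \<noteq> 0}"
      by (rule bounded_subset[OF bounded_cbox[of u v]]) (auto simp: indicator_def)
  qed
qed

text \<open>The differentiation theorem is applied to |f - q| for q in a countable dense set, which
  leaves a single null set; then f x is approximated by some q. The cubes have x as lower
  corner.\<close>

lemma AE_lebesgue_point: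
  fixes f :: "real^'n \<Rightarrow> complex"
  assumes f: "Linfc f"
  shows "AE x in lebesgue. \<forall>\<epsilon>>0. \<exists>h0>0. \<forall>h. 0 < h \<and> h < h0 \<longrightarrow>
     (\<integral>y. indicat_real (cbox x (x + h *\<^sub>R One)) y * cmod (f y - f x) \<partial>lebesgue) \<le> \<epsilon> * h ^ CARD('n)"
proof -
  obtain Dq :: "complex set" where Dq: "countable Dq" "\<And>X. open X \<Longrightarrow> X \<noteq> {} \<Longrightarrow> \<exists>d\<in>Dq. d \<in> X"
    using countable_dense_exists by blast
  have int: "integrable lebesgue (\<lambda>y. indicat_real (cbox u v) y * cmod (f y - q))" for u v q
    by (rule Linfc_cbox_integrable[OF f])
  have HK: "(\<lambda>y. cmod (f y - q)) integrable_on cbox u v"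
    "integral (cbox u v) (\<lambda>y. cmod (f y - q)) = (\<integral>y. indicat_real (cbox u v) y * cmod (f y - q) \<partial>lebesgue)" for u v q
  proof -
    have "set_integrable lebesgue (cbox u v) (\<lambda>y. cmod (f y - q))"
      using int[of u v q] by (simp add: set_integrable_def)
    from set_lebesgue_integral_eq_integral[OF this]
    show "(\<lambda>y. cmod (f y - q)) integrable_on cbox u v"
      "integral (cbox u v) (\<lambda>y. cmod (f y - q)) = (\<integral>y. indicat_real (cbox u v) y * cmod (f y - q) \<partial>lebesgue)"
      by (simp_all add: set_lebesgue_integral_def)
  qed
  have "AE x in lebesgue. \<forall>\<epsilon>>0. \<exists>h0>0. \<forall>h. 0 < h \<and> h < h0 \<longrightarrow>
      norm (integral (cbox x (x + h *\<^sub>R One)) (\<lambda>y. cmod (f y - q)) /\<^sub>R h ^ CARD('n) - cmod (f x - q)) < \<epsilon>" for q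
  proof -
    obtain N where N: "negligible N" "\<And>x \<epsilon>. x \<notin> N \<Longrightarrow> 0 < \<epsilon> \<Longrightarrow> \<exists>d>0. \<forall>h. 0 < h \<and> h < d \<longrightarrow>
      norm (integral (cbox x (x + h *\<^sub>R One)) (\<lambda>y. cmod (f y - q)) /\<^sub>R h ^ DIM(real^'n) - cmod (f x - q)) < \<epsilon>"
      using integrable_ccontinuous_explicit[of "\<lambda>y. cmod (f y - q)"] HK(1) by blast
    have "N \<in> null_sets lebesgue" using N(1) by (simp add: negligible_iff_null_sets)
    have N2: "\<exists>d>0. \<forall>h. 0 < h \<and> h < d \<longrightarrow>
      norm (integral (cbox x (x + h *\<^sub>R One)) (\<lambda>y. cmod (f y - q)) /\<^sub>R h ^ CARD('n) - cmod (f x - q)) < \<epsilon>"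
      if "x \<notin> N" "0 < \<epsilon>" for x \<epsilon> using N(2)[OF that] by simp
    show ?thesis
      using AE_not_in[OF \<open>N \<in> null_sets lebesgue\<close>] by eventually_elim (blast intro: N2)
  qed
  then have "AE x in lebesgue. \<forall>q\<in>Dq. \<forall>\<epsilon>>0. \<exists>h0>0. \<forall>h. 0 < h \<and> h < h0 \<longrightarrow>
      norm (integral (cbox x (x + h *\<^sub>R One)) (\<lambda>y. cmod (f y - q)) /\<^sub>R h ^ CARD('n) - cmod (f x - q)) < \<epsilon>"
    by (intro AE_ball_countable[OF Dq(1), THEN iffD2] ballI) blast
  then show ?thesis
  proof (rule AE_mp, intro AE_I2 impI allI)
    fix x \<epsilon> :: real and x' :: "real^'n"
    fix z :: "real^'n"
    assume H: "\<forall>q\<in>Dq. \<forall>\<epsilon>>0. \<exists>h0>0. \<forall>h. 0 < h \<and> h < h0 \<longrightarrow>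
      norm (integral (cbox z (z + h *\<^sub>R One)) (\<lambda>y. cmod (f y - q)) /\<^sub>R h ^ CARD('n) - cmod (f z - q)) < \<epsilon>"
      and \<epsilon>: "0 < \<epsilon>"
    have "ball (f z) (\<epsilon> / 4) \<noteq> {}" using \<epsilon> by simp
    then obtain q where q: "q \<in> Dq" "dist (f z) q < \<epsilon> / 4" using Dq(2)[of "ball (f z) (\<epsilon> / 4)"] by auto
    obtain h0 where h0: "h0 > 0" "\<And>h. 0 < h \<Longrightarrow> h < h0 \<Longrightarrow>
      norm (integral (cbox z (z + h *\<^sub>R One)) (\<lambda>y. cmod (f y - q)) /\<^sub>R h ^ CARD('n) - cmod (f z - q)) < \<epsilon> / 4"
    proof -
      have "0 < \<epsilon> / 4" using \<epsilon> by simp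
      from H[rule_format, OF q(1) this] show ?thesis using that by blast
    qed
    show "\<exists>h0>0. \<forall>h. 0 < h \<and> h < h0 \<longrightarrow>
     (\<integral>y. indicat_real (cbox z (z + h *\<^sub>R One)) y * cmod (f y - f z) \<partial>lebesgue) \<le> \<epsilon> * h ^ CARD('n)"
    proof (intro exI[of _ h0] conjI allI impI h0(1))
      fix h assume h: "0 < h \<and> h < h0"
      let ?B = "cbox z (z + h *\<^sub>R One)"
      have cont: "measure lebesgue ?B = h ^ CARD('n)"
      proof -
        have "measure lborel ?B = (\<Prod>b\<in>(Basis::(real^'n) set). ((z + h *\<^sub>R One) - z) \<bullet> b)"
          using h by (intro measure_lborel_cbox) (simp add: inner_add_left)
        also have "\<dots> = (\<Prod>b\<in>(Basis::(real^'n) set). h)" by (rule prod.cong) auto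
        finally show ?thesis by simp
      qed
      have iB: "integrable lebesgue (\<lambda>y. indicat_real ?B y * (\<epsilon> / 4))"
        by (intro integrable_mult_left integrable_real_indicator) (use lmeasurable_cbox in \<open>auto simp: fmeasurable_def\<close>)
      have "(\<integral>y. indicat_real ?B y * cmod (f y - f z) \<partial>lebesgue)
        \<le> (\<integral>y. indicat_real ?B y * cmod (f y - q) + indicat_real ?B y * (\<epsilon> / 4) \<partial>lebesgue)"
      proof (rule integral_mono)
        show "integrable lebesgue (\<lambda>y. indicat_real ?B y * cmod (f y - q) + indicat_real ?B y * (\<epsilon> / 4))"
          using int iB by (rule Bochner_Integration.integrable_add)
        fix y
        have "cmod (f y - f z) \<le> cmod (f y - q) + \<epsilon> / 4"
          using q(2) norm_triangle_ineq4[of "f y - q" "f z - q"] by (simp add: dist_norm)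
        then show "indicat_real ?B y * cmod (f y - f z) \<le> indicat_real ?B y * cmod (f y - q) + indicat_real ?B y * (\<epsilon> / 4)"
          by (auto simp: indicator_def)
      qed (rule int)
      also have "\<dots> = integral ?B (\<lambda>y. cmod (f y - q)) + h ^ CARD('n) * (\<epsilon> / 4)"
        using int iB cont unfolding HK(2) by (subst Bochner_Integration.integral_add) auto
      also have "integral ?B (\<lambda>y. cmod (f y - q)) \<le> h ^ CARD('n) * (cmod (f z - q) + \<epsilon> / 4)"
      proof -
        define I where "I = integral ?B (\<lambda>y. cmod (f y - q))"
        define H where "H = h ^ CARD('n)"
        have H: "H > 0" using h by (simp add: H_def)
        have "\<bar>I /\<^sub>R H - cmod (f z - q)\<bar> < \<epsilon> / 4"
          using h0(2)[of h] h unfolding I_def H_def real_norm_def by blast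
        then have "I /\<^sub>R H \<le> cmod (f z - q) + \<epsilon> / 4" by linarith
        then have "H * (I /\<^sub>R H) \<le> H * (cmod (f z - q) + \<epsilon> / 4)" using H by (intro mult_left_mono) auto
        moreover have "H * (I /\<^sub>R H) = I" using H by simp
        ultimately show ?thesis unfolding I_def H_def by linarith
      qed
      also have "h ^ CARD('n) * (cmod (f z - q) + \<epsilon> / 4) + h ^ CARD('n) * (\<epsilon> / 4) = h ^ CARD('n) * (cmod (f z - q) + \<epsilon> / 2)"
        by (simp add: algebra_simps)
      also have "\<dots> \<le> h ^ CARD('n) * \<epsilon>"
        using q(2) h \<epsilon> by (intro mult_left_mono) (auto simp: dist_norm)
      finally show "(\<integral>y. indicat_real ?B y * cmod (f y - f z) \<partial>lebesgue) \<le> \<epsilon> * h ^ CARD('n)"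
        by (simp add: mult.commute)
    qed
  qed
qed

context cz_kernel
begin

text \<open>The bound of \<open>pairing_bound\<close> with t = 3, times 3^d for comparing the cube
  of side h with the mass of the bump, which is at least (h/3)^d.\<close>

definition CL :: real where "CL = 2 * (Eeta * 3 ^ Suc m) * 3 ^ CARD('n)"

text \<open>At a Lebesgue point f is tested against a bump in a small cube with corner x: the
  pairing is bounded by the maximal function, and replacing f y by f x costs an arbitrarily small
  multiple of the volume.\<close>

lemma AE_le_maxf:
  assumes f: "Linfc f" and l: "l > 0"
  shows "AE x in lebesgue. x \<in> cube_of a l \<longrightarrow> cmod (f x) \<le> CL * maxf m \<delta> (triple (cube_of (a::real^'n) l)) f x"
  using AE_lebesgue_point[OF f]
proof (rule AE_mp, intro AE_I2 impI)
  fix x :: "real^'n"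
  assume LP: "\<forall>\<epsilon>>0. \<exists>h0>0. \<forall>h. 0 < h \<and> h < h0 \<longrightarrow>
     (\<integral>y. indicat_real (cbox x (x + h *\<^sub>R One)) y * cmod (f y - f x) \<partial>lebesgue) \<le> \<epsilon> * h ^ CARD('n)"
    and x: "x \<in> cube_of a l"
  let ?M = "maxf m \<delta> (triple (cube_of a l)) f x"
  show "cmod (f x) \<le> CL * ?M"
  proof (rule field_le_epsilon)
    fix e :: real assume e: "e > 0"
    obtain h0 where h0: "h0 > 0" "\<And>h. 0 < h \<Longrightarrow> h < h0 \<Longrightarrow>
       (\<integral>y. indicat_real (cbox x (x + h *\<^sub>R One)) y * cmod (f y - f x) \<partial>lebesgue) \<le> (e / 3 ^ CARD('n)) * h ^ CARD('n)"
    proof -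
      have "0 < e / 3 ^ CARD('n)" using e by simp
      from LP[rule_format, OF this] show ?thesis using that by blast
    qed
    define h where "h = min (h0 / 2) l"
    have h: "0 < h" "h < h0" "h \<le> l" using h0(1) l by (auto simp: h_def)
    define s where "s = h / 3"
    have s: "0 < s" "3 * s = h" using h by (auto simp: s_def)
    \<comment> \<open>The cutoff of the middle third: its support lies in the triple of that third,
      which is exactly the cube [x, x + h).\<close>
    define \<phi> where "\<phi> = eta m (x + (\<chi> i. s)) s"
    have \<phi>0: "\<phi> y = 0" if "y \<notin> cube_of x h" for y
    proof (rule ccontr)
      assume nz: "\<phi> y \<noteq> 0"
      have "x $ i \<le> y $ i \<and> y $ i < x $ i + h" for i
        using eta_nonzero[OF nz[unfolded \<phi>_def] s(1), of i] s(2) by simp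
      then show False using that by (simp add: mem_cube)
    qed
    have h\<phi>: "hc m \<delta> Eeta s UNIV (\<lambda>y. complex_of_real (\<phi> y))"
      unfolding \<phi>_def by (rule hc_bounded_linear[OF Eeta(2)[OF s(1)]]) (auto intro: bounded_linear_of_real)
    have c\<phi>: "continuous_on UNIV \<phi>" unfolding \<phi>_def by (rule hc_continuous_on[OF Eeta(2)[OF s(1)] s(1) \<delta>(1)])
    have sub: "cube_of x h \<subseteq> triple (cube_of a l)"
    proof
      fix y assume "y \<in> cube_of x h"
      then have y: "x $ i \<le> y $ i" "y $ i < x $ i + h" for i by (auto simp: mem_cube)
      show "y \<in> triple (cube_of a l)" unfolding mem_triple[OF l]
      proof
        fix i show "a $ i - l \<le> y $ i \<and> y $ i < a $ i + 2 * l"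
          using y[of i] x[unfolded mem_cube, rule_format, of i] h by linarith
      qed
    qed
    have xin: "x \<in> cube_of x h" using h by (simp add: mem_cube)
    have up: "cmod (\<integral>y. f y * of_real (\<phi> y) \<partial>lebesgue) \<le> 2 * (Eeta * 3 ^ Suc m) * h ^ CARD('n) * ?M"
      by (rule pairing_bound[OF f h(1) sub xin h\<phi> _ s(1)]) (use \<phi>0 s Eeta(1) \<delta> in auto)
    have int\<phi>: "integrable lebesgue \<phi>"
    proof (rule integrable_bounded_support[of _ 1])
      have "cube_of x h \<subseteq> cbox x (x + (\<chi> i. h))" by (auto simp: mem_cube mem_box_cart less_imp_le)
      then have "{y. \<phi> y \<noteq> 0} \<subseteq> cbox x (x + (\<chi> i. h))" using \<phi>0 by auto
      then show "bounded {y. \<phi> y \<noteq> 0}" using bounded_cbox bounded_subset by blast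
    qed (use measurable_continuous_lebesgue[OF c\<phi>] in \<open>auto simp: \<phi>_def eta_01 abs_of_nonneg[OF eta_01(1)]\<close>)
    have low: "s ^ CARD('n) \<le> (\<integral>y. \<phi> y \<partial>lebesgue)"
    proof -
      have "s ^ CARD('n) = (\<integral>y. indicat_real (cube_of (x + (\<chi> i. s)) s) y \<partial>lebesgue)"
        using s by simp
      also have "\<dots> \<le> (\<integral>y. \<phi> y \<partial>lebesgue)"
      proof (rule integral_mono)
        show "integrable lebesgue (indicat_real (cube_of (x + (\<chi> i. s)) s))"
          using lmeasurable_cube by (intro integrable_real_indicator) (auto simp: fmeasurable_def)
        show "indicat_real (cube_of (x + (\<chi> i. s)) s) y \<le> \<phi> y" for y
        proof (cases "y \<in> cube_of (x + (\<chi> i. s)) s")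
          case True
          have "\<phi> y = 1" unfolding \<phi>_def
          proof (rule eta_one[OF _ s(1)])
            fix i
            show "(x + (\<chi> i. s)) $ i - s / 2 \<le> y $ i \<and> y $ i \<le> (x + (\<chi> i. s)) $ i + 3 * s / 2"
              using True[unfolded mem_cube, rule_format, of i] s(1) by linarith
          qed
          then show ?thesis by (simp add: indicator_def)
        qed (simp add: \<phi>_def eta_01)
      qed (rule int\<phi>)
      finally show ?thesis .
    qed
    have int1: "integrable lebesgue (\<lambda>y. f y * of_real (\<phi> y))"
      using measurable_continuous_lebesgue[OF continuous_on_of_real[OF c\<phi>]]
      by (intro integrable_Linfc Linfc_mult[OF f, of _ 1]) (auto simp: \<phi>_def eta_01)
    have int2: "integrable lebesgue (\<lambda>y. f x * of_real (\<phi> y))"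
      using int\<phi> by (intro integrable_mult_right integrable_of_real)
    have "f x * of_real (\<integral>y. \<phi> y \<partial>lebesgue) = (\<integral>y. f y * of_real (\<phi> y) \<partial>lebesgue) - (\<integral>y. f y * of_real (\<phi> y) - f x * of_real (\<phi> y) \<partial>lebesgue)"
      using int1 int2 int\<phi> by (subst Bochner_Integration.integral_diff) auto
    then have "cmod (f x) * \<bar>\<integral>y. \<phi> y \<partial>lebesgue\<bar> = cmod ((\<integral>y. f y * of_real (\<phi> y) \<partial>lebesgue) - (\<integral>y. f y * of_real (\<phi> y) - f x * of_real (\<phi> y) \<partial>lebesgue))"
      by (metis norm_mult norm_of_real)
    also have "\<dots> \<le> cmod (\<integral>y. f y * of_real (\<phi> y) \<partial>lebesgue) + cmod (\<integral>y. f y * of_real (\<phi> y) - f x * of_real (\<phi> y) \<partial>lebesgue)"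
      by (rule norm_triangle_ineq4)
    also have "cmod (\<integral>y. f y * of_real (\<phi> y) - f x * of_real (\<phi> y) \<partial>lebesgue)
       \<le> (\<integral>y. indicat_real (cbox x (x + h *\<^sub>R One)) y * cmod (f y - f x) \<partial>lebesgue)"
    proof (rule norm_integral_le_bound[OF Linfc_cbox_integrable[OF f]])
      fix y
      have "norm (f y * of_real (\<phi> y) - f x * of_real (\<phi> y)) = cmod (f y - f x) * \<bar>\<phi> y\<bar>"
        by (simp add: norm_mult[symmetric] left_diff_distrib[symmetric] del: of_real_mult) (simp add: norm_mult)
      also have "\<dots> \<le> cmod (f y - f x) * indicat_real (cbox x (x + h *\<^sub>R One)) y"
      proof (cases "y \<in> cube_of x h")
        case True
        have oi: "(x + h *\<^sub>R One) $ i = x $ i + h" for i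
          by (simp only: vector_add_component vector_scaleR_component One_nth real_scaleR_def mult_1_right)
        have "y \<in> cbox x (x + h *\<^sub>R One)" using True unfolding mem_box_cart oi mem_cube by (auto intro: less_imp_le)
        then show ?thesis using eta_01[of m "x + (\<chi> i. s)" s y] by (intro mult_left_mono) (auto simp: \<phi>_def)
      qed (simp add: \<phi>0)
      finally show "norm (f y * of_real (\<phi> y) - f x * of_real (\<phi> y)) \<le> indicat_real (cbox x (x + h *\<^sub>R One)) y * cmod (f y - f x)"
        by (simp add: mult.commute)
    qed
    also have "\<dots> \<le> (e / 3 ^ CARD('n)) * h ^ CARD('n)" by (rule h0(2)[OF h(1,2)])
    finally have "cmod (f x) * \<bar>\<integral>y. \<phi> y \<partial>lebesgue\<bar> \<le> 2 * (Eeta * 3 ^ Suc m) * h ^ CARD('n) * ?M + (e / 3 ^ CARD('n)) * h ^ CARD('n)"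
      using up by linarith
    moreover have "cmod (f x) * s ^ CARD('n) \<le> cmod (f x) * \<bar>\<integral>y. \<phi> y \<partial>lebesgue\<bar>"
      using low by (intro mult_left_mono) auto
    moreover have "h ^ CARD('n) = 3 ^ CARD('n) * s ^ CARD('n)" using s(2) by (metis power_mult_distrib)
    ultimately have "cmod (f x) * s ^ CARD('n) \<le> (CL * ?M + e) * s ^ CARD('n)"
      by (simp add: CL_def algebra_simps)
    then show "cmod (f x) \<le> CL * ?M + e" using s(1) by (simp add: mult_le_cancel_right)
  qed
qed

definition Ctail :: real where "Ctail = 6 ^ CARD('n) / (1 - 2 powr (- \<delta>))"

definition Cmarc :: real where "Cmarc = Ctail * real OV * 4 ^ CARD('n)"

definition Cgood :: real where "Cgood = real OV * (Cpair * Cphi) + CL"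

lemma Ctail_nonneg: "0 \<le> Ctail"
proof -
  have "2 powr (- \<delta>) < (1::real)" using \<delta> by (simp add: powr_less_one)
  then show ?thesis by (simp add: Ctail_def)
qed

lemma CL_nonneg: "0 \<le> CL" using Eeta(1) by (simp add: CL_def)

lemma Cgood_nonneg: "0 \<le> Cgood" using consts_pos CL_nonneg by (simp add: Cgood_def)

end

section \<open>Bounded overlap of the pieces and their Marcinkiewicz integral\<close>

context cz_decomp
begin

lemma card_int_box:
  fixes u :: "'n \<Rightarrow> real"
  assumes "J \<subseteq> {j. \<forall>i. \<bar>u i - of_int (j i)\<bar> \<le> 2 * dd}"
  shows "card J \<le> (4 * CARD('n) + 1) ^ CARD('n)" and "finite J"
proof -
  let ?B = "\<lambda>i. {\<lceil>u i - 2 * dd\<rceil> .. \<lfloor>u i + 2 * dd\<rfloor>}"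
  have sub: "J \<subseteq> PiE UNIV ?B"
  proof
    fix j assume "j \<in> J"
    then have "\<bar>u i - of_int (j i)\<bar> \<le> 2 * dd" for i using assms by blast
    then have "u i - 2 * dd \<le> of_int (j i)" "of_int (j i) \<le> u i + 2 * dd" for i by (smt (verit))+
    then show "j \<in> PiE UNIV ?B" by (simp add: PiE_iff extensional_def le_floor_iff ceiling_le_iff)
  qed
  have fin: "finite (PiE UNIV ?B)" by (intro finite_PiE) auto
  show "finite J" using sub fin finite_subset by blast
  have "card J \<le> card (PiE UNIV ?B)" by (rule card_mono[OF fin sub])
  also have "\<dots> = (\<Prod>i\<in>UNIV. card (?B i))" by (rule card_PiE) simp
  also have "\<dots> \<le> (\<Prod>i\<in>(UNIV::'n set). 4 * CARD('n) + 1)"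
  proof (rule prod_mono, intro conjI)
    fix i
    have "\<lfloor>u i + 2 * dd\<rfloor> - \<lceil>u i - 2 * dd\<rceil> \<le> 4 * int CARD('n)"
    proof -
      have "real_of_int (\<lfloor>u i + 2 * dd\<rfloor> - \<lceil>u i - 2 * dd\<rceil>) \<le> (u i + 2 * dd) - (u i - 2 * dd)"
        unfolding of_int_diff by (intro diff_mono of_int_floor_le le_of_int_ceiling)
      also have "\<dots> = real_of_int (4 * int CARD('n))" by (simp add: dd_def)
      finally show ?thesis by (simp only: of_int_le_iff)
    qed
    then show "card (?B i) \<le> 4 * CARD('n) + 1" by simp
  qed simp
  also have "\<dots> = (4 * CARD('n) + 1) ^ CARD('n)" by simp
  finally show "card J \<le> (4 * CARD('n) + 1) ^ CARD('n)" .
qed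

lemma cpt_nth: "cc k j $ i = a $ i + hh k * of_int (j i)"
  by (simp add: cpt_def hh_def)

text \<open>Cells of one generation are disjoint, so y determines the fine index j as a floor. Only
  the coarse partner j' varies, and it stays within 2 d coarse sides in each coordinate.\<close>

lemma overlap_level: "card {q \<in> pcs k. y \<in> cell (k, q)} \<le> (4 * CARD('n) + 1) ^ CARD('n)"
proof (cases "{q \<in> pcs k. y \<in> cell (k, q)} = {}")
  case True
  show ?thesis unfolding True by simp
next
  case False
  let ?S = "{q \<in> pcs k. y \<in> cell (k, q)}"
  have cellD: "j i = \<lfloor>(y $ i - a $ i) / hh (Suc k)\<rfloor>" if "(j, j') \<in> ?S" for j j' i
  proof -
    have "cc (Suc k) j $ i \<le> y $ i" "y $ i < cc (Suc k) j $ i + hh (Suc k)"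
      using that by (auto simp: cell_def mem_cube cen_def side_def)
    then have "real_of_int (j i) \<le> (y $ i - a $ i) / hh (Suc k)" "(y $ i - a $ i) / hh (Suc k) < real_of_int (j i) + 1"
      using hh_pos[of "Suc k"] by (auto simp: cpt_nth field_simps)
    then show ?thesis by (simp add: floor_unique)
  qed
  define j0 :: "'n \<Rightarrow> int" where "j0 = (\<lambda>i. \<lfloor>(y $ i - a $ i) / hh (Suc k)\<rfloor>)"
  define u where "u i = (cc (Suc k) j0 $ i - a $ i) / hh k" for i
  have inj: "inj_on snd ?S"
    using cellD by (intro inj_onI) (metis (no_types, lifting) ext prod.collapse)
  have "snd ` ?S \<subseteq> {j'. \<forall>i. \<bar>u i - of_int (j' i)\<bar> \<le> 2 * dd}"
  proof (rule image_subsetI, rule CollectI, rule allI)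
    fix q i assume "q \<in> ?S"
    then obtain j j' where q: "q = (j, j')" and jj: "(j, j') \<in> pcs k" "y \<in> cell (k, j, j')" by (cases q) auto
    then have "j = j0" using cellD[of j j'] by (auto simp: j0_def)
    then have "dist (cc (Suc k) j0) (cc k j') \<le> 2 * dd * hh k" using jj(1) by (auto simp: pcs_def)
    then have "\<bar>cc (Suc k) j0 $ i - cc k j' $ i\<bar> \<le> 2 * dd * hh k"
      using component_le_dist order_trans by blast
    moreover have "u i - of_int (j' i) = (cc (Suc k) j0 $ i - cc k j' $ i) / hh k"
      using hh_pos[of k] by (simp add: u_def cpt_nth[of k j'] field_simps)
    ultimately show "\<bar>u i - of_int (snd q i)\<bar> \<le> 2 * dd"
      using hh_pos[of k] by (simp add: q abs_divide pos_divide_le_eq)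
  qed
  then have "card (snd ` ?S) \<le> (4 * CARD('n) + 1) ^ CARD('n)" by (rule card_int_box(1))
  then show ?thesis using card_image[OF inj] by simp
qed

text \<open>The distance of y from F is roughly between \<open>NN\<close> and 2 \<open>NN\<close>
  times the side of any piece whose cell contains y. Two generations apart the sides differ by a
  factor of at least 4, which is incompatible with both bounds.\<close>

lemma overlap: "card {p \<in> pieces n. y \<in> cell p} \<le> OV"
proof -
  let ?L = "\<lambda>k. {q \<in> pcs k. y \<in> cell (k, q)}"
  define Ks where "Ks = {k. k < n \<and> ?L k \<noteq> {}}"
  have near: "k2 \<le> k1 + 1" if kk: "k1 \<in> Ks" "k2 \<in> Ks" for k1 k2
  proof (rule ccontr)
    assume "\<not> ?thesis"
    then have k: "k1 + 2 \<le> k2" by simp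
    have ex: "\<exists>q. (k, q) \<in> pieces n \<and> y \<in> cell (k, q)" if k: "k \<in> Ks" for k
    proof -
      obtain q where "q \<in> ?L k" using k unfolding Ks_def by blast
      then show ?thesis using k by (intro exI[of _ q]) (simp add: pieces_def Ks_def)
    qed
    obtain q1 where q1: "(k1, q1) \<in> pieces n" "y \<in> cell (k1, q1)" using ex[OF kk(1)] by blast
    obtain q2 where q2: "(k2, q2) \<in> pieces n" "y \<in> cell (k2, q2)" using ex[OF kk(2)] by blast
    obtain z where z: "z \<in> F" "dist z (cen (k2, q2)) \<le> (2 * NN + 4 * dd) * side (k2, q2)"
      using piece_near(1)[OF q2(1)] by blast
    have "NN * side (k1, q1) < dist z (cen (k1, q1))" by (rule piece_near(2)[OF q1(1) z(1)])
    also have "\<dots> \<le> dist z y + dist y (cen (k1, q1))" by (rule dist_triangle)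
    also have "dist y (cen (k1, q1)) \<le> dd * side (k1, q1)" by (rule cell_near[OF q1(2)])
    also have "dist z y \<le> dist z (cen (k2, q2)) + dist y (cen (k2, q2))" by (rule dist_triangle2)
    also have "dist y (cen (k2, q2)) \<le> dd * side (k2, q2)" by (rule cell_near[OF q2(2)])
    finally have 1: "NN * side (k1, q1) < (2 * NN + 5 * dd) * side (k2, q2) + dd * side (k1, q1)"
      using z(2) by (simp add: algebra_simps)
    have 2: "4 * side (k2, q2) \<le> side (k1, q1)"
    proof -
      have "(2::real) ^ (Suc k1 + 2) \<le> 2 ^ Suc k2" using k by (intro power_increasing) auto
      then have "l / 2 ^ Suc k2 \<le> l / 2 ^ (Suc k1 + 2)" using l by (intro divide_left_mono) auto
      then show ?thesis by (simp add: side_def hh_def)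
    qed
    have "(NN - dd) * (4 * side (k2, q2)) \<le> (NN - dd) * side (k1, q1)"
      using NN_ge dd1 by (intro mult_left_mono 2) linarith
    with 1 have "(NN - dd) * (4 * side (k2, q2)) < (2 * NN + 5 * dd) * side (k2, q2)"
      by (simp add: algebra_simps)
    then have "((NN - dd) * 4) * side (k2, q2) < (2 * NN + 5 * dd) * side (k2, q2)" by (simp only: mult.assoc)
    then have "(NN - dd) * 4 < 2 * NN + 5 * dd" using side_pos by (metis mult_less_cancel_right_pos)
    then have "2 * NN < 9 * dd" by (simp add: algebra_simps)
    moreover have "9 * dd \<le> 1000 * dd" using dd1 by simp
    ultimately have "2 * NN < NN" using NN_ge by linarith
    moreover have "0 \<le> NN" using NN_ge dd1 by linarith
    ultimately show False by linarith
  qed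
  have fin: "finite Ks" by (simp add: Ks_def)
  have cardK: "card Ks \<le> 2"
  proof (cases "Ks = {}")
    case False
    have "Ks \<subseteq> {Min Ks, Suc (Min Ks)}"
    proof
      fix k assume "k \<in> Ks"
      then have "Min Ks \<le> k" "k \<le> Min Ks + 1" using fin near[OF Min_in[OF fin False]] by auto
      then show "k \<in> {Min Ks, Suc (Min Ks)}" by auto
    qed
    then have "card Ks \<le> card {Min Ks, Suc (Min Ks)}" by (intro card_mono) auto
    then show ?thesis by simp
  qed simp
  have "{p \<in> pieces n. y \<in> cell p} = Sigma Ks ?L"
    by (auto simp: pieces_def Ks_def)
  then have "card {p \<in> pieces n. y \<in> cell p} = (\<Sum>k\<in>Ks. card (?L k))"
  proof -
    have "finite (?L k)" for k
      by (rule finite_subset[of _ "cells (Suc k) \<times> cells k"]) (auto simp: pcs_def finite_cells)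
    then show ?thesis using \<open>{p \<in> pieces n. y \<in> cell p} = Sigma Ks ?L\<close> fin by (simp add: card_SigmaI)
  qed
  also have "\<dots> \<le> of_nat (card Ks) * (4 * CARD('n) + 1) ^ CARD('n)"
    by (rule sum_bounded_above) (rule overlap_level)
  also have "\<dots> \<le> 2 * (4 * CARD('n) + 1) ^ CARD('n)" using cardK by (intro mult_right_mono) auto
  finally show ?thesis by (simp add: OV_def)
qed

text \<open>Side 4 l instead of 3 l: a cell with its corner at the upper end of the tripled cube
  sticks out by at most l.\<close>

definition big :: "(real^'n) set" where "big = cube_of (a - (\<chi> i. l)) (4 * l)"

lemma cell_big:
  assumes "p \<in> pieces n"
  shows "cell p \<subseteq> big"
proof
  fix y assume y: "y \<in> cell p"
  obtain k j j' where p: "p = (k, j, j')" by (cases p)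
  have j: "j \<in> cells (Suc k)" using assms by (auto simp: p pieces_def pcs_def)
  show "y \<in> big" unfolding big_def mem_cube
  proof
    fix i
    have "- (2 ^ Suc k) \<le> j i" "j i \<le> 2 ^ (Suc k + 1)" using j by (auto simp: cells_def PiE_iff)
    then have "real_of_int (- (2 ^ Suc k)) \<le> real_of_int (j i)" "real_of_int (j i) \<le> real_of_int (2 ^ (Suc k + 1))"
      by (simp_all only: of_int_le_iff)
    from this[THEN mult_left_mono, OF less_imp_le[OF hh_pos[of "Suc k"]]]
    have 1: "hh (Suc k) * real_of_int (- (2 ^ Suc k)) \<le> hh (Suc k) * real_of_int (j i)"
      "hh (Suc k) * real_of_int (j i) \<le> hh (Suc k) * real_of_int (2 ^ (Suc k + 1))" .
    have 2: "hh (Suc k) * real_of_int (- (2 ^ Suc k)) = - l" "hh (Suc k) * real_of_int (2 ^ (Suc k + 1)) = 2 * l"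
      by (simp_all add: hh_def)
    define r where "r = hh (Suc k) * real_of_int (j i)"
    have "- l \<le> r" "r \<le> 2 * l" using 1 unfolding 2 r_def by auto
    moreover have "a $ i + r \<le> y $ i" "y $ i < a $ i + r + hh (Suc k)"
      using y by (auto simp: p cell_def mem_cube cen_def side_def cpt_nth r_def)
    ultimately show "(a - (\<chi> i. l)) $ i \<le> y $ i \<and> y $ i < (a - (\<chi> i. l)) $ i + 4 * l"
      using hh_le[of "Suc k"] by simp
  qed
qed

lemma measure_big: "measure lebesgue big = 4 ^ CARD('n) * l ^ CARD('n)" "big \<in> lmeasurable"
  using l by (auto simp: big_def measure_cube lmeasurable_cube power_mult_distrib)

lemma sum_indicator: "(\<Sum>p\<in>pieces n. indicat_real (cell p) y) \<le> real OV * indicat_real big y"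
proof (cases "y \<in> big")
  case True
  have "(\<Sum>p\<in>pieces n. indicat_real (cell p) y) = real (card {p \<in> pieces n. y \<in> cell p})"
    using finite_pieces[of n] by (simp add: indicator_def sum.If_cases Int_def)
  then show ?thesis using True overlap[of n y] by simp
next
  case False
  then have "indicat_real (cell p) y = 0" if "p \<in> pieces n" for p using cell_big[OF that] by (auto simp: indicator_def)
  then show ?thesis by simp
qed

lemma sum_volume: "(\<Sum>p\<in>pieces n. side p ^ CARD('n)) \<le> real OV * 4 ^ CARD('n) * l ^ CARD('n)"
proof -
  have int: "integrable lebesgue (indicat_real (cell p))" for p
    unfolding cell_def using lmeasurable_cube by (intro integrable_real_indicator) (auto simp: fmeasurable_def)
  have "(\<Sum>p\<in>pieces n. side p ^ CARD('n)) = (\<Sum>p\<in>pieces n. \<integral>y. indicat_real (cell p) y \<partial>lebesgue)"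
    using side_pos by (intro sum.cong) (auto simp: cell_def less_imp_le)
  also have "\<dots> = (\<integral>y. (\<Sum>p\<in>pieces n. indicat_real (cell p) y) \<partial>lebesgue)"
    by (rule Bochner_Integration.integral_sum[symmetric]) (rule int)
  also have "\<dots> \<le> (\<integral>y. real OV * indicat_real big y \<partial>lebesgue)"
  proof (rule integral_mono)
    show "integrable lebesgue (\<lambda>y. real OV * indicat_real big y)"
      using measure_big(2) by (intro integrable_mult_right integrable_real_indicator) (auto simp: fmeasurable_def)
    show "integrable lebesgue (\<lambda>y. \<Sum>p\<in>pieces n. indicat_real (cell p) y)" by (intro Bochner_Integration.integrable_sum int)
  qed (rule sum_indicator)
  also have "\<dots> = real OV * measure lebesgue big" using measure_big(2) by (simp add: fmeasurable_def)
  finally show ?thesis by (simp add: measure_big mult.assoc)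
qed

lemma marc_measurable: "marc n \<in> borel_measurable lebesgue"
proof -
  have "marc n \<in> borel_measurable borel" unfolding marc_def[abs_def] by measurable
  then show ?thesis by (simp add: measurable_completion)
qed

lemma marc_mono: "n \<le> n' \<Longrightarrow> marc n x \<le> marc n' x"
  unfolding marc_def using side_pos
  by (intro sum_mono2 finite_pieces pieces_mono mult_nonneg_nonneg) (auto simp: less_imp_le)

lemma F_sets: "F \<in> sets lebesgue"
  using borel_closed[OF F(1)] by (simp add: sets_completionI_sets)

text \<open>Summand by summand: F avoids the ball of radius \<open>side p\<close> about
  \<open>cen p\<close>, so the tail integral cancels the factor side^\<delta> and leaves a multiple
  of the volume of the piece. Bounded overlap sums these volumes.\<close>

lemma marc_integral: "(\<integral>\<^sup>+x. ennreal (marc n x) * indicator F x \<partial>lebesgue) \<le> ennreal (Cmarc * l ^ CARD('n))"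
proof -
  let ?g = "\<lambda>p x. indicat_real {y. side p \<le> dist (cen p) y} x * dist (cen p) x powr (- (dd + \<delta>))"
  let ?w = "\<lambda>p. side p ^ CARD('n) * side p powr \<delta>"
  have w0: "0 \<le> ?w p" for p using side_pos[of p] by simp
  have "(\<integral>\<^sup>+x. ennreal (marc n x) * indicator F x \<partial>lebesgue) \<le> (\<integral>\<^sup>+x. (\<Sum>p\<in>pieces n. ennreal (?w p) * ennreal (?g p x)) \<partial>lebesgue)"
  proof (rule nn_integral_mono)
    fix x
    show "ennreal (marc n x) * indicator F x \<le> (\<Sum>p\<in>pieces n. ennreal (?w p) * ennreal (?g p x))"
    proof (cases "x \<in> F")
      case True
      have e: "marc n x = (\<Sum>p\<in>pieces n. ?w p * ?g p x)"
        unfolding marc_def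
      proof (rule sum.cong[OF refl])
        fix p assume p: "p \<in> pieces n"
        have "1 * side p \<le> NN * side p" using NN_ge dd1 side_pos[of p] by (intro mult_right_mono) linarith+
        also have "\<dots> < dist x (cen p)" by (rule piece_near(2)[OF p True])
        finally show "side p ^ CARD('n) * side p powr \<delta> * dist x (cen p) powr (- (dd + \<delta>)) = ?w p * ?g p x"
          by (simp add: dist_commute)
      qed
      have e2: "ennreal (\<Sum>p\<in>pieces n. ?w p * ?g p x) = (\<Sum>p\<in>pieces n. ennreal (?w p * ?g p x))"
      proof (rule sum_ennreal[symmetric])
        fix p show "0 \<le> ?w p * ?g p x" by (rule mult_nonneg_nonneg[OF w0 mult_nonneg_nonneg]) simp_all
      qed
      have e3: "(\<Sum>p\<in>pieces n. ennreal (?w p * ?g p x)) = (\<Sum>p\<in>pieces n. ennreal (?w p) * ennreal (?g p x))"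
      proof (rule sum.cong[OF refl])
        fix p show "ennreal (?w p * ?g p x) = ennreal (?w p) * ennreal (?g p x)"
          by (rule ennreal_mult[OF w0 mult_nonneg_nonneg]) simp_all
      qed
      have "ennreal (marc n x) = (\<Sum>p\<in>pieces n. ennreal (?w p) * ennreal (?g p x))"
        by (rule trans[OF arg_cong[OF e, of ennreal] trans[OF e2 e3]])
      then show ?thesis using True by (simp only: indicator_simps mult_1_right order_refl)
    qed simp
  qed
  also have "\<dots> = (\<Sum>p\<in>pieces n. ennreal (?w p) * (\<integral>\<^sup>+x. ennreal (?g p x) \<partial>lebesgue))"
    by (subst nn_integral_sum, (intro borel_measurable_times_ennreal measurable_compose[OF measurable_dist_powr measurable_ennreal] borel_measurable_const),
        intro sum.cong refl nn_integral_cmult measurable_compose[OF measurable_dist_powr measurable_ennreal])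
  also have "\<dots> \<le> (\<Sum>p\<in>pieces n. ennreal (?w p) * ennreal (Ctail * side p powr (- \<delta>)))"
    unfolding Ctail_def dd_def by (intro sum_mono mult_left_mono nn_integral_tail side_pos \<delta>(1)) auto
  also have "\<dots> = (\<Sum>p\<in>pieces n. ennreal (Ctail * side p ^ CARD('n)))"
  proof (rule sum.cong[OF refl])
    fix p
    have eq: "?w p * (Ctail * side p powr (- \<delta>)) = Ctail * side p ^ CARD('n)"
      using side_pos[of p] by (simp add: powr_minus)
    have "ennreal (?w p) * ennreal (Ctail * side p powr (- \<delta>)) = ennreal (?w p * (Ctail * side p powr (- \<delta>)))"
      by (rule ennreal_mult[OF w0 mult_nonneg_nonneg[OF Ctail_nonneg], symmetric]) simp
    then show "ennreal (?w p) * ennreal (Ctail * side p powr (- \<delta>)) = ennreal (Ctail * side p ^ CARD('n))"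
      unfolding eq .
  qed
  also have "\<dots> = ennreal (Ctail * (\<Sum>p\<in>pieces n. side p ^ CARD('n)))"
    using Ctail_nonneg side_pos by (simp add: sum_ennreal sum_distrib_left less_imp_le)
  also have "\<dots> \<le> ennreal (Cmarc * l ^ CARD('n))"
    using mult_left_mono[OF sum_volume Ctail_nonneg] by (intro ennreal_leI) (simp add: Cmarc_def mult.assoc)
  finally show ?thesis .
qed

definition marc_good :: "real \<Rightarrow> (real^'n) set" where
  "marc_good A = {x \<in> F. \<forall>n. marc n x \<le> A}"

lemma marc_good_sets: "marc_good A \<in> sets lebesgue"
proof -
  have "{x \<in> space lebesgue. marc n x \<le> A} \<in> sets lebesgue" for n
    using marc_measurable by (rule borel_measurable_le) simp
  then have "F \<inter> (\<Inter>n. {x \<in> space lebesgue. marc n x \<le> A}) \<in> sets lebesgue"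
    using F_sets by (intro sets.Int sets.countable_INT) auto
  moreover have "marc_good A = F \<inter> (\<Inter>n. {x \<in> space lebesgue. marc n x \<le> A})"
    by (auto simp: marc_good_def)
  ultimately show ?thesis by simp
qed

text \<open>Chebyshev for fixed n, with a bound that does not depend on n; the exceptional sets
  increase with n.\<close>

lemma marc_good_measure:
  assumes A: "A > 0"
  shows "emeasure lebesgue (F - marc_good A) \<le> ennreal (Cmarc * l ^ CARD('n) / A)"
proof -
  define B where "B n = {x \<in> F. A < marc n x}" for n
  have Bs: "B n \<in> sets lebesgue" for n
  proof -
    have "F \<inter> {x \<in> space lebesgue. A < marc n x} \<in> sets lebesgue"
      using F_sets borel_measurable_less[OF _ marc_measurable, of "\<lambda>_. A"] by (intro sets.Int) auto
    then show ?thesis by (simp add: B_def Int_def)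
  qed
  have "F - marc_good A = (\<Union>n. B n)" by (auto simp: marc_good_def B_def not_le dest: leD)
  moreover have "incseq B" unfolding incseq_def B_def using marc_mono less_le_trans by blast
  ultimately have "emeasure lebesgue (F - marc_good A) = (SUP n. emeasure lebesgue (B n))"
    using SUP_emeasure_incseq[of B lebesgue] Bs by (metis image_subsetI)
  also have "\<dots> \<le> ennreal (Cmarc * l ^ CARD('n) / A)"
  proof (rule SUP_least)
    fix n
    have "emeasure lebesgue (B n) * ennreal A = (\<integral>\<^sup>+x. ennreal A * indicator (B n) x \<partial>lebesgue)"
      using Bs by (simp add: nn_integral_cmult_indicator mult.commute)
    also have "\<dots> \<le> (\<integral>\<^sup>+x. ennreal (marc n x) * indicator F x \<partial>lebesgue)"
      by (rule nn_integral_mono) (auto simp: B_def indicator_def intro!: ennreal_leI)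
    also have "\<dots> \<le> ennreal (Cmarc * l ^ CARD('n))" by (rule marc_integral)
    finally have "emeasure lebesgue (B n) * ennreal A / ennreal A \<le> ennreal (Cmarc * l ^ CARD('n)) / ennreal A"
      by (rule divide_right_mono_ennreal)
    moreover have "emeasure lebesgue (B n) * ennreal A / ennreal A = emeasure lebesgue (B n)"
      using A by (simp add: ennreal_mult_divide_eq)
    moreover have "ennreal (Cmarc * l ^ CARD('n)) / ennreal A = ennreal (Cmarc * l ^ CARD('n) / A)"
      using A l Ctail_nonneg by (intro divide_ennreal) (auto simp: Cmarc_def)
    ultimately show "emeasure lebesgue (B n) \<le> ennreal (Cmarc * l ^ CARD('n) / A)" by simp
  qed
  finally show ?thesis .
qed

subsection \<open>The good part\<close>

text \<open>A measurable part of F, equal to F up to a null set, on which the bound by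
  \<open>lam\<close> holds at every point; it makes \<open>uu\<close> bounded everywhere rather than
  almost everywhere.\<close>

definition Fb :: "(real^'n) set" where "Fb = {x \<in> F. cmod (f1 x) \<le> CL * lam}"

definition gg :: "nat \<Rightarrow> real^'n \<Rightarrow> complex" where
  "gg n y = (\<Sum>p\<in>pieces n. avg p * indicator (cell p) y)"

definition uu :: "nat \<Rightarrow> real^'n \<Rightarrow> complex" where
  "uu n y = gg n y + f1 y * of_real (ww n y) * indicator Fb y"

text \<open>The part to be removed in the limit: on F it lives on a null set only, and at a point
  off F it vanishes for all large n.\<close>

definition vv :: "nat \<Rightarrow> real^'n \<Rightarrow> complex" where
  "vv n y = f1 y * of_real (ww n y) * indicator (- Fb) y"

lemma f1_split: "f1 y = (\<Sum>p\<in>pieces n. bad p y) + (uu n y + vv n y)"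
proof -
  have "f1 y * of_real (ww n y) * indicator Fb y + vv n y = f1 y * of_real (ww n y)"
    by (simp add: vv_def indicator_def)
  moreover have "(\<Sum>p\<in>pieces n. bad p y) + gg n y = (\<Sum>p\<in>pieces n. f1 y * of_real (phi p y))"
    by (simp add: bad_def gg_def sum.distrib[symmetric])
  ultimately have eq: "f1 y = (\<Sum>p\<in>pieces n. bad p y) + gg n y + (f1 y * of_real (ww n y) * indicator Fb y + vv n y)"
    using f1_decomp[of y n] by metis
  show ?thesis by (rule trans[OF eq]) (simp add: uu_def add_ac)
qed

lemma f1_measurable: "f1 \<in> borel_measurable lebesgue"
  using Linfc_f1 by (simp add: Linfc_def)

lemma Fb_sets: "Fb \<in> sets lebesgue"
proof -
  have "F \<inter> {x \<in> space lebesgue. cmod (f1 x) \<le> CL * lam} \<in> sets lebesgue"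
    using F_sets borel_measurable_le[OF measurable_compose[OF f1_measurable borel_measurable_norm], of "\<lambda>_. CL * lam"]
    by (intro sets.Int) auto
  then show ?thesis by (simp add: Fb_def Int_def)
qed

lemma AE_Fb: "AE x in lebesgue. x \<in> F \<longrightarrow> x \<in> Fb"
  using AE_le_maxf[OF f l]
proof (rule AE_mp, intro AE_I2 impI)
  fix x assume le: "x \<in> cube_of a l \<longrightarrow> cmod (f x) \<le> CL * maxf m \<delta> (triple (cube_of a l)) f x" and x: "x \<in> F"
  have "cmod (f1 x) = cmod (f x) * \<bar>eta m a l x\<bar>" by (simp add: f1_def norm_mult)
  also have "\<dots> \<le> cmod (f x) * 1" using eta_01[of m a l x] by (intro mult_left_mono) auto
  also have "\<dots> \<le> CL * maxf m \<delta> (triple (cube_of a l)) f x" using le x F(2) by auto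
  also have "\<dots> \<le> CL * lam" using lam[OF x] CL_nonneg by (rule mult_left_mono)
  finally show "x \<in> Fb" using x by (simp add: Fb_def)
qed

lemma ww_measurable: "(\<lambda>y. complex_of_real (ww n y)) \<in> borel_measurable lebesgue"
  unfolding ww_def[abs_def]
  by (intro measurable_continuous_lebesgue continuous_on_of_real continuous_on_sum continuous_on_mult continuous_on_const
      hc_continuous_on[OF Eth(2)[OF hh_pos] hh_pos \<delta>(1)])

lemma ww_bounds:
  assumes y: "y \<in> triple (cube_of a l)"
  shows "0 \<le> ww n y" "ww n y \<le> 1"
proof -
  show "0 \<le> ww n y" unfolding ww_def by (intro sum_nonneg mult_nonneg_nonneg theta_01) auto
  have "ww n y \<le> (\<Sum>j\<in>cells n. theta m (hh n) (cc n j) y)"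
    unfolding ww_def by (intro sum_mono) (auto simp: theta_01)
  also have "\<dots> = 1" unfolding hh_def by (rule sum_theta[OF l in3Q[OF y]])
  finally show "ww n y \<le> 1" .
qed

lemma f1_ww_bound: "cmod (f1 y * of_real (ww n y)) \<le> cmod (f1 y)"
proof (cases "f1 y = 0")
  case False
  from ww_bounds[OF f1_nonzero[OF False], of n] show ?thesis
    by (simp add: norm_mult mult_left_le)
qed simp

text \<open>An active cell whose bump is nonzero at y forces a point of F within (\<open>NN\<close>
  + \<open>dd\<close>) \<open>hh n\<close> of y. This radius tends to 0 and F is closed.\<close>

lemma ww_eventually_0:
  assumes "y \<notin> F"
  shows "eventually (\<lambda>n. ww n y = 0) sequentially"
proof -
  obtain e where e: "e > 0" "\<And>z. dist z y < e \<Longrightarrow> z \<notin> F"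
    using F(1) assms unfolding closed_def open_dist by blast
  have "(\<lambda>n. (NN + dd) * hh n) \<longlonglongrightarrow> (NN + dd) * (l * 0)"
    unfolding hh_def divide_inverse by (intro tendsto_mult tendsto_const LIMSEQ_inverse_realpow_zero) auto
  then have "(\<lambda>n. (NN + dd) * hh n) \<longlonglongrightarrow> 0" by simp
  then have "eventually (\<lambda>n. (NN + dd) * hh n < e) sequentially" using e(1) by (rule order_tendstoD)
  then show ?thesis
  proof eventually_elim
    case (elim n)
    have "(if act n j then 1 else 0) * theta m (hh n) (cc n j) y = 0" for j
    proof (rule ccontr)
      assume nz: "(if act n j then 1 else 0) * theta m (hh n) (cc n j) y \<noteq> 0"
      then have "act n j" by (auto split: if_splits)
      then obtain z where z: "z \<in> F" "dist z (cc n j) \<le> NN * hh n" unfolding act_def by blast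
      have "dist y (cc n j) \<le> dd * hh n" using nz by (intro theta_near) auto
      then have "dist z y \<le> (NN + dd) * hh n" using z(2) dist_triangle2[of z y "cc n j"] by (simp add: algebra_simps)
      then show False using e(2) z(1) elim by fastforce
    qed
    then show ?case unfolding ww_def by (simp add: sum.neutral)
  qed
qed

lemma vv_tendsto: "AE y in lebesgue. (\<lambda>n. vv n y) \<longlonglongrightarrow> 0"
  using AE_Fb
proof (rule AE_mp, intro AE_I2 impI)
  fix y assume y: "y \<in> F \<longrightarrow> y \<in> Fb"
  show "(\<lambda>n. vv n y) \<longlonglongrightarrow> 0"
  proof (cases "y \<in> F")
    case True
    then show ?thesis using y by (simp add: vv_def)
  next
    case False
    have "eventually (\<lambda>n. vv n y = 0) sequentially"
      using ww_eventually_0[OF False] by eventually_elim (simp add: vv_def)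
    then show ?thesis by (rule tendsto_eventually)
  qed
qed

lemma vv_bound: "cmod (vv n y) \<le> cmod (f1 y)"
  using f1_ww_bound[of y n] by (auto simp: vv_def indicator_def)

lemma gg_measurable: "gg n \<in> borel_measurable lebesgue"
  unfolding gg_def[abs_def] cell_def
  by (intro borel_measurable_sum borel_measurable_times borel_measurable_indicator lebesgue_cube) auto

lemma uu_measurable: "uu n \<in> borel_measurable lebesgue"
  unfolding uu_def[abs_def] using Fb_sets
  by (intro borel_measurable_add gg_measurable borel_measurable_times f1_measurable ww_measurable borel_measurable_indicator)

lemma vv_measurable: "vv n \<in> borel_measurable lebesgue"
  unfolding vv_def[abs_def] using sets.compl_sets[OF Fb_sets]
  by (intro borel_measurable_times f1_measurable ww_measurable borel_measurable_indicator) (simp add: Compl_eq_Diff_UNIV)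

lemma uu_bound: "cmod (uu n y) \<le> Cgood * lam * indicat_real big y"
proof -
  have g: "cmod (gg n y) \<le> real OV * (Cpair * Cphi) * lam * indicat_real big y"
  proof -
    have "cmod (gg n y) \<le> (\<Sum>p\<in>pieces n. Cpair * Cphi * lam * indicat_real (cell p) y)"
      unfolding gg_def using avg_bound by (intro sum_norm_le) (auto simp: indicator_def norm_mult)
    also have "\<dots> = Cpair * Cphi * lam * (\<Sum>p\<in>pieces n. indicat_real (cell p) y)"
      by (simp add: sum_distrib_left)
    also have "\<dots> \<le> Cpair * Cphi * lam * (real OV * indicat_real big y)"
      using consts_pos lam_nonneg by (intro mult_left_mono sum_indicator) auto
    finally show ?thesis by (simp add: mult_ac)
  qed
  have fb: "Fb \<subseteq> big"
  proof
    fix x assume "x \<in> Fb"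
    then have "x \<in> cube_of a l" using F(2) by (auto simp: Fb_def)
    then show "x \<in> big" using l unfolding big_def mem_cube by (simp, smt (verit))
  qed
  have "cmod (f1 y * of_real (ww n y) * indicator Fb y) \<le> CL * lam * indicat_real big y"
  proof (cases "y \<in> Fb")
    case True
    then show ?thesis using f1_ww_bound[of y n] fb by (auto simp: Fb_def)
  next
    case False
    then show ?thesis using CL_nonneg lam_nonneg by simp
  qed
  then show ?thesis unfolding uu_def Cgood_def
    using g norm_triangle_ineq[of "gg n y" "f1 y * of_real (ww n y) * indicator Fb y"]
    by (simp add: distrib_right)
qed

lemma big_bounded: "bounded big"
proof -
  have "big \<subseteq> cbox (a - (\<chi> i. l)) (a - (\<chi> i. l) + (\<chi> i. 4 * l))"
    unfolding big_def by (auto simp: mem_cube mem_box_cart less_imp_le)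
  then show ?thesis using bounded_cbox bounded_subset by blast
qed

lemma Linfc_uu: "Linfc (uu n)"
proof -
  have "{y. uu n y \<noteq> 0} \<subseteq> big"
  proof
    fix y assume "y \<in> {y. uu n y \<noteq> 0}"
    then have "0 < cmod (uu n y)" by simp
    then show "y \<in> big" using uu_bound[of n y] by (cases "y \<in> big") auto
  qed
  moreover have "cmod (uu n y) \<le> Cgood * lam" for y
    using uu_bound[of n y] Cgood_nonneg lam_nonneg by (cases "y \<in> big") auto
  ultimately show ?thesis
    using uu_measurable big_bounded bounded_subset unfolding Linfc_def bounded_iff[of "range _"] by auto
qed

lemma Linfc_vv: "Linfc (vv n)"
proof -
  obtain M where M: "\<And>y. cmod (f1 y) \<le> M" using Linfc_bound[OF Linfc_f1] by blast
  have "{y. vv n y \<noteq> 0} \<subseteq> {y. f1 y \<noteq> 0}" by (auto simp: vv_def)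
  moreover have "cmod (vv n y) \<le> M" for y using vv_bound[of n y] M[of y] by linarith
  ultimately show ?thesis
    using vv_measurable Linfc_f1 bounded_subset unfolding Linfc_def bounded_iff[of "range _"] by auto
qed

lemma Linfc_bad: "Linfc (bad p)"
proof -
  have i: "Linfc (\<lambda>y. - avg p * indicator (cell p) y)"
  proof -
    have "{y. - avg p * indicator (cell p) y \<noteq> 0} \<subseteq> cbox (cen p) (cen p + (\<chi> i. side p))"
      by (auto simp: cell_def mem_cube mem_box_cart less_imp_le indicator_def split: if_splits)
    then have "bounded {y. - avg p * indicator (cell p) y \<noteq> 0}" using bounded_cbox bounded_subset by blast
    moreover have "(\<lambda>y. - avg p * indicator (cell p) y) \<in> borel_measurable lebesgue"
      unfolding cell_def by (intro borel_measurable_times borel_measurable_indicator lebesgue_cube) auto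
    moreover have "cmod (- avg p * indicator (cell p) y) \<le> cmod (avg p)" for y by (auto simp: indicator_def)
    ultimately show ?thesis unfolding Linfc_def bounded_iff[of "range _"] by auto
  qed
  have "Linfc (\<lambda>y. f1 y * of_real (phi p y))"
  proof (rule Linfc_mult[OF Linfc_f1])
    show "(\<lambda>y. complex_of_real (phi p y)) \<in> borel_measurable lebesgue"
      by (rule measurable_continuous_lebesgue[OF continuous_on_of_real[OF phi_continuous]])
    show "norm (complex_of_real (phi p y)) \<le> Cphi" for y using hc_bound[OF hc_phi, of y p] by simp
  qed
  from Linfc_add[OF this i] show ?thesis unfolding bad_def[abs_def] by simp
qed

lemma vv_L2: "(\<lambda>n. \<integral>y. (cmod (vv n y))\<^sup>2 \<partial>lebesgue) \<longlonglongrightarrow> 0"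
proof -
  have "(\<lambda>n. \<integral>y. (cmod (vv n y))\<^sup>2 \<partial>lebesgue) \<longlonglongrightarrow> (\<integral>y. 0 \<partial>(lebesgue :: (real^'n) measure))"
  proof (rule integral_dominated_convergence[where w = "\<lambda>y. (cmod (f1 y))\<^sup>2"])
    show "integrable lebesgue (\<lambda>y. (cmod (f1 y))\<^sup>2)" using L2_Linfc[OF Linfc_f1] by (simp add: L2_def)
    show "AE y in lebesgue. (\<lambda>n. (cmod (vv n y))\<^sup>2) \<longlonglongrightarrow> 0"
      using vv_tendsto by eventually_elim (auto intro!: tendsto_eq_intros)
    show "AE y in lebesgue. norm ((cmod (vv n y))\<^sup>2) \<le> (cmod (f1 y))\<^sup>2" for n
      using vv_bound by (intro AE_I2) (auto intro!: power_mono)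
    show "(\<lambda>y. (cmod (vv n y))\<^sup>2) \<in> borel_measurable lebesgue" for n
      by (rule borel_measurable_power[OF measurable_compose[OF vv_measurable borel_measurable_norm]])
  qed simp
  then show ?thesis by simp
qed

text \<open>Both truncated kernels are regular with respect to the same pole x', so the
  Marcinkiewicz integral at x' controls the bad part for each of them separately; hence the factor
  2. The cancellation between the kernels is spent on the bounded part \<open>uu\<close>.\<close>

lemma oscillation:
  assumes p: "p > 0" and x: "x \<in> cube_of b p" and x': "x' \<in> cube_of b p" and x'F: "x' \<in> marc_good A"
    and C: "\<And>z. z \<in> cube_of b p \<Longrightarrow> sk x' C (Kt b p z)" "0 \<le> C"
  shows "cmod (\<integral>y. (Kt b p x y - Kt b p x' y) * f1 y \<partial>lebesgue)
    \<le> (2 * (Cbad * C * A) + CK * (4 * real CARD('n)) ^ (CARD('n) + m + 1) * (Ctail * 2) * Cgood) * lam"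
proof -
  define k where "k z = Kt b p z" for z
  have mk: "k z \<in> borel_measurable lebesgue" for z unfolding k_def by (rule Kt_measurable[OF p])
  define M where "M = CK * (p / 2) powr (- real CARD('n))"
  have bk: "cmod (k z y) \<le> M" if "z \<in> cube_of b p" for z y unfolding k_def M_def by (rule Kt_bound[OF p that])
  have M0: "0 \<le> M" using bk[OF x, of x] norm_ge_zero order_trans by blast
  have x'F': "x' \<in> F" and mA: "\<And>n. marc n x' \<le> A" using x'F by (auto simp: marc_good_def)
  have int: "integrable lebesgue (\<lambda>y. k z y * g y)" if "Linfc g" "z \<in> cube_of b p" for g z
    using integrable_Linfc[OF Linfc_mult[OF that(1) mk bk[OF that(2)]]] by (simp add: mult.commute)
  have int': "integrable lebesgue (\<lambda>y. (k x y - k x' y) * g y)" if "Linfc g" for g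
    using int[OF that x] int[OF that x'] by (simp add: left_diff_distrib)
  let ?R = "2 * (Cbad * C * A) * lam + CK * (4 * real CARD('n)) ^ (CARD('n) + m + 1) * (Ctail * 2) * (Cgood * lam)"
  have main: "cmod (\<integral>y. (k x y - k x' y) * f1 y \<partial>lebesgue) \<le> ?R + cmod (\<integral>y. (k x y - k x' y) * vv n y \<partial>lebesgue)" for n
  proof -
    have bad: "(\<Sum>p\<in>pieces n. cmod (\<integral>y. k z y * bad p y \<partial>lebesgue)) \<le> Cbad * C * lam * A" if "z \<in> cube_of b p" for z
    proof -
      have "(\<Sum>p\<in>pieces n. cmod (\<integral>y. k z y * bad p y \<partial>lebesgue)) \<le> Cbad * C * lam * marc n x'"
        using bad_sum_bound[OF x'F' _ mk C(2), of z n] C(1)[OF that] by (simp add: k_def)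
      also have "\<dots> \<le> Cbad * C * lam * A" using consts_pos C(2) lam_nonneg mA by (intro mult_left_mono) auto
      finally show ?thesis .
    qed
    have "(\<integral>y. (k x y - k x' y) * f1 y \<partial>lebesgue)
       = (\<integral>y. (\<Sum>p\<in>pieces n. (k x y - k x' y) * bad p y) + ((k x y - k x' y) * uu n y + (k x y - k x' y) * vv n y) \<partial>lebesgue)"
      by (rule Bochner_Integration.integral_cong[OF refl]) (subst f1_split[of _ n], simp add: distrib_left sum_distrib_left)
    also have "\<dots> = (\<Sum>p\<in>pieces n. \<integral>y. (k x y - k x' y) * bad p y \<partial>lebesgue)
       + ((\<integral>y. (k x y - k x' y) * uu n y \<partial>lebesgue) + (\<integral>y. (k x y - k x' y) * vv n y \<partial>lebesgue))"
      by (simp only: Bochner_Integration.integral_add Bochner_Integration.integral_sum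
          Bochner_Integration.integrable_sum Bochner_Integration.integrable_add
          int'[OF Linfc_bad] int'[OF Linfc_uu] int'[OF Linfc_vv])
    also have "(\<Sum>p\<in>pieces n. \<integral>y. (k x y - k x' y) * bad p y \<partial>lebesgue)
       = (\<Sum>p\<in>pieces n. (\<integral>y. k x y * bad p y \<partial>lebesgue) - (\<integral>y. k x' y * bad p y \<partial>lebesgue))"
      using int[OF Linfc_bad x] int[OF Linfc_bad x'] by (simp add: left_diff_distrib)
    finally have eq: "(\<integral>y. (k x y - k x' y) * f1 y \<partial>lebesgue)
       = (\<Sum>p\<in>pieces n. (\<integral>y. k x y * bad p y \<partial>lebesgue) - (\<integral>y. k x' y * bad p y \<partial>lebesgue))
       + ((\<integral>y. (k x y - k x' y) * uu n y \<partial>lebesgue) + (\<integral>y. (k x y - k x' y) * vv n y \<partial>lebesgue))" .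
    have "cmod (\<integral>y. (k x y - k x' y) * f1 y \<partial>lebesgue)
       \<le> cmod (\<Sum>p\<in>pieces n. (\<integral>y. k x y * bad p y \<partial>lebesgue) - (\<integral>y. k x' y * bad p y \<partial>lebesgue))
         + (cmod (\<integral>y. (k x y - k x' y) * uu n y \<partial>lebesgue) + cmod (\<integral>y. (k x y - k x' y) * vv n y \<partial>lebesgue))"
      unfolding eq by (rule order_trans[OF norm_triangle_ineq add_left_mono[OF norm_triangle_ineq]])
    moreover have "cmod (\<Sum>p\<in>pieces n. (\<integral>y. k x y * bad p y \<partial>lebesgue) - (\<integral>y. k x' y * bad p y \<partial>lebesgue))
       \<le> (\<Sum>p\<in>pieces n. cmod (\<integral>y. k x y * bad p y \<partial>lebesgue)) + (\<Sum>p\<in>pieces n. cmod (\<integral>y. k x' y * bad p y \<partial>lebesgue))"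
      unfolding sum.distrib[symmetric] by (intro sum_norm_le norm_triangle_ineq4)
    moreover have "cmod (\<integral>y. (k x y - k x' y) * uu n y \<partial>lebesgue)
       \<le> CK * (4 * real CARD('n)) ^ (CARD('n) + m + 1) * (Ctail * 2) * (Cgood * lam)"
      unfolding k_def Ctail_def
    proof (rule Kt_osc_integral[OF p x x' uu_measurable])
      show "cmod (uu n y) \<le> Cgood * lam" for y
        using uu_bound[of n y] Cgood_nonneg lam_nonneg by (cases "y \<in> big") auto
      show "0 \<le> Cgood * lam" using Cgood_nonneg lam_nonneg by simp
    qed
    ultimately show ?thesis using bad[OF x] bad[OF x'] by (simp add: algebra_simps)
  qed
  \<comment> \<open>For a fixed cube the truncated kernels are bounded, so the remainder vanishes by
    dominated convergence, while \<open>?R\<close> does not depend on n.\<close>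
  have lim: "(\<lambda>n. \<integral>y. (k x y - k x' y) * vv n y \<partial>lebesgue) \<longlonglongrightarrow> (\<integral>y. 0 \<partial>(lebesgue :: (real^'n) measure))"
  proof (rule integral_dominated_convergence[where w = "\<lambda>y. 2 * M * cmod (f1 y)"])
    show "integrable lebesgue (\<lambda>y. 2 * M * cmod (f1 y))" using integrable_Linfc[OF Linfc_f1] by auto
    show "AE y in lebesgue. (\<lambda>n. (k x y - k x' y) * vv n y) \<longlonglongrightarrow> 0"
      using vv_tendsto by eventually_elim (auto intro!: tendsto_eq_intros)
    show "AE y in lebesgue. norm ((k x y - k x' y) * vv n y) \<le> 2 * M * cmod (f1 y)" for n
    proof (rule AE_I2)
      fix y
      have "cmod (k x y - k x' y) \<le> 2 * M" using bk[OF x, of y] bk[OF x', of y] norm_triangle_ineq4[of "k x y" "k x' y"] by linarith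
      then show "norm ((k x y - k x' y) * vv n y) \<le> 2 * M * cmod (f1 y)"
        unfolding norm_mult using vv_bound[of n y] M0 by (intro mult_mono) auto
    qed
    show "(\<lambda>y. (k x y - k x' y) * vv n y) \<in> borel_measurable lebesgue" for n
      by (intro borel_measurable_times borel_measurable_diff mk vv_measurable)
  qed simp
  have "cmod (\<integral>y. (k x y - k x' y) * f1 y \<partial>lebesgue) \<le> ?R + 0"
  proof (rule LIMSEQ_le_const[of _ "?R + 0"])
    show "(\<lambda>n. ?R + cmod (\<integral>y. (k x y - k x' y) * vv n y \<partial>lebesgue)) \<longlonglongrightarrow> ?R + 0"
      using lim by (intro tendsto_intros) (auto dest: tendsto_norm)
  qed (use main in blast)
  then show ?thesis by (simp add: k_def algebra_simps)
qed

end

subsection \<open>Quantiles\<close>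

lemma outer_meas_le: "A \<subseteq> B \<Longrightarrow> B \<in> sets lebesgue \<Longrightarrow> outer_meas A \<le> emeasure lebesgue B"
  unfolding outer_meas_def by (rule Inf_lower) blast

text \<open>The infimum in \<open>Pr\<close> need not be attained. Measurable covers B k are chosen
  at the levels \<open>Pr\<close> + 1/(k+1), with the slack from r to 2 r making room for the
  choice. Their lower limit has the same measure bound and contains every point above the quantile,
  because such a point belongs to all but finitely many B k.\<close>

lemma quantile_exceptional_set:
  fixes g :: "real^'n \<Rightarrow> real"
  assumes l: "l > 0" and r: "r > 0" and bd: "\<And>x. x \<in> cube_of a l \<Longrightarrow> g x \<le> M"
  obtains B where "B \<in> sets lebesgue" "{x \<in> cube_of a l. g x > Pr r (cube_of a l) g} \<subseteq> B"
    "emeasure lebesgue B \<le> ennreal (2 * r * l ^ CARD('n))"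
proof -
  let ?Q = "cube_of a l"
  define q where "q = l ^ CARD('n)"
  have q: "q > 0" using l by (simp add: q_def)
  let ?X = "{t. outer_meas {x\<in>?Q. g x > t} \<le> ennreal (r * measure lebesgue ?Q)}"
  have mQ: "measure lebesgue ?Q = q" using l by (simp add: q_def)
  have "{x\<in>?Q. g x > M} = {}" using bd by fastforce
  then have "outer_meas {x\<in>?Q. g x > M} \<le> emeasure lebesgue ({} :: (real^'n) set)" by (intro outer_meas_le) auto
  then have "M \<in> ?X" by simp
  then have ne: "?X \<noteq> {}" by blast
  have "\<exists>B. B \<in> sets lebesgue \<and> {x\<in>?Q. g x > Pr r ?Q g + 1 / real (Suc n)} \<subseteq> B \<and> emeasure lebesgue B \<le> ennreal (2 * r * q)" for n
  proof -
    have "Inf ?X < Pr r ?Q g + 1 / real (Suc n)" unfolding Pr_def by simp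
    then obtain t where t: "t \<in> ?X" "t < Pr r ?Q g + 1 / real (Suc n)" using cInf_lessD[OF ne] by blast
    have "outer_meas {x\<in>?Q. g x > t} \<le> ennreal (r * q)" using t(1) mQ by simp
    also have "\<dots> < ennreal (2 * r * q)" using r q by (intro ennreal_lessI) auto
    finally obtain B where B: "B \<in> sets lebesgue" "{x\<in>?Q. g x > t} \<subseteq> B" "emeasure lebesgue B < ennreal (2 * r * q)"
      unfolding outer_meas_def Inf_less_iff by blast
    have "{x\<in>?Q. g x > Pr r ?Q g + 1 / real (Suc n)} \<subseteq> {x\<in>?Q. g x > t}" using t(2) by auto
    from this B(2) have sub: "{x\<in>?Q. g x > Pr r ?Q g + 1 / real (Suc n)} \<subseteq> B" by (rule subset_trans)
    show ?thesis by (rule exI[of _ B], rule conjI[OF B(1) conjI[OF sub less_imp_le[OF B(3)]]])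
  qed
  then have "\<exists>B. \<forall>n. B n \<in> sets lebesgue \<and> {x\<in>?Q. g x > Pr r ?Q g + 1 / real (Suc n)} \<subseteq> B n \<and> emeasure lebesgue (B n) \<le> ennreal (2 * r * q)"
    by (intro choice allI)
  then obtain B where B: "\<And>n. B n \<in> sets lebesgue" "\<And>n. {x\<in>?Q. g x > Pr r ?Q g + 1 / real (Suc n)} \<subseteq> B n"
    "\<And>n. emeasure lebesgue (B n) \<le> ennreal (2 * r * q)" by blast
  define C where "C n = (\<Inter>k\<in>{n..}. B k)" for n
  have Cs: "C n \<in> sets lebesgue" for n unfolding C_def using B(1) by (intro sets.countable_INT) auto
  have "incseq C" unfolding incseq_def C_def by fastforce
  then have "emeasure lebesgue (\<Union>n. C n) = (SUP n. emeasure lebesgue (C n))"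
    using SUP_emeasure_incseq[of C lebesgue] Cs by (metis image_subsetI)
  also have "\<dots> \<le> ennreal (2 * r * q)"
  proof (rule SUP_least)
    fix n
    have "emeasure lebesgue (C n) \<le> emeasure lebesgue (B n)" using B(1) by (intro emeasure_mono) (auto simp: C_def)
    then show "emeasure lebesgue (C n) \<le> ennreal (2 * r * q)" using B(3) order_trans by blast
  qed
  finally have m: "emeasure lebesgue (\<Union>n. C n) \<le> ennreal (2 * r * q)" .
  have "{x \<in> ?Q. g x > Pr r ?Q g} \<subseteq> (\<Union>n. C n)"
  proof
    fix x assume x: "x \<in> {x \<in> ?Q. g x > Pr r ?Q g}"
    then obtain n where n: "inverse (real (Suc n)) < g x - Pr r ?Q g" using reals_Archimedean[of "g x - Pr r ?Q g"] by auto
    have "x \<in> B k" if "n \<le> k" for k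
    proof -
      have "1 / real (Suc k) \<le> 1 / real (Suc n)" using that by (intro divide_left_mono) auto
      then have "g x > Pr r ?Q g + 1 / real (Suc k)" using n by (simp add: inverse_eq_divide)
      then show ?thesis using B(2)[of k] x by blast
    qed
    then show "x \<in> (\<Union>n. C n)" unfolding C_def by auto
  qed
  moreover have "(\<Union>n. C n) \<in> sets lebesgue" using Cs by (intro sets.countable_UN) auto
  ultimately show ?thesis using that m unfolding q_def by blast
qed

subsection \<open>The operator\<close>

context cz_kernel
begin

definition Cbk :: "real \<Rightarrow> real" where "Cbk A = Cbad * (4 * CK * 2 ^ (CARD('n) + m + 1)) * A"

definition rr :: real where "rr = (1 / 2) ^ (CARD('n) + 6)"

end

locale cz_op = cz_kernel m \<delta> CK K for m \<delta> CK and K :: "real^'n \<Rightarrow> real^'n \<Rightarrow> complex" +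
  fixes T :: "(real^'n \<Rightarrow> complex) \<Rightarrow> real^'n \<Rightarrow> complex" and B :: real
  assumes T_L2: "\<And>f. L2 f \<Longrightarrow> L2 (T f)"
    and T_bound: "\<And>f. L2 f \<Longrightarrow> (\<integral>x. (cmod (T f x))^2 \<partial>lebesgue) \<le> B^2 * (\<integral>x. (cmod (f x))^2 \<partial>lebesgue)"
    and T_add: "\<And>f g. L2 f \<Longrightarrow> L2 g \<Longrightarrow> AE x in lebesgue. T (\<lambda>y. f y + g y) x = T f x + T g x"
    and T_mult: "\<And>f c. L2 f \<Longrightarrow> AE x in lebesgue. T (\<lambda>y. c * f y) x = c * T f x"
    and T_off: "\<And>f. Linfc f \<Longrightarrow> AE x in lebesgue. x \<notin> closure {y. f y \<noteq> 0} \<longrightarrow> T f x = (\<integral>y. K x y * f y \<partial>lebesgue)"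
begin

lemma Linfc_sum: "(\<And>p. p \<in> S \<Longrightarrow> Linfc (g p)) \<Longrightarrow> Linfc (\<lambda>y. \<Sum>p\<in>S. g p y)" for g :: "'i \<Rightarrow> real^'n \<Rightarrow> complex"
proof (induction S rule: infinite_finite_induct)
  case (insert x S)
  then show ?case by (simp add: Linfc_add)
qed (auto simp: Linfc_def)

lemma T_sum:
  fixes g :: "'i \<Rightarrow> real^'n \<Rightarrow> complex"
  assumes "finite S" "\<And>p. p \<in> S \<Longrightarrow> Linfc (g p)"
  shows "AE x in lebesgue. T (\<lambda>y. \<Sum>p\<in>S. g p y) x = (\<Sum>p\<in>S. T (g p) x)"
  using assms
proof (induction S rule: finite_induct)
  case empty
  have "L2 (\<lambda>y::real^'n. 0)" by (intro L2_Linfc) (auto simp: Linfc_def)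
  from T_mult[OF this, of 0] show ?case by simp
next
  case (insert p S)
  have "AE x in lebesgue. T (\<lambda>y. g p y + (\<Sum>p\<in>S. g p y)) x = T (g p) x + T (\<lambda>y. \<Sum>p\<in>S. g p y) x"
    using insert.prems by (intro T_add L2_Linfc Linfc_sum) auto
  moreover have "AE x in lebesgue. T (\<lambda>y. \<Sum>p\<in>S. g p y) x = (\<Sum>p\<in>S. T (g p) x)"
    using insert by auto
  ultimately show ?case
    by eventually_elim (use insert.hyps in simp)
qed

lemma T_measurable: "L2 f \<Longrightarrow> T f \<in> borel_measurable lebesgue"
  using T_L2 by (simp add: L2_def)

lemma T_chebyshev:
  assumes "L2 f" "t > 0"
  shows "emeasure lebesgue {x. t < cmod (T f x)} \<le> ennreal (B^2 * (\<integral>x. (cmod (f x))^2 \<partial>lebesgue) / t^2)"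
proof -
  let ?S = "{x. t < cmod (T f x)}"
  have L: "L2 (T f)" by (rule T_L2[OF assms(1)])
  have S: "?S \<in> sets lebesgue"
    using borel_measurable_less[OF borel_measurable_const measurable_compose[OF T_measurable[OF assms(1)] borel_measurable_norm], of t]
    by simp
  have int: "integrable lebesgue (\<lambda>x. (cmod (T f x))^2)" using L by (simp add: L2_def)
  have "emeasure lebesgue ?S * ennreal (t^2) = (\<integral>\<^sup>+x. ennreal (t^2) * indicator ?S x \<partial>lebesgue)"
    using S by (subst nn_integral_cmult_indicator) (auto simp: mult.commute)
  also have "\<dots> \<le> (\<integral>\<^sup>+x. ennreal ((cmod (T f x))^2) \<partial>lebesgue)"
    using assms(2) by (intro nn_integral_mono) (auto simp: indicator_def intro!: ennreal_leI power_mono)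
  also have "\<dots> = ennreal (\<integral>x. (cmod (T f x))^2 \<partial>lebesgue)"
    by (rule nn_integral_eq_integral[OF int]) auto
  also have "\<dots> \<le> ennreal (B^2 * (\<integral>x. (cmod (f x))^2 \<partial>lebesgue))"
    by (rule ennreal_leI[OF T_bound[OF assms(1)]])
  finally have "emeasure lebesgue ?S * ennreal (t^2) / ennreal (t^2) \<le> ennreal (B^2 * (\<integral>x. (cmod (f x))^2 \<partial>lebesgue)) / ennreal (t^2)"
    by (rule divide_right_mono_ennreal)
  moreover have "emeasure lebesgue ?S * ennreal (t^2) / ennreal (t^2) = emeasure lebesgue ?S"
    using assms(2) by (simp add: ennreal_mult_divide_eq)
  moreover have "ennreal (B^2 * (\<integral>x. (cmod (f x))^2 \<partial>lebesgue)) / ennreal (t^2) = ennreal (B^2 * (\<integral>x. (cmod (f x))^2 \<partial>lebesgue) / t^2)"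
    using assms(2) by (intro divide_ennreal mult_nonneg_nonneg integral_nonneg_AE) auto
  ultimately show ?thesis by simp
qed

end

section \<open>The weak type estimate for the localised operator\<close>

locale cz_decomp_op = cz_op m \<delta> CK K T B + cz_decomp m \<delta> CK K f a l F lam
  for m \<delta> CK and K :: "real^'n \<Rightarrow> real^'n \<Rightarrow> complex" and T B f a l F lam
begin

lemma T_decomp:
  "AE x in lebesgue. T f1 x = (\<Sum>p\<in>pieces n. T (bad p) x) + (T (uu n) x + T (vv n) x)"
proof -
  have "AE x in lebesgue. T (\<lambda>y. (\<Sum>p\<in>pieces n. bad p y) + (uu n y + vv n y)) x
     = T (\<lambda>y. \<Sum>p\<in>pieces n. bad p y) x + T (\<lambda>y. uu n y + vv n y) x"
    by (intro T_add L2_Linfc Linfc_sum Linfc_bad Linfc_add Linfc_uu Linfc_vv)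
  moreover have "AE x in lebesgue. T (\<lambda>y. uu n y + vv n y) x = T (uu n) x + T (vv n) x"
    by (intro T_add L2_Linfc Linfc_uu Linfc_vv)
  moreover have "AE x in lebesgue. T (\<lambda>y. \<Sum>p\<in>pieces n. bad p y) x = (\<Sum>p\<in>pieces n. T (bad p) x)"
    by (intro T_sum finite_pieces Linfc_bad)
  moreover have "f1 = (\<lambda>y. (\<Sum>p\<in>pieces n. bad p y) + (uu n y + vv n y))"
    using f1_split by blast
  ultimately show ?thesis by auto
qed

text \<open>The kernel representation applies on F: the closed support of a bad piece lies within d
  sides of its centre, while F stays beyond \<open>NN\<close> sides.\<close>

lemma T_bad:
  assumes p: "p \<in> pieces n"
  shows "AE x in lebesgue. x \<in> F \<longrightarrow> T (bad p) x = (\<integral>y. K x y * bad p y \<partial>lebesgue)"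
  using T_off[OF Linfc_bad[of p]]
proof (rule AE_mp, intro AE_I2 impI)
  fix x assume off: "x \<notin> closure {y. bad p y \<noteq> 0} \<longrightarrow> T (bad p) x = (\<integral>y. K x y * bad p y \<partial>lebesgue)" and x: "x \<in> F"
  have "{y. bad p y \<noteq> 0} \<subseteq> cball (cen p) (dd * side p)"
  proof
    fix y assume "y \<in> {y. bad p y \<noteq> 0}"
    then have "phi p y \<noteq> 0 \<or> y \<in> cell p" by (cases "y \<in> cell p") (auto simp: bad_def)
    then show "y \<in> cball (cen p) (dd * side p)" using phi_near[of p y] cell_near[of y p] by (auto simp: dist_commute[of "cen p"])
  qed
  then have "closure {y. bad p y \<noteq> 0} \<subseteq> cball (cen p) (dd * side p)" by (rule closure_minimal) simp
  moreover have "x \<notin> cball (cen p) (dd * side p)"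
  proof -
    have "dd * side p \<le> NN * side p" using NN_ge dd1 side_pos[of p] by (intro mult_right_mono) linarith+
    then show ?thesis using piece_near(2)[OF p x] by (simp add: dist_commute)
  qed
  ultimately show "T (bad p) x = (\<integral>y. K x y * bad p y \<partial>lebesgue)" using off by blast
qed

lemma T_pointwise:
  "AE x in lebesgue. x \<in> marc_good A \<longrightarrow> cmod (T f1 x) \<le> Cbk A * lam + (cmod (T (uu n) x) + cmod (T (vv n) x))"
proof -
  have "AE x in lebesgue. \<forall>p\<in>pieces n. x \<in> F \<longrightarrow> T (bad p) x = (\<integral>y. K x y * bad p y \<partial>lebesgue)"
    using T_bad by (intro AE_finite_allI finite_pieces) auto
  with T_decomp[of n] show ?thesis
  proof eventually_elim
    case (elim x)
    show ?case
    proof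
      assume xG: "x \<in> marc_good A"
      then have x: "x \<in> F" "marc n x \<le> A" by (auto simp: marc_good_def)
      let ?c = "4 * CK * 2 ^ (CARD('n) + m + 1)"
      have c0: "0 \<le> ?c" using CK by simp
      have "cmod (\<Sum>p\<in>pieces n. T (bad p) x) \<le> (\<Sum>p\<in>pieces n. cmod (\<integral>y. K x y * bad p y \<partial>lebesgue))"
        using elim(2) x by (intro sum_norm_le) auto
      also have "\<dots> \<le> Cbad * ?c * lam * marc n x"
        by (rule bad_sum_bound[OF x(1) sk_K K_measurable c0])
      also have "\<dots> \<le> Cbad * ?c * lam * A"
        using consts_pos c0 lam_nonneg x(2) by (intro mult_left_mono) auto
      finally have 1: "cmod (\<Sum>p\<in>pieces n. T (bad p) x) \<le> Cbk A * lam" by (simp add: Cbk_def mult_ac)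
      have "cmod (T f1 x) \<le> cmod (\<Sum>p\<in>pieces n. T (bad p) x) + (cmod (T (uu n) x) + cmod (T (vv n) x))"
        unfolding elim(1) by (rule order_trans[OF norm_triangle_ineq add_left_mono[OF norm_triangle_ineq]])
      then show "cmod (T f1 x) \<le> Cbk A * lam + (cmod (T (uu n) x) + cmod (T (vv n) x))" using 1 by linarith
    qed
  qed
qed

lemma uu_L2: "(\<integral>y. (cmod (uu n y))^2 \<partial>lebesgue) \<le> (Cgood * lam)^2 * (4 ^ CARD('n) * l ^ CARD('n))"
proof -
  have "(\<integral>y. (cmod (uu n y))^2 \<partial>lebesgue) \<le> (\<integral>y. (Cgood * lam)^2 * indicat_real big y \<partial>lebesgue)"
  proof (rule integral_mono)
    show "integrable lebesgue (\<lambda>y. (cmod (uu n y))^2)" using L2_Linfc[OF Linfc_uu] by (simp add: L2_def)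
    show "integrable lebesgue (\<lambda>y. (Cgood * lam)^2 * indicat_real big y)"
      using measure_big(2) by (intro integrable_mult_right integrable_real_indicator) (auto simp: fmeasurable_def)
    show "(cmod (uu n y))^2 \<le> (Cgood * lam)^2 * indicat_real big y" for y
      using power_mono[OF uu_bound[of n y], of 2] by (cases "y \<in> big") auto
  qed
  also have "\<dots> = (Cgood * lam)^2 * measure lebesgue big" using measure_big(2) by (simp add: fmeasurable_def)
  finally show ?thesis by (simp add: measure_big)
qed

text \<open>Off the set where one of \<open>T (uu n)\<close>, \<open>T (vv n)\<close> exceeds
  \<beta> \<mu>, the pointwise bound holds. Chebyshev bounds the first set by \<epsilon> l^d and
  lets the second disappear as n grows. A level \<mu> above \<open>lam\<close> is used because
  \<open>lam\<close> may be 0 while Chebyshev needs a positive level.\<close>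

lemma weak_type_aux:
  assumes \<beta>: "\<beta> > 0" "B^2 * Cgood^2 * 4 ^ CARD('n) / \<beta>^2 \<le> \<epsilon>" and A: "A \<ge> 0" and \<mu>: "\<mu> > 0" "lam \<le> \<mu>"
  shows "emeasure lebesgue {x \<in> marc_good A. (Cbk A + 2 * \<beta>) * \<mu> < cmod (T f1 x)} \<le> ennreal (\<epsilon> * l ^ CARD('n))"
proof -
  let ?S = "{x \<in> marc_good A. (Cbk A + 2 * \<beta>) * \<mu> < cmod (T f1 x)}"
  define I where "I n = (\<integral>y. (cmod (vv n y))^2 \<partial>lebesgue)" for n
  have t: "\<beta> * \<mu> > 0" using \<beta> \<mu> by simp
  have Cbk0: "0 \<le> Cbk A" using consts_pos CK A by (simp add: Cbk_def)
  have bound: "emeasure lebesgue ?S \<le> ennreal (\<epsilon> * l ^ CARD('n) + B^2 * I n / (\<beta> * \<mu>)^2)" for n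
  proof -
    let ?U = "{x. \<beta> * \<mu> < cmod (T (uu n) x)}" and ?V = "{x. \<beta> * \<mu> < cmod (T (vv n) x)}"
    have meas: "{x. t < cmod (T g x)} \<in> sets lebesgue" if "L2 g" for t g
      using borel_measurable_less[OF borel_measurable_const measurable_compose[OF T_measurable[OF that] borel_measurable_norm], of t]
      by simp
    have UV: "?U \<in> sets lebesgue" "?V \<in> sets lebesgue" by (auto intro!: meas L2_Linfc Linfc_uu Linfc_vv)
    have "AE x in lebesgue. x \<in> ?S \<longrightarrow> x \<in> ?U \<union> ?V"
      using T_pointwise[of A n]
    proof eventually_elim
      case (elim x)
      show ?case
      proof
        assume xS: "x \<in> ?S"
        then have "cmod (T f1 x) \<le> Cbk A * lam + (cmod (T (uu n) x) + cmod (T (vv n) x))" using elim by blast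
        also have "Cbk A * lam \<le> Cbk A * \<mu>" using Cbk0 \<mu> by (intro mult_left_mono) auto
        finally have "2 * (\<beta> * \<mu>) < cmod (T (uu n) x) + cmod (T (vv n) x)" using xS by (simp add: algebra_simps)
        then show "x \<in> ?U \<union> ?V" by auto
      qed
    qed
    then have "emeasure lebesgue ?S \<le> emeasure lebesgue (?U \<union> ?V)"
      using UV by (intro emeasure_mono_AE) auto
    also have "\<dots> \<le> emeasure lebesgue ?U + emeasure lebesgue ?V" by (rule emeasure_subadditive[OF UV])
    also have "\<dots> \<le> ennreal (\<epsilon> * l ^ CARD('n)) + ennreal (B^2 * I n / (\<beta> * \<mu>)^2)"
    proof (rule add_mono)
      have "emeasure lebesgue ?U \<le> ennreal (B^2 * (\<integral>x. (cmod (uu n x))^2 \<partial>lebesgue) / (\<beta> * \<mu>)^2)"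
        by (rule T_chebyshev[OF L2_Linfc[OF Linfc_uu] t])
      also have "\<dots> \<le> ennreal (\<epsilon> * l ^ CARD('n))"
      proof (rule ennreal_leI)
        have "B^2 * (\<integral>x. (cmod (uu n x))^2 \<partial>lebesgue) / (\<beta> * \<mu>)^2 \<le> B^2 * ((Cgood * \<mu>)^2 * (4 ^ CARD('n) * l ^ CARD('n))) / (\<beta> * \<mu>)^2"
        proof (intro divide_right_mono mult_left_mono)
          have "(Cgood * lam)^2 \<le> (Cgood * \<mu>)^2" using Cgood_nonneg lam_nonneg \<mu> by (intro power_mono mult_left_mono) auto
          then have "(Cgood * lam)^2 * (4 ^ CARD('n) * l ^ CARD('n)) \<le> (Cgood * \<mu>)^2 * (4 ^ CARD('n) * l ^ CARD('n))"
            using l by (intro mult_right_mono) auto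
          then show "(\<integral>x. (cmod (uu n x))^2 \<partial>lebesgue) \<le> (Cgood * \<mu>)^2 * (4 ^ CARD('n) * l ^ CARD('n))"
            using uu_L2[of n] by linarith
        qed auto
        also have "\<dots> = (B^2 * Cgood^2 * 4 ^ CARD('n) / \<beta>^2) * l ^ CARD('n)"
          using \<mu> by (simp add: power_mult_distrib)
        also have "\<dots> \<le> \<epsilon> * l ^ CARD('n)" using \<beta>(2) l by (intro mult_right_mono) auto
        finally show "B^2 * (\<integral>x. (cmod (uu n x))^2 \<partial>lebesgue) / (\<beta> * \<mu>)^2 \<le> \<epsilon> * l ^ CARD('n)" .
      qed
      finally show "emeasure lebesgue ?U \<le> ennreal (\<epsilon> * l ^ CARD('n))" .
      show "emeasure lebesgue ?V \<le> ennreal (B^2 * I n / (\<beta> * \<mu>)^2)"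
        unfolding I_def by (rule T_chebyshev[OF L2_Linfc[OF Linfc_vv] t])
    qed
    also have "\<dots> = ennreal (\<epsilon> * l ^ CARD('n) + B^2 * I n / (\<beta> * \<mu>)^2)"
    proof (rule ennreal_plus[symmetric])
      have "0 \<le> B^2 * Cgood^2 * 4 ^ CARD('n) / \<beta>^2" by simp
      then have "0 \<le> \<epsilon>" using \<beta>(2) by linarith
      then show "0 \<le> \<epsilon> * l ^ CARD('n)" using l by simp
      show "0 \<le> B^2 * I n / (\<beta> * \<mu>)^2" by (simp add: I_def)
    qed
    finally show ?thesis .
  qed
  have "(\<lambda>n. \<epsilon> * l ^ CARD('n) + B^2 * I n / (\<beta> * \<mu>)^2) \<longlonglongrightarrow> \<epsilon> * l ^ CARD('n) + B^2 * 0 / (\<beta> * \<mu>)^2"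
    using vv_L2 t unfolding I_def by (intro tendsto_intros) auto
  then have "(\<lambda>n. ennreal (\<epsilon> * l ^ CARD('n) + B^2 * I n / (\<beta> * \<mu>)^2)) \<longlonglongrightarrow> ennreal (\<epsilon> * l ^ CARD('n))"
    by (intro tendsto_ennrealI) simp
  then show ?thesis by (rule LIMSEQ_le_const) (use bound in blast)
qed

text \<open>Lets \<mu> decrease to \<open>lam\<close>; the exceptional sets increase to the one
  claimed.\<close>

lemma weak_type:
  assumes \<beta>: "\<beta> > 0" "B^2 * Cgood^2 * 4 ^ CARD('n) / \<beta>^2 \<le> \<epsilon>" and A: "A \<ge> 0"
  shows "emeasure lebesgue {x \<in> marc_good A. (Cbk A + 2 * \<beta>) * lam < cmod (T f1 x)} \<le> ennreal (\<epsilon> * l ^ CARD('n))"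
proof -
  define C where "C = Cbk A + 2 * \<beta>"
  have C0: "C > 0" using consts_pos CK A \<beta> by (simp add: C_def Cbk_def add_nonneg_pos)
  define S where "S n = {x \<in> marc_good A. C * (lam + 1 / real (Suc n)) < cmod (T f1 x)}" for n
  have meas: "{x. t < cmod (T f1 x)} \<in> sets lebesgue" for t
    using borel_measurable_less[OF borel_measurable_const measurable_compose[OF T_measurable[OF L2_Linfc[OF Linfc_f1]] borel_measurable_norm], of t]
    by simp
  have Ss: "S n \<in> sets lebesgue" for n
  proof -
    have "S n = marc_good A \<inter> {x. C * (lam + 1 / real (Suc n)) < cmod (T f1 x)}" by (auto simp: S_def)
    then show ?thesis using sets.Int[OF marc_good_sets meas] by simp
  qed
  have "incseq S"
    unfolding incseq_def
  proof (intro allI impI)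
    fix n n' :: nat assume "n \<le> n'"
    then have "1 / real (Suc n') \<le> 1 / real (Suc n)" by (intro divide_left_mono) auto
    then have "C * (lam + 1 / real (Suc n')) \<le> C * (lam + 1 / real (Suc n))" using C0 by (intro mult_left_mono) auto
    then show "S n \<subseteq> S n'" unfolding S_def by auto
  qed
  then have "emeasure lebesgue (\<Union>n. S n) = (SUP n. emeasure lebesgue (S n))"
    using SUP_emeasure_incseq[of S lebesgue] Ss by (metis image_subsetI)
  also have "\<dots> \<le> ennreal (\<epsilon> * l ^ CARD('n))"
    unfolding S_def C_def using lam_nonneg
    by (intro SUP_least weak_type_aux[OF \<beta> A]) (auto intro: add_nonneg_pos)
  finally have "emeasure lebesgue (\<Union>n. S n) \<le> ennreal (\<epsilon> * l ^ CARD('n))" .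
  moreover have "{x \<in> marc_good A. C * lam < cmod (T f1 x)} \<subseteq> (\<Union>n. S n)"
  proof
    fix x assume x: "x \<in> {x \<in> marc_good A. C * lam < cmod (T f1 x)}"
    then have "0 < (cmod (T f1 x) - C * lam) / C" using C0 by simp
    then obtain n where "inverse (real (Suc n)) < (cmod (T f1 x) - C * lam) / C" using reals_Archimedean by blast
    then have "C * (lam + 1 / real (Suc n)) < cmod (T f1 x)"
      using C0 by (simp add: inverse_eq_divide pos_less_divide_eq algebra_simps)
    then show "x \<in> (\<Union>n. S n)" using x by (auto simp: S_def)
  qed
  ultimately show ?thesis
    unfolding C_def[symmetric] using Ss
    by (meson emeasure_mono order_trans sets.countable_UN image_subsetI)
qed

end

section \<open>The local estimate in a single cube\<close>

context cz_op
begin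

lemma rr: "0 < rr" "8 * rr = (1 / 2) ^ (CARD('n) + 3)" "8 * rr < 1"
proof -
  show "0 < rr" by (simp add: rr_def)
  show e: "8 * rr = (1 / 2) ^ (CARD('n) + 3)" by (simp add: rr_def power_add power_one_over)
  have "(1 / 2 :: real) ^ (CARD('n) + 3) \<le> (1 / 2) ^ 1" by (intro power_decreasing) auto
  then show "8 * rr < 1" unfolding e by simp
qed

definition T_loc :: "(real^'n \<Rightarrow> complex) \<Rightarrow> real^'n \<Rightarrow> real \<Rightarrow> real^'n \<Rightarrow> complex" where
  "T_loc f a l = T (\<lambda>y. f y * of_real (eta m a l y))"

definition quant :: "(real^'n \<Rightarrow> complex) \<Rightarrow> (real^'n) set \<Rightarrow> real" where
  "quant f Q = Pr rr Q (maxf m \<delta> (triple Q) f)"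

text \<open>An oscillation counterpart of a bound for a grand maximal truncation: over every cube
  the truncated integrals are compared with the one at a base point in G, instead of being bounded
  outright.\<close>

definition osc_ok :: "(real^'n \<Rightarrow> complex) \<Rightarrow> real^'n \<Rightarrow> real \<Rightarrow> real \<Rightarrow> (real^'n) set \<Rightarrow> bool" where
  "osc_ok f a l M G \<longleftrightarrow> (\<forall>b p x x'. p > 0 \<longrightarrow> x \<in> cube_of b p \<longrightarrow> x' \<in> cube_of b p \<longrightarrow> x' \<in> G \<longrightarrow>
     cmod (\<integral>y. (Kt b p x y - Kt b p x' y) * (f y * of_real (eta m a l y)) \<partial>lebesgue) \<le> M)"

text \<open>C depends on T but not on f or the cube. The thresholds A and \<beta> are fixed
  beforehand so large that the Marcinkiewicz and the weak type exceptional sets cost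
  \<open>rr\<close> each, which leaves \<open>rr\<close> itself a function of the dimension.\<close>

lemma local_estimate:
  "\<exists>C\<ge>0. \<forall>f a l. Linfc f \<longrightarrow> l > 0 \<longrightarrow> 0 \<le> quant f (cube_of a l) \<and>
     (\<exists>G\<in>sets lebesgue. G \<subseteq> cube_of a l \<and>
        emeasure lebesgue (cube_of a l - G) \<le> ennreal (8 * rr * l ^ CARD('n)) \<and>
        (\<forall>x\<in>G. cmod (T_loc f a l x) \<le> C * quant f (cube_of a l)) \<and>
        osc_ok f a l (C * quant f (cube_of a l)) G)"
proof -
  obtain Csk where Csk: "Csk \<ge> 1" "\<And>b p x x'. p > 0 \<Longrightarrow> x \<in> cube_of b p \<Longrightarrow> x' \<in> cube_of b p \<Longrightarrow> sk x' Csk (Kt b p x)"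
    using sk_Kt_exists by blast
  \<comment> \<open>The summand 1, here and in \<beta>, keeps the threshold positive even if the
    quotient is 0.\<close>
  define A where "A = Cmarc / rr + 1"
  have Cm0: "0 \<le> Cmarc" using Ctail_nonneg by (simp add: Cmarc_def)
  have A: "A > 0" "Cmarc / A \<le> rr" using Cm0 rr(1) by (auto simp: A_def field_simps add_nonneg_pos)
  define g where "g = B^2 * Cgood^2 * 4 ^ CARD('n)"
  define \<beta> where "\<beta> = sqrt (g / rr) + 1"
  have g0: "0 \<le> g" by (simp add: g_def)
  have \<beta>: "\<beta> > 0" "g / \<beta>^2 \<le> rr"
  proof -
    have s0: "0 \<le> sqrt (g / rr)" using g0 rr(1) by simp
    then show "\<beta> > 0" unfolding \<beta>_def by linarith
    have "(sqrt (g / rr))^2 \<le> \<beta>^2" unfolding \<beta>_def using s0 by (intro power_mono) auto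
    then have "g / rr \<le> \<beta>^2" using g0 rr(1) by simp
    then show "g / \<beta>^2 \<le> rr" using \<open>\<beta> > 0\<close> rr(1) by (simp add: field_simps)
  qed
  define C1 where "C1 = Cbk A + 2 * \<beta>"
  define C2 where "C2 = 2 * (Cbad * Csk * A) + CK * (4 * real CARD('n)) ^ (CARD('n) + m + 1) * (Ctail * 2) * Cgood"
  define C where "C = max 0 (max C1 C2)"
  have main: "0 \<le> quant f Q \<and> (\<exists>G\<in>sets lebesgue. G \<subseteq> Q \<and>
        emeasure lebesgue (Q - G) \<le> ennreal (8 * rr * l ^ CARD('n)) \<and>
        (\<forall>x\<in>G. cmod (T_loc f a l x) \<le> C * quant f Q) \<and> osc_ok f a l (C * quant f Q) G)"
    if f: "Linfc f" and l: "l > 0" and Q: "Q = cube_of a l" for f a l Q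
  proof -
    define q where "q = l ^ CARD('n)"
    have q: "q > 0" using l by (simp add: q_def)
    let ?M = "maxf m \<delta> (triple Q) f"
    define lam where "lam = quant f Q"
    obtain M where M: "M \<ge> 0" "\<And>y. cmod (f y) \<le> M" using Linfc_bound[OF f] by blast
    have "?M x \<le> M" for x
      using maxf_le[of "3 * l" "a - (\<chi> i. l)" "triple Q" M f] M l by (simp add: Q triple_cube)
    then obtain E where E: "E \<in> sets lebesgue" "{x \<in> Q. ?M x > lam} \<subseteq> E" "emeasure lebesgue E \<le> ennreal (2 * rr * q)"
      using quantile_exceptional_set[OF l rr(1), of a ?M M] unfolding lam_def quant_def Q q_def by blast
    have Qs: "Q \<in> sets lebesgue" "emeasure lebesgue Q = ennreal q" using l emeasure_cube[of l a] by (auto simp: Q q_def)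
    have "Q - E \<in> sets lebesgue" using Qs E by blast
    \<comment> \<open>A closed set is required, because the decomposition lives on the distance from
      F; the loss is one more \<open>rr\<close>.\<close>
    from sets_lebesgue_inner_closed[OF this, of "rr * q"] rr(1) q
    obtain F where F: "closed F" "F \<subseteq> Q - E" "(Q - E) - F \<in> lmeasurable" "emeasure lebesgue ((Q - E) - F) < ennreal (rr * q)"
      by (metis mult_pos_pos)
    have Fs: "F \<in> sets lebesgue" using borel_closed[OF F(1)] by (simp add: sets_completionI_sets)
    have QF: "emeasure lebesgue (Q - F) \<le> ennreal (3 * rr * q)"
    proof -
      have "emeasure lebesgue (Q - F) \<le> emeasure lebesgue (E \<union> ((Q - E) - F))"
        using E(1) F(3) by (intro emeasure_mono) (auto simp: fmeasurable_def)
      also have "\<dots> \<le> emeasure lebesgue E + emeasure lebesgue ((Q - E) - F)"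
        using E(1) F(3) by (intro emeasure_subadditive) (auto simp: fmeasurable_def)
      also have "\<dots> \<le> ennreal (2 * rr * q) + ennreal (rr * q)" using E(3) F(4) by (intro add_mono) auto
      also have "\<dots> = ennreal (3 * rr * q)" using rr(1) q by (simp add: ennreal_plus[symmetric] algebra_simps)
      finally show ?thesis .
    qed
    have "F \<noteq> {}"
    proof
      assume "F = {}"
      then have "ennreal q \<le> ennreal (3 * rr * q)" using QF Qs(2) by simp
      then have "q \<le> 3 * rr * q" using q rr(1) by (subst (asm) ennreal_le_iff) auto
      then have "1 \<le> 3 * rr" using q by simp
      then show False using rr by linarith
    qed
    have lamF: "?M z \<le> lam" if "z \<in> F" for z using that F(2) E(2) by force
    interpret D: cz_decomp_op m \<delta> CK K T B f a l F lam
      by unfold_locales (use f l F \<open>F \<noteq> {}\<close> lamF in \<open>auto simp: Q\<close>)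
    let ?S = "{x \<in> D.marc_good A. C1 * lam < cmod (T D.f1 x)}"
    define G where "G = D.marc_good A - ?S"
    have TD: "T D.f1 = T_loc f a l" by (simp add: T_loc_def D.f1_def[abs_def])
    have Ss: "?S \<in> sets lebesgue"
    proof -
      have "{x. C1 * lam < cmod (T D.f1 x)} \<in> sets lebesgue"
        using borel_measurable_less[OF borel_measurable_const measurable_compose[OF T_measurable[OF L2_Linfc[OF D.Linfc_f1]] borel_measurable_norm], of "C1 * lam"]
        by simp
      moreover have "?S = D.marc_good A \<inter> {x. C1 * lam < cmod (T D.f1 x)}" by auto
      ultimately show ?thesis using D.marc_good_sets by simp
    qed
    have Gs: "G \<in> sets lebesgue" unfolding G_def using Ss D.marc_good_sets by blast
    have m1: "emeasure lebesgue (F - D.marc_good A) \<le> ennreal (rr * q)"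
    proof -
      have "Cmarc * q / A \<le> rr * q" using mult_right_mono[OF A(2), of q] q by simp
      then show ?thesis using D.marc_good_measure[OF A(1)] unfolding q_def[symmetric] by (meson ennreal_leI order_trans)
    qed
    have m2: "emeasure lebesgue ?S \<le> ennreal (rr * q)"
      unfolding C1_def q_def by (rule D.weak_type[OF \<beta>(1) \<beta>(2)[unfolded g_def] less_imp_le[OF A(1)]])
    have "emeasure lebesgue (Q - G) \<le> emeasure lebesgue ((Q - F) \<union> (F - D.marc_good A) \<union> ?S)"
      using Qs Fs Ss D.marc_good_sets by (intro emeasure_mono sets.Un sets.Diff) (auto simp: G_def)
    also have "\<dots> \<le> (emeasure lebesgue (Q - F) + emeasure lebesgue (F - D.marc_good A)) + emeasure lebesgue ?S"
      using Qs Fs Ss D.marc_good_sets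
      by (intro order_trans[OF emeasure_subadditive] add_right_mono emeasure_subadditive sets.Un sets.Diff)
    also have "\<dots> \<le> (ennreal (3 * rr * q) + ennreal (rr * q)) + ennreal (rr * q)"
      by (intro add_mono QF m1 m2)
    \<comment> \<open>Two shares for the quantile cover and one each for closedness, the
      Marcinkiewicz integral and the weak type bound; 8 is the next power of two.\<close>
    also have "\<dots> = ennreal (5 * rr * q)" using rr(1) q by (simp add: ennreal_plus[symmetric] algebra_simps)
    also have "\<dots> \<le> ennreal (8 * rr * q)" using rr(1) q by (intro ennreal_leI) auto
    finally have mG: "emeasure lebesgue (Q - G) \<le> ennreal (8 * rr * l ^ CARD('n))" by (simp add: q_def)
    have lam0: "0 \<le> lam" by (rule D.lam_nonneg)
    have GQ: "G \<subseteq> Q" using F(2) by (auto simp: G_def D.marc_good_def)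
    have "\<forall>x\<in>G. cmod (T_loc f a l x) \<le> C * lam"
    proof
      fix x assume "x \<in> G"
      then have "cmod (T_loc f a l x) \<le> C1 * lam" unfolding G_def TD[symmetric] by auto
      also have "\<dots> \<le> C * lam" using lam0 by (intro mult_right_mono) (auto simp: C_def)
      finally show "cmod (T_loc f a l x) \<le> C * lam" .
    qed
    moreover have "osc_ok f a l (C * lam) G"
      unfolding osc_ok_def
    proof (intro allI impI)
      fix b p x x' assume p: "0 < p" and x: "x \<in> cube_of b p" and x': "x' \<in> cube_of b p" and xG: "x' \<in> G"
      have "cmod (\<integral>y. (Kt b p x y - Kt b p x' y) * D.f1 y \<partial>lebesgue) \<le> C2 * lam"
        unfolding C2_def by (rule D.oscillation[OF p x x']) (use xG Csk p x' in \<open>auto simp: G_def\<close>)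
      also have "\<dots> \<le> C * lam" using lam0 by (intro mult_right_mono) (auto simp: C_def)
      finally show "cmod (\<integral>y. (Kt b p x y - Kt b p x' y) * (f y * of_real (eta m a l y)) \<partial>lebesgue) \<le> C * lam"
        by (simp add: D.f1_def)
    qed
    ultimately show ?thesis using Gs GQ mG lam0 unfolding lam_def by blast
  qed
  show ?thesis
    by (rule exI[of _ C]) (use main in \<open>auto simp: C_def\<close>)
qed

end

subsection \<open>Dyadic cubes\<close>

definition dyc :: "real^'n \<Rightarrow> real \<Rightarrow> nat \<Rightarrow> ('n \<Rightarrow> nat) \<Rightarrow> (real^'n) set" where
  "dyc a l k j = cube_of (a + (l / 2^k) *\<^sub>R (\<chi> i. real (j i))) (l / 2^k)"

lemma dyadic_sub_cube:
  assumes "l > 0"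
  shows "dyadic_sub (cube_of (a::real^'n) l) = {dyc a l k j | k j. \<forall>i. j i < 2^k}"
proof
  show "dyadic_sub (cube_of a l) \<subseteq> {dyc a l k j | k j. \<forall>i. j i < 2^k}"
  proof
    fix P assume "P \<in> dyadic_sub (cube_of a l)"
    then obtain a' l' k j where H: "l' > 0" "cube_of a l = cube_of a' l'" "\<forall>i. j i < 2^k"
      "P = cube_of (a' + (l' / 2^k) *\<^sub>R (\<chi> i. real (j i))) (l' / 2^k)"
      unfolding dyadic_sub_def by blast
    have "a = a' \<and> l = l'" using cube_inj[OF H(2) assms H(1)] .
    then show "P \<in> {dyc a l k j | k j. \<forall>i. j i < 2^k}" using H(3,4) unfolding dyc_def by blast
  qed
  show "{dyc a l k j | k j. \<forall>i. j i < 2^k} \<subseteq> dyadic_sub (cube_of a l)"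
    unfolding dyadic_sub_def dyc_def using assms by blast
qed

lemma mem_dyc: "x \<in> dyc a l k j \<longleftrightarrow> (\<forall>i. a $ i + l / 2^k * real (j i) \<le> x $ i \<and> x $ i < a $ i + l / 2^k * (real (j i) + 1))"
  by (simp add: dyc_def mem_cube distrib_left add.assoc)

lemma mem_dyc_iff:
  assumes "l > 0"
  shows "x \<in> dyc a l k j \<longleftrightarrow> (\<forall>i. real (j i) \<le> (x $ i - a $ i) / (l / 2^k) \<and> (x $ i - a $ i) / (l / 2^k) < real (j i) + 1)"
proof -
  define h where "h = l / 2^k"
  have h: "h > 0" using assms by (simp add: h_def)
  have "a $ i + h * real (j i) \<le> x $ i \<longleftrightarrow> real (j i) \<le> (x $ i - a $ i) / h"
    "x $ i < a $ i + h * (real (j i) + 1) \<longleftrightarrow> (x $ i - a $ i) / h < real (j i) + 1" for i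
    using h by (auto simp: pos_le_divide_eq pos_divide_less_eq mult.commute)
  then show ?thesis unfolding mem_dyc h_def[symmetric] by simp
qed

lemma dyc_unique:
  assumes "l > 0" "x \<in> dyc a l k j" "x \<in> dyc a l k j'"
  shows "j = j'"
proof
  fix i
  have "real (j i) < real (j' i) + 1" "real (j' i) < real (j i) + 1"
    using assms(2,3) unfolding mem_dyc_iff[OF assms(1)] by (meson le_less_trans)+
  then show "j i = j' i" by linarith
qed

lemma dyc_exists:
  assumes "l > 0" "x \<in> cube_of a l"
  shows "\<exists>j. (\<forall>i. j i < 2^k) \<and> x \<in> dyc a l k j"
proof -
  define h where "h = l / 2^k"
  have h: "h > 0" "l = 2^k * h" using assms(1) by (auto simp: h_def)
  define u where "u i = (x $ i - a $ i) / h" for i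
  have u: "0 \<le> u i" "u i < 2^k" for i
    using assms(2)[unfolded mem_cube, rule_format, of i] h by (auto simp: u_def pos_divide_less_eq)
  define j where "j i = nat \<lfloor>u i\<rfloor>" for i
  have j: "real (j i) \<le> u i" "u i < real (j i) + 1" for i
    using u(1)[of i] unfolding j_def by (simp_all add: of_nat_nat)
  have "j i < 2^k" for i
  proof -
    have "real (j i) < 2^k" using j(1)[of i] u(2)[of i] by (rule le_less_trans)
    then show ?thesis by (metis of_nat_less_iff of_nat_numeral of_nat_power)
  qed
  moreover have "x \<in> dyc a l k j"
    unfolding mem_dyc_iff[OF assms(1)] h_def[symmetric] using j by (simp add: u_def)
  ultimately show ?thesis by blast
qed

text \<open>Written on the finer grid, the common point gives strict inequalities between integer
  endpoints; integrality sharpens them to the inclusion.\<close>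

lemma dyc_nested:
  assumes l: "l > 0" and x: "x \<in> dyc a l k j" "x \<in> dyc a l k' j'" and k: "k \<le> k'"
  shows "dyc a l k' j' \<subseteq> dyc a l k j"
proof
  define e :: nat where "e = 2 ^ (k' - k)"
  define h' where "h' = l / 2^k'"
  have h': "h' > 0" using l by (simp add: h'_def)
  obtain i where "k' = k + i" using k le_Suc_ex by blast
  then have h: "l / 2^k = real e * h'"
    by (simp add: e_def h'_def power_add)
  have e: "e > 0" by (simp add: e_def)
  have le: "e * j i \<le> j' i" "j' i + 1 \<le> e * (j i + 1)" for i
  proof -
    define t where "t = x $ i - a $ i"
    have 1: "real e * h' * real (j i) \<le> t" "t < real e * h' * (real (j i) + 1)"
      using x(1)[unfolded mem_dyc h, rule_format, of i] by (auto simp: t_def)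
    have 2: "h' * real (j' i) \<le> t" "t < h' * (real (j' i) + 1)"
      using x(2)[unfolded mem_dyc h'_def[symmetric], rule_format, of i] by (auto simp: t_def)
    have "h' * (real e * real (j i)) < h' * (real (j' i) + 1)" using 1 2 by (simp add: mult_ac)
    then have "real (e * j i) < real (j' i + 1)" using h' by simp
    then show "e * j i \<le> j' i" by linarith
    have "h' * real (j' i) < h' * real (e * (j i + 1))" using 1 2 by (simp add: algebra_simps)
    then have "real (j' i) < real (e * (j i + 1))" by (rule mult_left_less_imp_less) (use h' in simp)
    then show "j' i + 1 \<le> e * (j i + 1)" by linarith
  qed
  fix y assume y: "y \<in> dyc a l k' j'"
  show "y \<in> dyc a l k j"
    unfolding mem_dyc h
  proof (intro allI conjI)
    fix i
    have yi: "a $ i + h' * real (j' i) \<le> y $ i" "y $ i < a $ i + h' * (real (j' i) + 1)"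
      using y[unfolded mem_dyc h'_def[symmetric], rule_format, of i] by auto
    have "real (e * j i) \<le> real (j' i)" using le(1)[of i] by (simp only: of_nat_le_iff)
    then have "h' * real (e * j i) \<le> h' * real (j' i)" using h' by (intro mult_left_mono) auto
    then show "a $ i + real e * h' * real (j i) \<le> y $ i" using yi(1) by (simp add: mult_ac)
    have "real (j' i + 1) \<le> real (e * (j i + 1))" using le(2)[of i] by (simp only: of_nat_le_iff)
    then have "h' * real (j' i + 1) \<le> h' * real (e * (j i + 1))" using h' by (intro mult_left_mono) auto
    then show "y $ i < a $ i + real e * h' * (real (j i) + 1)" using yi(2) by (simp add: algebra_simps)
  qed
qed

lemma dyc_0: "dyc a l 0 j = cube_of a l" if "\<forall>i. j i < 2^0"
proof -
  have "j i = 0" for i using that by simp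
  then show ?thesis by (auto simp: set_eq_iff mem_dyc mem_cube)
qed

lemma dyc_subset:
  assumes "l > 0" "\<forall>i. j i < 2^k"
  shows "dyc a l k j \<subseteq> cube_of a l"
proof
  fix x assume x: "x \<in> dyc a l k j"
  define h where "h = l / 2^k"
  have h: "h > 0" "2^k * h = l" using assms(1) by (auto simp: h_def)
  show "x \<in> cube_of a l" unfolding mem_cube
  proof
    fix i
    have "a $ i + h * real (j i) \<le> x $ i" "x $ i < a $ i + h * (real (j i) + 1)"
      using x[unfolded mem_dyc h_def[symmetric], rule_format, of i] by auto
    moreover have "real (j i) + 1 \<le> 2^k"
    proof -
      have "j i + 1 \<le> 2^k" using assms(2) by (simp add: Suc_leI)
      then have "real (j i + 1) \<le> real (2^k)" by (simp only: of_nat_le_iff)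
      then show ?thesis by simp
    qed
    then have "h * (real (j i) + 1) \<le> h * 2^k" using h by (intro mult_left_mono) auto
    moreover have "0 \<le> h * real (j i)" using h by simp
    ultimately show "a $ i \<le> x $ i \<and> x $ i < a $ i + l" using h(2) by (simp add: mult.commute)
  qed
qed

lemma countable_dyadic_sub: "l > 0 \<Longrightarrow> countable (dyadic_sub (cube_of (a::real^'n) l))"
proof -
  assume "l > 0"
  then have "dyadic_sub (cube_of a l) \<subseteq> (\<lambda>(k, j). dyc a l k j) ` (UNIV :: (nat \<times> ('n \<Rightarrow> nat)) set)"
    by (auto simp: dyadic_sub_cube)
  then show ?thesis using countable_subset countable_image uncountable_def by (metis countableI_type)
qed

lemma dyadic_sub_trans:
  assumes l: "l > 0" and Q: "Q \<in> dyadic_sub (cube_of (a::real^'n) l)" and P: "P \<in> dyadic_sub Q"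
  shows "P \<in> dyadic_sub (cube_of a l)"
proof -
  obtain k j where Q: "Q = dyc a l k j" "\<forall>i. j i < 2^k" using Q by (auto simp: dyadic_sub_cube[OF l])
  define b where "b = a + (l / 2^k) *\<^sub>R (\<chi> i. real (j i))"
  have h: "l / 2^k > 0" using l by simp
  have "P \<in> dyadic_sub (cube_of b (l / 2^k))" using P by (simp add: Q dyc_def b_def)
  then obtain k' j' where P: "P = dyc b (l / 2^k) k' j'" "\<forall>i. j' i < 2^k'" by (auto simp: dyadic_sub_cube[OF h])
  define j'' where "j'' i = 2^k' * j i + j' i" for i
  have "P = dyc a l (k + k') j''"
    unfolding P dyc_def b_def j''_def
    by (rule arg_cong2[where f = cube_of]) (auto simp: vec_eq_iff power_add field_simps)
  moreover have "j'' i < 2^(k + k')" for i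
  proof -
    have "j'' i < 2^k' * (j i + 1)" using P(2) by (simp add: j''_def)
    also have "\<dots> \<le> 2^k' * 2^k" using Q(2) by (intro mult_le_mono2) (simp add: Suc_leI)
    finally show ?thesis by (simp add: power_add mult.commute)
  qed
  ultimately show ?thesis unfolding dyadic_sub_cube[OF l] by blast
qed

lemma dyadic_strict:
  assumes l: "l > 0" and P: "P \<in> dyadic_sub (cube_of (a::real^'n) l)" "P \<noteq> cube_of a l"
  obtains b p where "p > 0" "P = cube_of b p" "p \<le> l / 2" "\<And>i. a $ i \<le> b $ i \<and> b $ i + p \<le> a $ i + l"
proof -
  obtain k j where k: "P = dyc a l k j" "\<forall>i. j i < 2^k" using P(1) by (auto simp: dyadic_sub_cube[OF l])
  have "k \<noteq> 0" using P(2) k dyc_0[of j a l] by auto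
  then have "(2::real)^1 \<le> 2^k" by (intro power_increasing) auto
  then have "l / 2^k \<le> l / 2" using l by (intro divide_left_mono) auto
  moreover have "a $ i \<le> (a + (l / 2^k) *\<^sub>R (\<chi> i. real (j i))) $ i \<and> (a + (l / 2^k) *\<^sub>R (\<chi> i. real (j i))) $ i + l / 2^k \<le> a $ i + l" for i
  proof -
    have "j i + 1 \<le> 2^k" using k(2) by (simp add: Suc_leI)
    then have "real (j i + 1) \<le> real (2^k)" by (simp only: of_nat_le_iff)
    then have "l / 2^k * (real (j i) + 1) \<le> l / 2^k * 2^k" using l by (intro mult_left_mono) auto
    then show ?thesis using l by (simp add: distrib_left)
  qed
  ultimately show ?thesis using that[of "l / 2^k"] k(1) l unfolding dyc_def by auto
qed

lemma emeasure_dyc: "l > 0 \<Longrightarrow> emeasure lebesgue (dyc a l k j) = ennreal ((l / 2^k) ^ CARD('n))" for a :: "real^'n"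
  unfolding dyc_def by (rule emeasure_cube) simp

lemma sets_dyc: "dyc a l k j \<in> sets lebesgue"
  unfolding dyc_def by (rule lebesgue_cube)

lemma half_power_ennreal: "(1/2 :: ennreal) ^ n = ennreal ((1/2) ^ n)"
proof -
  have e: "(1/2 :: ennreal) = ennreal (1/2)" using divide_ennreal[of 1 2] by simp
  show ?thesis unfolding e by (rule ennreal_power) simp
qed

subsection \<open>Selection of the stopping cubes\<close>

text \<open>The threshold is lowered by \<open>2\<^bsup>-d\<^esup>\<close>: a maximal dense cube \<open>P\<close> then satisfies \<open>|W \<inter> P| \<le> |P| / 2\<close>, because its parent is
  not dense, and so still contains points outside \<open>W\<close>.\<close>

definition dense :: "(real^'n) set \<Rightarrow> (real^'n) set \<Rightarrow> bool" where
  "dense W P \<longleftrightarrow> (1/2) ^ (CARD('n) + 1) * emeasure lebesgue P < emeasure lebesgue (W \<inter> P)"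

definition stop :: "(real^'n) set \<Rightarrow> real^'n \<Rightarrow> real \<Rightarrow> (real^'n) set set" where
  "stop W a l = {dyc a l k j | k j. (\<forall>i. j i < 2^k) \<and> dense W (dyc a l k j) \<and>
     (\<forall>k' j'. k' < k \<longrightarrow> (\<forall>i. j' i < 2^k') \<longrightarrow> dyc a l k j \<subseteq> dyc a l k' j' \<longrightarrow> \<not> dense W (dyc a l k' j'))}"

lemma stop_sub: "l > 0 \<Longrightarrow> stop W a l \<subseteq> dyadic_sub (cube_of (a::real^'n) l)"
  by (auto simp: stop_def dyadic_sub_cube)

lemma stop_disjoint:
  assumes l: "l > 0" and P: "P \<in> stop W a l" "P' \<in> stop W a l" and x: "x \<in> P" "x \<in> P'"
  shows "P = P'"
proof -
  obtain k j where k: "P = dyc a l k j" "\<forall>i. j i < 2^k" "dense W P"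
    "\<And>k' j'. k' < k \<Longrightarrow> (\<forall>i. j' i < 2^k') \<Longrightarrow> P \<subseteq> dyc a l k' j' \<Longrightarrow> \<not> dense W (dyc a l k' j')"
    using P(1) unfolding stop_def by blast
  obtain k' j' where k': "P' = dyc a l k' j'" "\<forall>i. j' i < 2^k'" "dense W P'"
    "\<And>k'' j''. k'' < k' \<Longrightarrow> (\<forall>i. j'' i < 2^k'') \<Longrightarrow> P' \<subseteq> dyc a l k'' j'' \<Longrightarrow> \<not> dense W (dyc a l k'' j'')"
    using P(2) unfolding stop_def by blast
  consider "k < k'" | "k' < k" | "k = k'" by linarith
  then show ?thesis
  proof cases
    case 1
    then show ?thesis using k'(4)[of k j] k dyc_nested[OF l, of x a k j k' j'] x k'(1) by auto
  next
    case 2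
    then show ?thesis using k(4)[of k' j'] k' dyc_nested[OF l, of x a k' j' k j] x k(1) by auto
  next
    case 3
    then show ?thesis using dyc_unique[OF l, of x a k j j'] x k(1) k'(1) by simp
  qed
qed

text \<open>Since W is open, a small enough dyadic cube about x lies inside W and is therefore
  dense. The smallest generation in the chain of dyadic cubes about x that is dense is a stopping
  cube. Thus every point of W is covered, not merely almost every one.\<close>

lemma stop_cover:
  fixes a :: "real^'n"
  assumes l: "l > 0" and W: "open W" and x: "x \<in> W" "x \<in> cube_of a l"
  shows "\<exists>P\<in>stop W a l. x \<in> P"
proof -
  define d where "d = real CARD('n)"
  obtain e where e: "e > 0" "ball x e \<subseteq> W" using W x(1) open_contains_ball by blast
  define jj where "jj k = (SOME j. (\<forall>i. j i < 2^k) \<and> x \<in> dyc a l k j)" for k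
  have jj: "\<forall>i. jj k i < 2^k" "x \<in> dyc a l k (jj k)" for k
    using someI_ex[OF dyc_exists[OF l x(2), of k]] unfolding jj_def by auto
  have "(\<lambda>k. d * (l * inverse (2^k))) \<longlonglongrightarrow> d * (l * 0)"
    by (intro tendsto_mult tendsto_const LIMSEQ_inverse_realpow_zero) auto
  then have "(\<lambda>k. d * (l * inverse (2^k))) \<longlonglongrightarrow> 0" by simp
  then have "eventually (\<lambda>k. d * (l * inverse (2^k)) < e) sequentially" using e(1) by (rule order_tendstoD)
  then obtain K where K: "d * (l / 2^K) < e" by (auto simp: eventually_sequentially divide_inverse)
  have "dyc a l K (jj K) \<subseteq> W"
  proof
    fix y assume "y \<in> dyc a l K (jj K)"
    then have "dist x y \<le> d * (l / 2^K)"
      using jj(2)[of K] unfolding dyc_def d_def by (intro dist_cube)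
    then show "y \<in> W" using K e(2) by auto
  qed
  then have "W \<inter> dyc a l K (jj K) = dyc a l K (jj K)" by blast
  moreover have "(1/2) ^ (CARD('n) + 1) * ennreal q < ennreal q" if "q > 0" for q
  proof -
    have lt: "(1/2::real) ^ (CARD('n) + 1) < 1" by (intro power_Suc_less_one[of "1/2", unfolded Suc_eq_plus1]) auto
    have "(1/2) ^ (CARD('n) + 1) * ennreal q = ennreal ((1/2) ^ (CARD('n) + 1) * q)"
      unfolding half_power_ennreal using that by (subst ennreal_mult) auto
    also have "\<dots> < ennreal q" using lt that by (intro ennreal_lessI) auto
    finally show ?thesis .
  qed
  ultimately have "dense W (dyc a l K (jj K))"
    unfolding dense_def using l by (simp only: emeasure_dyc) simp
  then obtain k where k: "dense W (dyc a l k (jj k))" "\<And>k'. k' < k \<Longrightarrow> \<not> dense W (dyc a l k' (jj k'))"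
    using exists_least_iff[of "\<lambda>k. dense W (dyc a l k (jj k))"] by blast
  have "dyc a l k (jj k) \<in> stop W a l"
    unfolding stop_def mem_Collect_eq
  proof (rule exI[of _ k], rule exI[of _ "jj k"], intro conjI refl jj(1) k(1) allI impI)
    fix k' j' assume k': "k' < k" "\<forall>i. j' i < 2^k'" "dyc a l k (jj k) \<subseteq> dyc a l k' j'"
    then have "x \<in> dyc a l k' j'" using jj(2) by blast
    then have "j' = jj k'" using dyc_unique[OF l _ jj(2)] by blast
    then show "\<not> dense W (dyc a l k' j')" using k(2)[OF k'(1)] by simp
  qed
  then show ?thesis using jj(2) by blast
qed

text \<open>The stopping cubes are disjoint and each is at most 2^(d+1) times its part in W, so
  their union has measure at most 2^(d+1) |W \<inter> Q| \<le> |Q|/2.\<close>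

lemma stop_measure:
  fixes a :: "real^'n"
  assumes l: "l > 0" and W: "open W" and m: "emeasure lebesgue (W \<inter> cube_of a l) \<le> ennreal ((1/2) ^ (CARD('n) + 2) * l ^ CARD('n))"
  shows "emeasure lebesgue (\<Union>(stop W a l)) \<le> ennreal (1/2 * l ^ CARD('n))"
proof -
  let ?c = "(2::ennreal) ^ (CARD('n) + 1)"
  have cnt: "countable (stop W a l)" using stop_sub[OF l] countable_dyadic_sub[OF l] countable_subset by blast
  have s: "P \<in> sets lebesgue" if "P \<in> stop W a l" for P using that sets_dyc by (auto simp: stop_def)
  have Ws: "W \<in> sets lebesgue" using W by (simp add: borel_open sets_completionI_sets)
  have dis: "disjoint_family_on (\<lambda>P. P) (stop W a l)"
    unfolding disjoint_family_on_def using stop_disjoint[OF l] by blast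
  have dis': "disjoint_family_on (\<lambda>P. W \<inter> P) (stop W a l)"
    using dis unfolding disjoint_family_on_def by blast
  have c1: "?c * (1/2) ^ (CARD('n) + 1) = 1"
    unfolding half_power_ennreal
    by (subst ennreal_numeral[symmetric], subst ennreal_power, simp, subst ennreal_mult[symmetric]) (auto simp flip: power_mult_distrib)
  have "emeasure lebesgue (\<Union>(stop W a l)) = (\<integral>\<^sup>+P. emeasure lebesgue P \<partial>count_space (stop W a l))"
    using emeasure_UN_countable[OF s cnt dis] by simp
  also have "\<dots> \<le> (\<integral>\<^sup>+P. ?c * emeasure lebesgue (W \<inter> P) \<partial>count_space (stop W a l))"
  proof (rule nn_integral_mono)
    fix P assume "P \<in> space (count_space (stop W a l))"
    then have "dense W P" by (auto simp: stop_def)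
    then have "?c * ((1/2) ^ (CARD('n) + 1) * emeasure lebesgue P) \<le> ?c * emeasure lebesgue (W \<inter> P)"
      unfolding dense_def by (intro mult_left_mono) auto
    then show "emeasure lebesgue P \<le> ?c * emeasure lebesgue (W \<inter> P)"
      unfolding mult.assoc[symmetric] c1 by simp
  qed
  also have "\<dots> = ?c * (\<integral>\<^sup>+P. emeasure lebesgue (W \<inter> P) \<partial>count_space (stop W a l))"
    by (rule nn_integral_cmult) simp
  also have "(\<integral>\<^sup>+P. emeasure lebesgue (W \<inter> P) \<partial>count_space (stop W a l)) = emeasure lebesgue (\<Union>P\<in>stop W a l. W \<inter> P)"
    using s Ws by (intro emeasure_UN_countable[OF _ cnt dis', symmetric]) auto
  also have "\<dots> \<le> emeasure lebesgue (W \<inter> cube_of a l)"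
  proof (rule emeasure_mono)
    have "P \<subseteq> cube_of a l" if "P \<in> stop W a l" for P using that dyc_subset[OF l] unfolding stop_def by blast
    then show "(\<Union>P\<in>stop W a l. W \<inter> P) \<subseteq> W \<inter> cube_of a l" by blast
  qed (use Ws in auto)
  also have "\<dots> \<le> ennreal ((1/2) ^ (CARD('n) + 2) * l ^ CARD('n))" by (rule m)
  also have "?c * ennreal ((1/2) ^ (CARD('n) + 2) * l ^ CARD('n)) = ennreal (1/2 * l ^ CARD('n))"
  proof -
    have "?c = ennreal (2 ^ (CARD('n) + 1))" by (subst ennreal_numeral[symmetric], subst ennreal_power) auto
    then have "?c * ennreal ((1/2) ^ (CARD('n) + 2) * l ^ CARD('n)) = ennreal (2 ^ (CARD('n) + 1) * ((1/2) ^ (CARD('n) + 2) * l ^ CARD('n)))"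
      by (simp only:) (rule ennreal_mult[symmetric], use l in auto)
    moreover have "2 ^ (CARD('n) + 1) * ((1/2) ^ (CARD('n) + 2) * l ^ CARD('n)) = 1/2 * l ^ CARD('n)"
      by (simp add: power_add power_one_over)
    ultimately show ?thesis by (simp only:)
  qed
  finally show ?thesis by (simp add: mult_left_mono)
qed

lemma stop_strict:
  fixes a :: "real^'n"
  assumes l: "l > 0" and W: "open W" and m: "emeasure lebesgue (W \<inter> cube_of a l) \<le> ennreal ((1/2) ^ (CARD('n) + 2) * l ^ CARD('n))"
    and P: "P \<in> stop W a l"
  shows "P \<noteq> cube_of a l" and "emeasure lebesgue (W \<inter> P) \<le> ennreal (1/2) * emeasure lebesgue P"
proof -
  obtain k j where k: "P = dyc a l k j" "\<forall>i. j i < 2^k" "dense W P"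
    "\<And>k' j'. k' < k \<Longrightarrow> (\<forall>i. j' i < 2^k') \<Longrightarrow> P \<subseteq> dyc a l k' j' \<Longrightarrow> \<not> dense W (dyc a l k' j')"
    using P unfolding stop_def by blast
  \<comment> \<open>W has density at most 2^-(d+2) in the whole cube, below the threshold 2^-(d+1),
    so generation 0 is never selected.\<close>
  show ne: "P \<noteq> cube_of a l"
  proof
    assume "P = cube_of a l"
    then have "(1/2) ^ (CARD('n) + 1) * emeasure lebesgue (cube_of a l) < ennreal ((1/2) ^ (CARD('n) + 2) * l ^ CARD('n))"
      using order_less_le_trans[OF _ m] k(3) unfolding dense_def by blast
    then have "(1/2) ^ (CARD('n) + 1) * ennreal (l ^ CARD('n)) < ennreal ((1/2) ^ (CARD('n) + 2) * l ^ CARD('n))"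
      using emeasure_cube[of l a] l by (simp only: less_imp_le)
    then have "ennreal ((1/2) ^ (CARD('n) + 1) * l ^ CARD('n)) < ennreal ((1/2) ^ (CARD('n) + 2) * l ^ CARD('n))"
      unfolding half_power_ennreal using l by (subst ennreal_mult) auto
    then have "(1/2) ^ (CARD('n) + 1) * l ^ CARD('n) < (1/2) ^ (CARD('n) + 2) * l ^ CARD('n)"
      using l by (subst (asm) ennreal_less_iff) auto
    then show False using l by simp
  qed
  have "k \<noteq> 0" using ne k(1,2) dyc_0[of j a l] by auto
  then obtain k0 where k0: "k = Suc k0" using not0_implies_Suc by blast
  define j0 where "j0 i = j i div 2" for i
  define b where "b = a + (l / 2^k) *\<^sub>R (\<chi> i. real (j i))"
  have bP: "b \<in> P" using l by (simp add: k(1) dyc_def b_def mem_cube)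
  \<comment> \<open>Halving the index gives the dyadic parent; the corner b of P is the common point
    from which the nesting follows.\<close>
  have j0: "\<forall>i. j0 i < 2^k0"
  proof
    fix i
    have "j i < 2^k0 * 2" using k(2)[rule_format, of i] k0 by (simp add: mult.commute)
    then show "j0 i < 2^k0" unfolding j0_def by (rule less_mult_imp_div_less)
  qed
  have "b \<in> dyc a l k0 j0"
    unfolding mem_dyc
  proof
    fix i
    define h where "h = l / 2^k"
    have h: "h > 0" "l / 2^k0 = 2 * h" using l by (auto simp: h_def k0)
    have "2 * j0 i \<le> j i" "j i + 1 \<le> 2 * (j0 i + 1)" by (auto simp: j0_def)
    then have "real (2 * j0 i) \<le> real (j i)" "real (j i + 1) \<le> real (2 * (j0 i + 1))"
      by (simp_all only: of_nat_le_iff)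
    then have 1: "h * (2 * real (j0 i)) \<le> h * real (j i)" "h * (real (j i) + 1) \<le> h * (2 * (real (j0 i) + 1))"
      using h by (auto intro!: mult_left_mono)
    have 2: "h * real (j i) < h * (real (j i) + 1)" using h by simp
    have "b $ i = a $ i + h * real (j i)" by (simp add: b_def h_def)
    then show "a $ i + l / 2^k0 * real (j0 i) \<le> b $ i \<and> b $ i < a $ i + l / 2^k0 * (real (j0 i) + 1)"
      unfolding h(2) using 1 2 by (simp add: mult_ac)
  qed
  then have sub: "P \<subseteq> dyc a l k0 j0" using dyc_nested[OF l, of b a k0 j0 k j] bP k(1) k0 by simp
  have Ws: "W \<in> sets lebesgue" using W by (simp add: borel_open sets_completionI_sets)
  have "\<not> dense W (dyc a l k0 j0)" using k(4)[of k0 j0] j0 sub k0 by simp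
  then have x1: "emeasure lebesgue (W \<inter> dyc a l k0 j0) \<le> (1/2) ^ (CARD('n) + 1) * emeasure lebesgue (dyc a l k0 j0)"
    unfolding dense_def not_less .
  have x2: "emeasure lebesgue (W \<inter> P) \<le> emeasure lebesgue (W \<inter> dyc a l k0 j0)"
    using sub by (intro emeasure_mono sets.Int Ws sets_dyc) blast
  \<comment> \<open>The parent has volume 2^d |P|, so the threshold 2^-(d+1) leaves exactly half of
    |P|.\<close>
  have x3: "(1/2) ^ (CARD('n) + 1) * emeasure lebesgue (dyc a l k0 j0) = ennreal (1/2) * emeasure lebesgue P"
  proof -
    have "(1/2) ^ (CARD('n) + 1) * emeasure lebesgue (dyc a l k0 j0) = ennreal ((1/2) ^ (CARD('n) + 1) * (l / 2^k0) ^ CARD('n))"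
      unfolding half_power_ennreal emeasure_dyc[OF l] using l by (subst ennreal_mult) auto
    also have "(1/2) ^ (CARD('n) + 1) * (l / 2^k0) ^ CARD('n) = 1/2 * (l / 2^k) ^ CARD('n)"
      by (simp add: k0 power_add power_divide power_mult_distrib)
    also have "ennreal (1/2 * (l / 2^k) ^ CARD('n)) = ennreal (1/2) * emeasure lebesgue P"
      unfolding k(1) emeasure_dyc[OF l] using l by (subst ennreal_mult) auto
    finally show ?thesis .
  qed
  show "emeasure lebesgue (W \<inter> P) \<le> ennreal (1/2) * emeasure lebesgue P"
    by (rule order_trans[OF x2 order_trans[OF x1 eq_refl[OF x3]]])
qed

subsection \<open>Iteration\<close>

text \<open>The recursion with the analysis stripped off: \<open>Fn Q\<close> stands for the size of
  the operator localised to Q and \<open>st Q\<close> for the stopping cubes. The term with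
  \<open>lam P\<close> in \<open>step_in\<close> is present because Q and P are compared through a
  point that is good for both.\<close>

locale sparse_iteration =
  fixes a :: "real^'n" and l :: real and st :: "(real^'n) set \<Rightarrow> (real^'n) set set"
    and lam :: "(real^'n) set \<Rightarrow> real" and Fn :: "(real^'n) set \<Rightarrow> real^'n \<Rightarrow> real" and C :: real
  assumes l: "l > 0" and C: "C \<ge> 0"
    and st_sub: "\<And>Q. Q \<in> dyadic_sub (cube_of a l) \<Longrightarrow> st Q \<subseteq> dyadic_sub (cube_of a l)"
    and st_strict: "\<And>Q P. Q \<in> dyadic_sub (cube_of a l) \<Longrightarrow> P \<in> st Q \<Longrightarrow> P \<subset> Q"
    and st_disj: "\<And>Q P P' x. Q \<in> dyadic_sub (cube_of a l) \<Longrightarrow> P \<in> st Q \<Longrightarrow> P' \<in> st Q \<Longrightarrow> x \<in> P \<Longrightarrow> x \<in> P' \<Longrightarrow> P = P'"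
    and st_meas: "\<And>Q. Q \<in> dyadic_sub (cube_of a l) \<Longrightarrow> emeasure lebesgue (\<Union>(st Q)) \<le> ennreal (1/2) * emeasure lebesgue Q"
    and lam: "\<And>Q. Q \<in> dyadic_sub (cube_of a l) \<Longrightarrow> 0 \<le> lam Q"
    and step_out: "\<And>Q. Q \<in> dyadic_sub (cube_of a l) \<Longrightarrow> AE x in lebesgue. x \<in> Q - \<Union>(st Q) \<longrightarrow> Fn Q x \<le> C * lam Q"
    and step_in: "\<And>Q P. Q \<in> dyadic_sub (cube_of a l) \<Longrightarrow> P \<in> st Q \<Longrightarrow>
        AE x in lebesgue. x \<in> P \<longrightarrow> Fn Q x \<le> Fn P x + C * lam Q + C * lam P"
begin

abbreviation "Q0 \<equiv> cube_of a l"
abbreviation "DD \<equiv> dyadic_sub Q0"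

primrec lev :: "nat \<Rightarrow> (real^'n) set set" where
  "lev 0 = {Q0}"
| "lev (Suc n) = (\<Union>Q\<in>lev n. st Q)"

definition fam :: "(real^'n) set set" where "fam = (\<Union>n. lev n)"

lemma Q0_DD: "Q0 \<in> DD"
proof -
  have "Q0 = dyc a l 0 (\<lambda>_. 0)" by (rule dyc_0[symmetric]) simp
  then show ?thesis unfolding dyadic_sub_cube[OF l] by (intro CollectI exI[of _ 0] exI[of _ "\<lambda>_. 0"]) auto
qed

lemma lev_DD: "lev n \<subseteq> DD"
proof (induction n)
  case 0
  then show ?case using Q0_DD by simp
next
  case (Suc n)
  then show ?case using st_sub by fastforce
qed

lemma DD_sets: "Q \<in> DD \<Longrightarrow> Q \<in> sets lebesgue" and DD_fin: "Q \<in> DD \<Longrightarrow> emeasure lebesgue Q < \<infinity>"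
proof -
  assume "Q \<in> DD"
  then obtain k j where Q: "Q = dyc a l k j" unfolding dyadic_sub_cube[OF l] by blast
  show "Q \<in> sets lebesgue" "emeasure lebesgue Q < \<infinity>"
    unfolding Q by (rule sets_dyc) (subst emeasure_dyc[OF l], simp)
qed

lemma DD_countable: "countable DD" by (rule countable_dyadic_sub[OF l])

lemma st_countable: "Q \<in> DD \<Longrightarrow> countable (st Q)"
  using st_sub DD_countable countable_subset by blast

lemma Un_st_sets: "Q \<in> DD \<Longrightarrow> \<Union>(st Q) \<in> sets lebesgue"
  using st_countable st_sub DD_sets by (intro sets.countable_Union) auto

lemma lev_countable: "countable (lev n)"
  using lev_DD DD_countable countable_subset by blast

lemma lev_disj: "Q \<in> lev n \<Longrightarrow> Q' \<in> lev n \<Longrightarrow> x \<in> Q \<Longrightarrow> x \<in> Q' \<Longrightarrow> Q = Q'"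
proof (induction n arbitrary: Q Q')
  case 0
  then show ?case by simp
next
  case (Suc n)
  obtain R where R: "R \<in> lev n" "Q \<in> st R" using Suc.prems(1) by auto
  obtain R' where R': "R' \<in> lev n" "Q' \<in> st R'" using Suc.prems(2) by auto
  have D: "R \<in> DD" "R' \<in> DD" using R R' lev_DD by auto
  have "x \<in> R" "x \<in> R'" using st_strict[OF D(1) R(2)] st_strict[OF D(2) R'(2)] Suc.prems by auto
  then have "R = R'" using Suc.IH R(1) R'(1) by blast
  then show ?case using st_disj[OF D(1), of Q Q' x] R R' Suc.prems by auto
qed

lemma lev_Un_Suc: "\<Union>(lev (Suc n)) \<subseteq> \<Union>(lev n)"
  using st_strict lev_DD by fastforce

lemma lev_Un_mono: "n \<le> n' \<Longrightarrow> \<Union>(lev n') \<subseteq> \<Union>(lev n)"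
  using lift_Suc_antimono_le[of "\<lambda>n. \<Union>(lev n)"] lev_Un_Suc by blast

lemma lev_sets: "\<Union>(lev n) \<in> sets lebesgue"
  using lev_countable lev_DD DD_sets by (intro sets.countable_Union) auto

lemma lev_measure_Suc: "emeasure lebesgue (\<Union>(lev (Suc n))) \<le> ennreal (1/2) * emeasure lebesgue (\<Union>(lev n))"
proof -
  have dis: "disjoint_family_on (\<lambda>Q. Q) (lev n)" unfolding disjoint_family_on_def using lev_disj by blast
  have dis': "disjoint_family_on (\<lambda>Q. \<Union>(st Q)) (lev n)"
    unfolding disjoint_family_on_def
  proof (intro ballI impI)
    fix Q Q' assume H: "Q \<in> lev n" "Q' \<in> lev n" "Q \<noteq> Q'"
    then have "\<Union>(st Q) \<subseteq> Q" "\<Union>(st Q') \<subseteq> Q'" using st_strict lev_DD by fastforce+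
    then show "\<Union>(st Q) \<inter> \<Union>(st Q') = {}" using lev_disj H by blast
  qed
  have "emeasure lebesgue (\<Union>(lev (Suc n))) = emeasure lebesgue (\<Union>Q\<in>lev n. \<Union>(st Q))"
    by (rule arg_cong[where f = "emeasure lebesgue"]) auto
  also have "\<dots> = (\<integral>\<^sup>+Q. emeasure lebesgue (\<Union>(st Q)) \<partial>count_space (lev n))"
    using Un_st_sets lev_DD by (intro emeasure_UN_countable lev_countable dis') auto
  also have "\<dots> \<le> (\<integral>\<^sup>+Q. ennreal (1/2) * emeasure lebesgue Q \<partial>count_space (lev n))"
    using st_meas lev_DD by (intro nn_integral_mono) auto
  also have "\<dots> = ennreal (1/2) * (\<integral>\<^sup>+Q. emeasure lebesgue Q \<partial>count_space (lev n))"
    by (rule nn_integral_cmult) simp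
  also have "(\<integral>\<^sup>+Q. emeasure lebesgue Q \<partial>count_space (lev n)) = emeasure lebesgue (\<Union>Q\<in>lev n. Q)"
    using DD_sets lev_DD by (intro emeasure_UN_countable[symmetric] lev_countable dis) auto
  finally show ?thesis by simp
qed

lemma lev_measure: "emeasure lebesgue (\<Union>(lev n)) \<le> ennreal ((1/2) ^ n * l ^ CARD('n))"
proof (induction n)
  case 0
  then show ?case using emeasure_cube[of l a] l by simp
next
  case (Suc n)
  have "emeasure lebesgue (\<Union>(lev (Suc n))) \<le> ennreal (1/2) * ennreal ((1/2) ^ n * l ^ CARD('n))"
    using lev_measure_Suc[of n] mult_left_mono[OF Suc, of "ennreal (1/2)"] by (meson order_trans zero_le)
  also have "\<dots> = ennreal (1/2 * ((1/2) ^ n * l ^ CARD('n)))" using l by (intro ennreal_mult[symmetric]) auto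
  finally show ?case by simp
qed

text \<open>The measure of the levels at least halves from one to the next, so the points lying in
  all levels form a null set. Almost every chain of stopping cubes is therefore finite.\<close>

lemma AE_leaves: "AE x in lebesgue. \<exists>n. x \<notin> \<Union>(lev n)"
proof -
  let ?N = "\<Inter>n. \<Union>(lev n)"
  have Ns: "?N \<in> sets lebesgue" using lev_sets by (intro sets.countable_INT) auto
  have le: "emeasure lebesgue ?N \<le> ennreal ((1/2) ^ n * l ^ CARD('n))" for n
    using order_trans[OF emeasure_mono lev_measure[of n]] lev_sets[of n] by (metis INT_lower UNIV_I)
  have "(\<lambda>n. (1/2::real) ^ n * l ^ CARD('n)) \<longlonglongrightarrow> 0 * l ^ CARD('n)"
    by (intro tendsto_mult tendsto_const LIMSEQ_power_zero) auto
  then have "(\<lambda>n. ennreal ((1/2) ^ n * l ^ CARD('n))) \<longlonglongrightarrow> ennreal 0" by (intro tendsto_ennrealI) simp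
  then have "emeasure lebesgue ?N \<le> ennreal 0" by (rule LIMSEQ_le_const) (use le in blast)
  then have "?N \<in> null_sets lebesgue" using Ns by (simp add: null_setsI)
  then show ?thesis by (rule AE_I') auto
qed

text \<open>The disjoint parts are the cubes without their stopping children. For cubes of the same
  level disjointness is that of the level; otherwise a point of the deeper cube lies in a cube of
  the level just below the shallower one, hence in one of the removed children.\<close>

lemma sparse: "half_sparse fam"
  unfolding half_sparse_def
proof (intro exI conjI ballI)
  let ?E = "\<lambda>Q. Q - \<Union>(st Q)"
  fix Q assume "Q \<in> fam"
  then have Q: "Q \<in> DD" using lev_DD by (auto simp: fam_def)
  show "?E Q \<in> sets lebesgue" using DD_sets[OF Q] Un_st_sets[OF Q] by (rule sets.Diff)
  show "?E Q \<subseteq> Q" by blast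
  have sub: "\<Union>(st Q) \<subseteq> Q" using st_strict[OF Q] by blast
  have fin: "emeasure lebesgue (\<Union>(st Q)) \<noteq> \<infinity>" "emeasure lebesgue Q \<noteq> \<infinity>"
    using DD_fin[OF Q] emeasure_mono[OF sub DD_sets[OF Q]] by auto
  have "measure lebesgue (\<Union>(st Q)) \<le> 1/2 * measure lebesgue Q"
  proof -
    have "ennreal (measure lebesgue (\<Union>(st Q))) \<le> ennreal (1/2) * ennreal (measure lebesgue Q)"
      using st_meas[OF Q] emeasure_eq_ennreal_measure[OF fin(1)[unfolded infinity_ennreal_def]] emeasure_eq_ennreal_measure[OF fin(2)[unfolded infinity_ennreal_def]] by metis
    then have "ennreal (measure lebesgue (\<Union>(st Q))) \<le> ennreal (1/2 * measure lebesgue Q)" by (subst ennreal_mult) auto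
    then show ?thesis by (subst (asm) ennreal_le_iff) auto
  qed
  moreover have "measure lebesgue (?E Q) = measure lebesgue Q - measure lebesgue (\<Union>(st Q))"
    using fin DD_sets[OF Q] Un_st_sets[OF Q] sub by (intro measure_Diff) auto
  ultimately show "measure lebesgue (?E Q) \<ge> measure lebesgue Q / 2" by linarith
next
  let ?E = "\<lambda>Q. Q - \<Union>(st Q)"
  have key: "?E Q \<inter> ?E Q' = {}" if Q: "Q \<in> lev n" "Q' \<in> lev n'" "n \<le> n'" "Q \<noteq> Q'" for Q Q' n n'
  proof (rule ccontr)
    assume "?E Q \<inter> ?E Q' \<noteq> {}"
    then obtain x where x: "x \<in> ?E Q" "x \<in> ?E Q'" by blast
    show False
    proof (cases "n = n'")
      case True
      then show False using lev_disj Q x by blast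
    next
      case False
      then have "\<Union>(lev n') \<subseteq> \<Union>(lev (Suc n))" using Q(3) by (intro lev_Un_mono) simp
      then obtain P where P: "P \<in> lev (Suc n)" "x \<in> P" using x(2) Q(2) by blast
      then obtain R where R: "R \<in> lev n" "P \<in> st R" by auto
      then have "x \<in> R" using st_strict[of R P] lev_DD P(2) by blast
      then have "R = Q" using lev_disj R(1) Q(1) x(1) by blast
      then show False using R(2) P(2) x(1) by blast
    qed
  qed
  show "disjoint_family_on ?E fam"
    unfolding disjoint_family_on_def
  proof (intro ballI impI)
    fix Q Q' assume "Q \<in> fam" "Q' \<in> fam" and ne: "Q \<noteq> Q'"
    then obtain n n' where n: "Q \<in> lev n" "Q' \<in> lev n'" by (auto simp: fam_def)
    show "?E Q \<inter> ?E Q' = {}"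
    proof (cases "n \<le> n'")
      case True
      then show ?thesis using key n ne by blast
    next
      case False
      then have "?E Q' \<inter> ?E Q = {}" using key[OF n(2,1)] ne by simp
      then show ?thesis by blast
    qed
  qed
qed

text \<open>The induction carries Fn Q x + C \<open>lam Q\<close> rather than Fn Q x: the extra term
  is the C \<open>lam P\<close> that \<open>step_in\<close> leaves behind one generation up, so each
  cube of the chain is charged 2 C \<open>lam\<close> once. The members of G lie in P, a proper
  subset of Q, so inserting Q adds a new summand.\<close>

lemma chain:
  assumes out: "\<And>Q. Q \<in> DD \<Longrightarrow> x \<in> Q - \<Union>(st Q) \<Longrightarrow> Fn Q x \<le> C * lam Q"
    and inn: "\<And>Q P. Q \<in> DD \<Longrightarrow> P \<in> st Q \<Longrightarrow> x \<in> P \<Longrightarrow> Fn Q x \<le> Fn P x + C * lam Q + C * lam P"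
    and Q: "Q \<in> lev n" "x \<in> Q" and leave: "x \<notin> \<Union>(lev (n + Suc k))"
  shows "\<exists>G. finite G \<and> G \<subseteq> fam \<and> (\<forall>R\<in>G. R \<subseteq> Q \<and> x \<in> R) \<and> Fn Q x + C * lam Q \<le> 2 * C * (\<Sum>R\<in>G. lam R)"
  using Q leave
proof (induction k arbitrary: Q n)
  case (0 Q n)
  have QD: "Q \<in> DD" using 0(1) lev_DD by blast
  have "x \<notin> \<Union>(st Q)" using 0 by auto
  then have "Fn Q x + C * lam Q \<le> 2 * C * (\<Sum>R\<in>{Q}. lam R)" using out[OF QD] 0(2) by simp
  then show ?case using 0 by (intro exI[of _ "{Q}"]) (auto simp: fam_def)
next
  case (Suc k Q n)
  have QD: "Q \<in> DD" using Suc.prems(1) lev_DD by blast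
  show ?case
  proof (cases "x \<in> \<Union>(st Q)")
    case False
    then have "Fn Q x + C * lam Q \<le> 2 * C * (\<Sum>R\<in>{Q}. lam R)" using out[OF QD] Suc.prems(2) by simp
    then show ?thesis using Suc.prems by (intro exI[of _ "{Q}"]) (auto simp: fam_def)
  next
    case True
    then obtain P where P: "P \<in> st Q" "x \<in> P" by blast
    have "P \<in> lev (Suc n)" using P(1) Suc.prems(1) by auto
    then obtain G where G: "finite G" "G \<subseteq> fam" "\<forall>R\<in>G. R \<subseteq> P \<and> x \<in> R" "Fn P x + C * lam P \<le> 2 * C * (\<Sum>R\<in>G. lam R)"
      using Suc.IH[of P "Suc n"] P(2) Suc.prems(3) by auto
    have PQ: "P \<subset> Q" by (rule st_strict[OF QD P(1)])
    then have "Q \<notin> G" using G(3) by blast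
    then have "2 * C * (\<Sum>R\<in>insert Q G. lam R) = 2 * C * lam Q + 2 * C * (\<Sum>R\<in>G. lam R)"
      using G(1) by (simp add: distrib_left)
    moreover have "Fn Q x \<le> Fn P x + C * lam Q + C * lam P" by (rule inn[OF QD P])
    ultimately have "Fn Q x + C * lam Q \<le> 2 * C * (\<Sum>R\<in>insert Q G. lam R)" using G(4) by linarith
    moreover have "\<forall>R\<in>insert Q G. R \<subseteq> Q \<and> x \<in> R" using G(3) PQ Suc.prems(2) by blast
    moreover have "insert Q G \<subseteq> fam" using G(2) Suc.prems(1) by (auto simp: fam_def)
    ultimately show ?thesis using G(1) by blast
  qed
qed

lemma domination: "AE x in lebesgue. x \<in> Q0 \<longrightarrow> ennreal (Fn Q0 x) \<le> ennreal (2 * C) * esum fam (\<lambda>Q. lam Q * indicator Q x)"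
proof -
  \<comment> \<open>There are only countably many dyadic cubes, so one null set serves for all Q and
    P.\<close>
  have 1: "AE x in lebesgue. \<forall>Q\<in>DD. x \<in> Q - \<Union>(st Q) \<longrightarrow> Fn Q x \<le> C * lam Q"
    using step_out by (intro AE_ball_countable[OF DD_countable, THEN iffD2] ballI)
  have 2: "AE x in lebesgue. \<forall>Q\<in>DD. \<forall>P\<in>st Q. x \<in> P \<longrightarrow> Fn Q x \<le> Fn P x + C * lam Q + C * lam P"
    using step_in by (intro AE_ball_countable[OF DD_countable, THEN iffD2] ballI AE_ball_countable[OF st_countable, THEN iffD2])
  from 1 2 AE_leaves show ?thesis
  proof eventually_elim
    case (elim x)
    show ?case
    proof
      assume x: "x \<in> Q0"
      obtain n where n: "x \<notin> \<Union>(lev n)" using elim(3) by blast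
      then have "n \<noteq> 0" using x by (intro notI) simp
      then obtain k where k: "n = 0 + Suc k" using not0_implies_Suc by auto
      obtain G where G: "finite G" "G \<subseteq> fam" "\<forall>R\<in>G. R \<subseteq> Q0 \<and> x \<in> R" "Fn Q0 x + C * lam Q0 \<le> 2 * C * (\<Sum>R\<in>G. lam R)"
        using chain[of x Q0 0 k] elim(1,2) x n[unfolded k] by auto
      have "Fn Q0 x \<le> 2 * C * (\<Sum>R\<in>G. lam R)" using G(4) mult_nonneg_nonneg[OF C lam[OF Q0_DD]] by linarith
      then have "ennreal (Fn Q0 x) \<le> ennreal (2 * C * (\<Sum>R\<in>G. lam R * indicator R x))"
        using G(3) by (intro ennreal_leI) simp
      also have "\<dots> = ennreal (2 * C) * ennreal (\<Sum>R\<in>G. lam R * indicator R x)"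
        using C G(2) lam lev_DD by (intro ennreal_mult sum_nonneg mult_nonneg_nonneg) (auto simp: fam_def)
      also have "\<dots> \<le> ennreal (2 * C) * esum fam (\<lambda>Q. lam Q * indicator Q x)"
        unfolding esum_def using G(1,2) by (intro mult_left_mono SUP_upper) auto
      finally show "ennreal (Fn Q0 x) \<le> ennreal (2 * C) * esum fam (\<lambda>Q. lam Q * indicator Q x)" .
    qed
  qed
qed

end

section \<open>From a cube to its stopping cubes, and the conclusion\<close>

context cz_op
begin

text \<open>As q \<le> p/2, the cutoff of the smaller cube is supported where that of the larger one
  is 1, so their difference is (1 - \<open>eta m b q\<close>) \<open>eta m a p\<close>. It vanishes
  in a neighbourhood of the smaller cube; there the kernel representation applies, and its kernel is
  \<open>Kt\<close>.\<close>

lemma T_loc_difference: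
  assumes f: "Linfc f" and p: "p > 0" and q: "0 < q" "q \<le> p / 2"
    and sub: "\<And>i. a $ i \<le> b $ i \<and> b $ i + q \<le> a $ i + p"
  shows "AE x in lebesgue. x \<in> cube_of b q \<longrightarrow>
    T_loc f a p x = T_loc f b q x + (\<integral>y. Kt b q x y * (f y * of_real (eta m a p y)) \<partial>lebesgue)"
proof -
  have L: "Linfc (\<lambda>y. f y * of_real (eta m c s y))" if "s > 0" for c s
  proof -
    have "continuous_on UNIV (eta m c s)" using hc_continuous_on[OF Eeta(2)[OF that] that \<delta>(1)] .
    then show ?thesis
      by (intro Linfc_mult[OF f, of _ 1] measurable_continuous_lebesgue continuous_on_of_real)
        (auto simp: abs_of_nonneg[OF eta_01(1)] eta_01)
  qed
  define g where "g y = f y * of_real (eta m a p y) + (-1) * (f y * of_real (eta m b q y))" for y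
  have Lm: "Linfc (\<lambda>y. (-1) * (f y * of_real (eta m b q y)))"
    using Linfc_mult[OF L[OF q(1), of b], of "\<lambda>_. -1" 1] by simp
  have Lg: "Linfc g" unfolding g_def[abs_def] by (intro Linfc_add L p Lm)
  have eq1: "eta m b q y * (1 - eta m a p y) = 0" for y
  proof (cases "eta m b q y = 0")
    case False
    have "eta m a p y = 1"
    proof (rule eta_one[OF _ p])
      fix i show "a $ i - p / 2 \<le> y $ i \<and> y $ i \<le> a $ i + 3 * p / 2"
        using eta_nonzero[OF False q(1), of i] sub[of i] q p by linarith
    qed
    then show ?thesis by simp
  qed simp
  have geq: "K x y * g y = Kt b q x y * (f y * of_real (eta m a p y))" for x y
  proof -
    have "eta m a p y - eta m b q y = (1 - eta m b q y) * eta m a p y"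
      using eq1[of y] by (simp add: algebra_simps)
    then have "complex_of_real (eta m a p y) - of_real (eta m b q y) = of_real (1 - eta m b q y) * of_real (eta m a p y)"
      by (metis of_real_diff of_real_mult)
    moreover have "g y = f y * (of_real (eta m a p y) - of_real (eta m b q y))" by (simp add: g_def algebra_simps)
    ultimately show ?thesis by (simp add: Kt_def scaleR_conv_of_real)
  qed
  let ?B = "box (b - (\<chi> i. q / 2)) (b + (\<chi> i. 3 * q / 2))"
  have g0: "g y = 0" if "y \<in> ?B" for y
  proof -
    have y: "b $ i - q / 2 < y $ i" "y $ i < b $ i + 3 * q / 2" for i
      using that by (auto simp: mem_box_cart)
    have "eta m b q y = 1" using y by (intro eta_one[OF _ q(1)]) (auto intro: less_imp_le)
    then have "eta m a p y = 1" using eq1[of y] by simp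
    then show ?thesis using \<open>eta m b q y = 1\<close> by (simp add: g_def)
  qed
  have cl: "closure {y. g y \<noteq> 0} \<subseteq> - ?B"
    by (rule closure_minimal) (use g0 open_box in \<open>auto simp: closed_def\<close>)
  have inB: "x \<in> ?B" if "x \<in> cube_of b q" for x
    unfolding mem_box_cart
  proof
    fix i show "(b - (\<chi> i. q / 2)) $ i < x $ i \<and> x $ i < (b + (\<chi> i. 3 * q / 2)) $ i"
      using that[unfolded mem_cube, rule_format, of i] q(1) by simp
  qed
  have "AE x in lebesgue. T (\<lambda>y. f y * of_real (eta m b q y) + g y) x = T (\<lambda>y. f y * of_real (eta m b q y)) x + T g x"
    by (intro T_add L2_Linfc L q Lg)
  moreover have "(\<lambda>y. f y * of_real (eta m b q y) + g y) = (\<lambda>y. f y * of_real (eta m a p y))"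
    by (simp add: g_def)
  ultimately have 1: "AE x in lebesgue. T_loc f a p x = T_loc f b q x + T g x" by (simp add: T_loc_def)
  from 1 T_off[OF Lg] show ?thesis
  proof eventually_elim
    case (elim x)
    show ?case
    proof
      assume "x \<in> cube_of b q"
      then have "x \<notin> closure {y. g y \<noteq> 0}" using inB cl by blast
      then show "T_loc f a p x = T_loc f b q x + (\<integral>y. Kt b q x y * (f y * of_real (eta m a p y)) \<partial>lebesgue)"
        using elim by (simp add: geq)
    qed
  qed
qed

theorem sparse_domination:
  "\<exists>C>0. \<forall>f Q0. Linfc f \<and> is_cube Q0 \<and> (\<forall>y. y \<notin> Q0 \<longrightarrow> f y = 0) \<longrightarrow>
     (\<exists>S. S \<subseteq> dyadic_sub Q0 \<and> half_sparse S \<and>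
       (AE x in lebesgue. x \<in> Q0 \<longrightarrow>
          ennreal (cmod (T f x)) \<le> ennreal C * esum S (\<lambda>Q. quant f Q * indicator Q x)))"
proof -
  obtain C where C: "C \<ge> 0" and loc: "\<And>f a l. Linfc f \<Longrightarrow> l > 0 \<Longrightarrow> 0 \<le> quant f (cube_of a l) \<and>
     (\<exists>G\<in>sets lebesgue. G \<subseteq> cube_of a l \<and>
        emeasure lebesgue (cube_of a l - G) \<le> ennreal (8 * rr * l ^ CARD('n)) \<and>
        (\<forall>x\<in>G. cmod (T_loc f a l x) \<le> C * quant f (cube_of a l)) \<and>
        osc_ok f a l (C * quant f (cube_of a l)) G)"
    using local_estimate by blast
  have main: "\<exists>S. S \<subseteq> dyadic_sub (cube_of a l) \<and> half_sparse S \<and>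
       (AE x in lebesgue. x \<in> cube_of a l \<longrightarrow>
          ennreal (cmod (T f x)) \<le> ennreal (4 * C + 1) * esum S (\<lambda>Q. quant f Q * indicator Q x))"
    if f: "Linfc f" and l: "l > 0" and supp: "\<And>y. y \<notin> cube_of a l \<Longrightarrow> f y = 0" for f a l
  proof -
    \<comment> \<open>G carries the local estimate; W is an enlargement of its complement in the
      cube, open so that the stopping cubes cover all of it.\<close>
    define GW where "GW G W b p \<longleftrightarrow> G \<in> sets lebesgue \<and> G \<subseteq> cube_of b p \<and>
        emeasure lebesgue (cube_of b p - G) \<le> ennreal (8 * rr * p ^ CARD('n)) \<and>
        (\<forall>x\<in>G. cmod (T_loc f b p x) \<le> C * quant f (cube_of b p)) \<and>
        osc_ok f b p (C * quant f (cube_of b p)) G \<and>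
        open W \<and> cube_of b p - G \<subseteq> W \<and> emeasure lebesgue (W \<inter> cube_of b p) \<le> ennreal ((1/2) ^ (CARD('n) + 2) * p ^ CARD('n))"
      for G W b p
    have exGW: "\<exists>G W. GW G W b p" if p: "p > 0" for b p
    proof -
      obtain G where G: "G \<in> sets lebesgue" "G \<subseteq> cube_of b p"
        "emeasure lebesgue (cube_of b p - G) \<le> ennreal (8 * rr * p ^ CARD('n))"
        "\<forall>x\<in>G. cmod (T_loc f b p x) \<le> C * quant f (cube_of b p)"
        "osc_ok f b p (C * quant f (cube_of b p)) G" using loc[OF f p, of b] by blast
      have Es: "cube_of b p - G \<in> sets lebesgue" using G(1) lebesgue_cube by blast
      have e: "8 * rr * p ^ CARD('n) > 0" using rr(1) p by simp
      obtain W where W: "open W" "cube_of b p - G \<subseteq> W" "W - (cube_of b p - G) \<in> lmeasurable"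
        "emeasure lebesgue (W - (cube_of b p - G)) < ennreal (8 * rr * p ^ CARD('n))"
        using sets_lebesgue_outer_open[OF Es e] .
      have Ws: "W \<in> sets lebesgue" using W(1) by (simp add: borel_open sets_completionI_sets)
      have "emeasure lebesgue (W \<inter> cube_of b p) \<le> emeasure lebesgue ((cube_of b p - G) \<union> (W - (cube_of b p - G)))"
        using Es W(3) by (intro emeasure_mono sets.Un) (auto simp: fmeasurable_def)
      also have "\<dots> \<le> emeasure lebesgue (cube_of b p - G) + emeasure lebesgue (W - (cube_of b p - G))"
        using Es W(3) by (intro emeasure_subadditive) (auto simp: fmeasurable_def)
      also have "\<dots> \<le> ennreal (8 * rr * p ^ CARD('n)) + ennreal (8 * rr * p ^ CARD('n))"
        using G(3) W(4) by (intro add_mono) auto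
      \<comment> \<open>Twice 8 \<open>rr\<close> = 2^-(d+3): once for the complement of G, once for
        outer regularity.\<close>
      also have "\<dots> = ennreal ((1/2) ^ (CARD('n) + 2) * p ^ CARD('n))"
        unfolding rr(2) using p by (simp add: ennreal_plus[symmetric] power_add power3_eq_cube eval_nat_numeral)
      finally show ?thesis using G W(1,2) unfolding GW_def by blast
    qed
    \<comment> \<open>The recursion is indexed by cubes as sets, while the cutoffs need corner and
      side; \<open>cube_inj\<close> recovers them.\<close>
    define bq :: "(real^'n) set \<Rightarrow> real^'n" where "bq Q = (THE b. \<exists>p>0. Q = cube_of b p)" for Q
    define pq :: "(real^'n) set \<Rightarrow> real" where "pq Q = (THE p. p > 0 \<and> (\<exists>b. Q = cube_of b p))" for Q
    have bq: "bq (cube_of b p) = b" and pq: "pq (cube_of b p) = p" if p: "p > 0" for b p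
    proof -
      show "bq (cube_of b p) = b" unfolding bq_def using p cube_inj[of b p] by (intro the_equality) blast+
      show "pq (cube_of b p) = p" unfolding pq_def using p cube_inj[of b p] by (intro the_equality) blast+
    qed
    \<comment> \<open>Choosing G and W once for each cube ensures that a stopping cube enters with
      the same sets as child and, one step later, as parent.\<close>
    define Gq where "Gq Q = (SOME G. \<exists>W. GW G W (bq Q) (pq Q))" for Q
    define Wq where "Wq Q = (SOME W. GW (Gq Q) W (bq Q) (pq Q))" for Q
    define st where "st Q = stop (Wq Q) (bq Q) (pq Q)" for Q
    define Fn where "Fn Q x = cmod (T_loc f (bq Q) (pq Q) x)" for Q x
    have GWq: "GW (Gq (cube_of b p)) (Wq (cube_of b p)) b p" if p: "p > 0" for b p
    proof -
      have "\<exists>W. GW (Gq (cube_of b p)) W b p"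
        using someI_ex[of "\<lambda>G. \<exists>W. GW G W b p"] exGW[OF p] unfolding Gq_def bq[OF p] pq[OF p] by blast
      then show ?thesis using someI_ex[of "\<lambda>W. GW (Gq (cube_of b p)) W b p"] unfolding Wq_def bq[OF p] pq[OF p] by blast
    qed
    note GWD = GWq[unfolded GW_def]
    have DDcube: "\<exists>b p. p > 0 \<and> Q = cube_of b p" if Qd: "Q \<in> dyadic_sub (cube_of a l)" for Q
    proof -
      obtain k j where "Q = dyc a l k j" using Qd unfolding dyadic_sub_cube[OF l] by blast
      moreover have "l / 2 ^ k > 0" using l by simp
      ultimately show ?thesis unfolding dyc_def by blast
    qed
    have lam0: "0 \<le> quant f (cube_of b p)" if "p > 0" for b p using loc[OF f that] by blast
    \<comment> \<open>The constant is 2 C because \<open>step_in\<close> collects C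
      \<open>quant f Q\<close> twice: from the oscillation and from the operator at the base
      point.\<close>
    interpret I: sparse_iteration a l st "quant f" Fn "2 * C"
    proof (unfold_locales)
      fix Q assume Q: "Q \<in> dyadic_sub (cube_of a l)"
      obtain b p where p: "p > 0" and Qe: "Q = cube_of b p" using DDcube[OF Q] by blast
      have stQ: "st Q = stop (Wq Q) b p" unfolding st_def Qe bq[OF p] pq[OF p] ..
      note W = GWD[OF p, of b, folded Qe]
      have Wm: "emeasure lebesgue (Wq Q \<inter> cube_of b p) \<le> ennreal ((1/2) ^ (CARD('n) + 2) * p ^ CARD('n))"
        and Wo: "open (Wq Q)" using W unfolding Qe by blast+
      show "st Q \<subseteq> dyadic_sub (cube_of a l)"
        using stop_sub[OF p, of "Wq Q" b] dyadic_sub_trans[OF l Q] unfolding stQ unfolding Qe by blast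
      show "emeasure lebesgue (\<Union>(st Q)) \<le> ennreal (1/2) * emeasure lebesgue Q"
      proof -
        have "ennreal (1/2 * p ^ CARD('n)) = ennreal (1/2) * ennreal (p ^ CARD('n))" using p by (intro ennreal_mult) auto
        then show ?thesis using stop_measure[OF p Wo Wm] emeasure_cube[of p b] p unfolding stQ unfolding Qe by simp
      qed
      show "0 \<le> quant f Q" unfolding Qe by (rule lam0[OF p])
      show "AE x in lebesgue. x \<in> Q - \<Union>(st Q) \<longrightarrow> Fn Q x \<le> 2 * C * quant f Q"
      proof (intro AE_I2 impI)
        fix x assume x: "x \<in> Q - \<Union>(st Q)"
        then have "x \<notin> Wq Q" using stop_cover[OF p Wo, of x b] unfolding stQ unfolding Qe by blast
        then have "x \<in> Gq Q" using W x by blast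
        then have "cmod (T_loc f b p x) \<le> C * quant f Q" using W by blast
        also have "\<dots> \<le> 2 * C * quant f Q"
          using C lam0[OF p, of b] unfolding Qe by (intro mult_right_mono) auto
        finally show "Fn Q x \<le> 2 * C * quant f Q" unfolding Fn_def Qe bq[OF p] pq[OF p] .
      qed
      fix P assume P: "P \<in> st Q"
      have Pd: "P \<in> dyadic_sub (cube_of b p)" using stop_sub[OF p] P unfolding stQ by blast
      have Pne: "P \<noteq> cube_of b p" and PW: "emeasure lebesgue (Wq Q \<inter> P) \<le> ennreal (1/2) * emeasure lebesgue P"
        using stop_strict[OF p Wo Wm] P unfolding stQ by blast+
      have PsubQ: "P \<subseteq> Q" using Pd dyc_subset[OF p] unfolding dyadic_sub_cube[OF p] Qe by blast
      then show "P \<subset> Q" using Pne unfolding Qe by blast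
      show "P = P'" if "P' \<in> st Q" "x \<in> P" "x \<in> P'" for P' x
        using stop_disjoint[OF p] P that unfolding stQ by blast
      obtain b' q where q: "q > 0" and Pe: "P = cube_of b' q" and q2: "q \<le> p / 2"
        and sub: "\<And>i. b $ i \<le> b' $ i \<and> b' $ i + q \<le> b $ i + p"
        using dyadic_strict[OF p Pd Pne] by blast
      note V = GWD[OF q, of b', folded Pe]
      define f1 where "f1 y = f y * of_real (eta m b p y)" for y
      define I where "I x = (\<integral>y. Kt b' q x y * f1 y \<partial>lebesgue)" for x
      have diff: "AE x in lebesgue. x \<in> P \<longrightarrow> T_loc f b p x = T_loc f b' q x + I x"
        using T_loc_difference[OF f p q q2 sub] unfolding I_def f1_def Pe by blast
      \<comment> \<open>The identity for T is needed at a single base point, so its exceptional null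
        set is made explicit and avoided.\<close>
      have "AE x in lebesgue. \<not> (x \<in> P \<and> T_loc f b p x \<noteq> T_loc f b' q x + I x)"
        using diff by eventually_elim blast
      then obtain N where
          N': "{x \<in> space lebesgue. \<not> \<not> (x \<in> P \<and> T_loc f b p x \<noteq> T_loc f b' q x + I x)} \<subseteq> N"
            "emeasure lebesgue N = 0" "N \<in> sets lebesgue"
        by (rule AE_E)
      have N: "N \<in> null_sets lebesgue"
        "\<And>x. x \<notin> N \<Longrightarrow> x \<in> P \<Longrightarrow> T_loc f b p x = T_loc f b' q x + I x"
        using N'(1) null_setsI[OF N'(2,3)] by auto
      have Lf1: "Linfc f1"
      proof -
        have "continuous_on UNIV (eta m b p)" using hc_continuous_on[OF Eeta(2)[OF p] p \<delta>(1)] .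
        then show ?thesis unfolding f1_def[abs_def]
          by (intro Linfc_mult[OF f, of _ 1] measurable_continuous_lebesgue continuous_on_of_real)
            (auto simp: abs_of_nonneg[OF eta_01(1)] eta_01)
      qed
      have int: "integrable lebesgue (\<lambda>y. Kt b' q x y * f1 y)" if "x \<in> P" for x
        using integrable_Linfc[OF Linfc_mult[OF Lf1 Kt_measurable[OF q] Kt_bound[OF q that[unfolded Pe]]]]
        by (simp add: mult.commute)
      \<comment> \<open>A point that is good for Q and for P: within P, the set W of Q takes at most
        one half, the complement of the good set of P at most 8 \<open>rr\<close> \<le> 1/4, and N
        nothing.\<close>
      have "\<exists>x'. x' \<in> P \<and> x' \<notin> Wq Q \<and> x' \<in> Gq P \<and> x' \<notin> N"
      proof (rule ccontr)
        assume "\<not> ?thesis"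
        then have sub: "P \<subseteq> (Wq Q \<inter> P) \<union> (P - Gq P) \<union> N" by blast
        have Ps: "P \<in> sets lebesgue" unfolding Pe by (rule lebesgue_cube)
        have Ws: "Wq Q \<inter> P \<in> sets lebesgue" using Wo Ps by (simp add: borel_open sets_completionI_sets sets.Int)
        have Gs: "P - Gq P \<in> sets lebesgue" using V Ps by blast
        define qd where "qd = q ^ CARD('n)"
        have qd: "qd > 0" "emeasure lebesgue P = ennreal qd" using q emeasure_cube[of q b'] by (auto simp: qd_def Pe)
        have "ennreal qd \<le> emeasure lebesgue ((Wq Q \<inter> P) \<union> (P - Gq P) \<union> N)"
          unfolding qd(2)[symmetric] using sub Ws Gs N(1) by (intro emeasure_mono) auto
        also have "\<dots> = emeasure lebesgue ((Wq Q \<inter> P) \<union> (P - Gq P))"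
          using Ws Gs N(1) by (intro emeasure_Un_null_set) auto
        also have "\<dots> \<le> emeasure lebesgue (Wq Q \<inter> P) + emeasure lebesgue (P - Gq P)"
          by (rule emeasure_subadditive[OF Ws Gs])
        also have "\<dots> \<le> ennreal (1/2) * ennreal qd + ennreal (8 * rr * qd)"
          using PW[unfolded qd(2)] V unfolding qd_def by (intro add_mono) auto
        also have "\<dots> = ennreal (1/2 * qd + 8 * rr * qd)"
        proof -
          have "ennreal (1/2) * ennreal qd = ennreal (1/2 * qd)" using qd(1) by (intro ennreal_mult[symmetric]) auto
          moreover have "ennreal (1/2 * qd) + ennreal (8 * rr * qd) = ennreal (1/2 * qd + 8 * rr * qd)"
            using qd(1) rr(1) by (intro ennreal_plus[symmetric]) auto
          ultimately show ?thesis by (simp only:)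
        qed
        finally have "qd \<le> 1/2 * qd + 8 * rr * qd" using qd(1) rr(1) by (subst (asm) ennreal_le_iff) auto
        then have "1 * qd \<le> (1/2 + 8 * rr) * qd" by (simp add: distrib_right)
        then have "1 \<le> 1/2 + 8 * rr" using qd(1) by (rule mult_right_le_imp_le)
        moreover have "(1/2 :: real) ^ (CARD('n) + 3) \<le> (1/2) ^ 2" by (intro power_decreasing) auto
        then have "8 * rr \<le> 1/4" unfolding rr(2) by (simp add: power2_eq_square)
        ultimately show False by linarith
      qed
      then obtain x' where x': "x' \<in> P" "x' \<notin> Wq Q" "x' \<in> Gq P" "x' \<notin> N" by blast
      have x'G: "x' \<in> Gq Q" using W x'(1,2) PsubQ by blast
      have Ix': "cmod (I x') \<le> C * quant f Q + C * quant f P"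
      proof -
        have "I x' = T_loc f b p x' - T_loc f b' q x'" using N(2)[OF x'(4,1)] by simp
        then have "cmod (I x') \<le> cmod (T_loc f b p x') + cmod (T_loc f b' q x')" using norm_triangle_ineq4 by metis
        moreover have "cmod (T_loc f b p x') \<le> C * quant f Q" using W x'G by blast
        moreover have "cmod (T_loc f b' q x') \<le> C * quant f P" using V x'(3) by blast
        ultimately show ?thesis by linarith
      qed
      \<comment> \<open>Here the oscillation bound of Q is used with the subcube P: control of I at
        the one point x' spreads to every point of P.\<close>
      have osc: "cmod (I x) \<le> C * quant f Q + cmod (I x')" if x: "x \<in> P" for x
      proof -
        have "osc_ok f b p (C * quant f Q) (Gq Q)" using W by blast
        then have "cmod (\<integral>y. (Kt b' q x y - Kt b' q x' y) * f1 y \<partial>lebesgue) \<le> C * quant f Q"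
          using q x x'(1) x'G unfolding osc_ok_def f1_def Pe by blast
        moreover have "(\<integral>y. (Kt b' q x y - Kt b' q x' y) * f1 y \<partial>lebesgue) = I x - I x'"
          unfolding I_def left_diff_distrib by (rule Bochner_Integration.integral_diff[OF int[OF x] int[OF x'(1)]])
        ultimately show ?thesis using norm_triangle_sub[of "I x" "I x'"] by simp
      qed
      show "AE x in lebesgue. x \<in> P \<longrightarrow> Fn Q x \<le> Fn P x + 2 * C * quant f Q + 2 * C * quant f P"
        using diff
      proof eventually_elim
        case (elim x)
        show ?case
        proof
          assume x: "x \<in> P"
          have "cmod (T_loc f b p x) \<le> cmod (T_loc f b' q x) + cmod (I x)"
            using elim x norm_triangle_ineq by metis
          moreover have "0 \<le> C * quant f P" using C lam0[OF q, of b'] unfolding Pe by simp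
          ultimately have "cmod (T_loc f b p x) \<le> cmod (T_loc f b' q x) + 2 * C * quant f Q + 2 * C * quant f P"
            using osc[OF x] Ix' by linarith
          then show "Fn Q x \<le> Fn P x + 2 * C * quant f Q + 2 * C * quant f P"
            unfolding Fn_def by (simp add: Qe Pe bq[OF p] pq[OF p] bq[OF q] pq[OF q])
        qed
      qed
    qed (use l C in auto)
    have Tf: "Fn (cube_of a l) = (\<lambda>x. cmod (T f x))"
    proof -
      have "f y * of_real (eta m a l y) = f y" for y
      proof (cases "y \<in> cube_of a l")
        case True
        have "eta m a l y = 1"
        proof (rule eta_one[OF _ l])
          fix i show "a $ i - l / 2 \<le> y $ i \<and> y $ i \<le> a $ i + 3 * l / 2"
            using True[unfolded mem_cube, rule_format, of i] l by linarith
        qed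
        then show ?thesis by simp
      qed (simp add: supp)
      then have "(\<lambda>y. f y * of_real (eta m a l y)) = f" by blast
      then show ?thesis by (simp add: Fn_def[abs_def] T_loc_def bq[OF l] pq[OF l])
    qed
    have "AE x in lebesgue. x \<in> cube_of a l \<longrightarrow>
          ennreal (cmod (T f x)) \<le> ennreal (4 * C + 1) * esum I.fam (\<lambda>Q. quant f Q * indicator Q x)"
      using I.domination unfolding Tf
    proof eventually_elim
      case (elim x)
      \<comment> \<open>\<open>domination\<close> doubles the constant 2 C of the interpretation;
        the added 1 makes the final constant positive even for C = 0.\<close>
      have "ennreal (2 * (2 * C)) \<le> ennreal (4 * C + 1)" by (intro ennreal_leI) simp
      then have "ennreal (2 * (2 * C)) * esum I.fam (\<lambda>Q. quant f Q * indicator Q x)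
          \<le> ennreal (4 * C + 1) * esum I.fam (\<lambda>Q. quant f Q * indicator Q x)"
        by (intro mult_right_mono) auto
      then show ?case using elim order_trans by blast
    qed
    moreover have "I.fam \<subseteq> dyadic_sub (cube_of a l)" using I.lev_DD unfolding I.fam_def by blast
    ultimately show ?thesis using I.sparse by blast
  qed
  show ?thesis
  proof (intro exI[of _ "4 * C + 1"] conjI allI impI)
    show "0 < 4 * C + 1" using C by simp
    fix f :: "real^'n \<Rightarrow> complex" and Q0 assume H: "Linfc f \<and> is_cube Q0 \<and> (\<forall>y. y \<notin> Q0 \<longrightarrow> f y = 0)"
    then obtain a l where "l > 0" "Q0 = cube_of a l" by (auto simp: is_cube_def)
    then show "\<exists>S. S \<subseteq> dyadic_sub Q0 \<and> half_sparse S \<and>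
       (AE x in lebesgue. x \<in> Q0 \<longrightarrow>
          ennreal (cmod (T f x)) \<le> ennreal (4 * C + 1) * esum S (\<lambda>Q. quant f Q * indicator Q x))"
      using main[of f l a] H by blast
  qed
qed

end

theorem theoremD:
  shows "\<exists>r::real. 0 < r \<and> r < 1 \<and>
    (\<forall>(m::nat) (\<delta>::real) (T :: (real^'n::finite \<Rightarrow> complex) \<Rightarrow> real^'n \<Rightarrow> complex) K.
       0 < \<delta> \<and> \<delta> \<le> 1 \<and> CZO m \<delta> T K \<longrightarrow>
       (\<exists>C>0. \<forall>f Q0. Linfc f \<and> is_cube Q0 \<and> (\<forall>y. y \<notin> Q0 \<longrightarrow> f y = 0) \<longrightarrow>
          (\<exists>S. S \<subseteq> dyadic_sub Q0 \<and> half_sparse S \<and>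
             (AE x in lebesgue. x \<in> Q0 \<longrightarrow>
                ennreal (cmod (T f x)) \<le>
                  ennreal C * esum S (\<lambda>Q. Pr r Q (maxf m \<delta> (triple Q) f) * indicator Q x)))))"
\<comment> \<open>The witness is \<open>rr\<close> written out, as it has to be given before the
  smoothness, the operator and the kernel are fixed.\<close>
proof (rule exI[of _ "(1 / 2 :: real) ^ (CARD('n) + 6)"], rule conjI[OF _ conjI], goal_cases)
  case 1
  show ?case by simp
next
  case 2
  have "(1 / 2 :: real) ^ (CARD('n) + 6) \<le> (1 / 2) ^ 1" by (intro power_decreasing) auto
  then show ?case by simp
next
  case 3
  show ?case
  proof (intro allI impI)
  fix m :: nat and \<delta> :: real and T :: "(real^'n \<Rightarrow> complex) \<Rightarrow> real^'n \<Rightarrow> complex" and K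
  assume H: "0 < \<delta> \<and> \<delta> \<le> 1 \<and> CZO m \<delta> T K"
  then have \<delta>: "0 < \<delta>" "\<delta> \<le> 1" and Z: "CZO m \<delta> T K" by auto
  obtain B where B: "\<And>f. L2 f \<Longrightarrow> L2 (T f) \<and>
        (\<integral>x. (cmod (T f x))^2 \<partial>lebesgue) \<le> B^2 * (\<integral>x. (cmod (f x))^2 \<partial>lebesgue)"
    using Z unfolding CZO_def by blast
  have lin: "\<And>f g. L2 f \<Longrightarrow> L2 g \<Longrightarrow> AE x in lebesgue. T (\<lambda>y. f y + g y) x = T f x + T g x"
    "\<And>f c. L2 f \<Longrightarrow> AE x in lebesgue. T (\<lambda>y. c * f y) x = c * T f x"
    "\<And>f. Linfc f \<Longrightarrow> AE x in lebesgue. x \<notin> closure {y. f y \<noteq> 0} \<longrightarrow> T f x = (\<integral>y. K x y * f y \<partial>lebesgue)"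
    using Z unfolding CZO_def by blast+
  obtain CK where CK: "CK > 0" and
    k1: "\<forall>x. diff_upto m (K x) (- {x})" and
    k2: "\<forall>x y is. x \<noteq> y \<and> length is \<le> m \<longrightarrow>
          norm (pds is (K x) y) \<le> CK * dist x y powr (- (real CARD('n) + real (length is)))" and
    k3: "\<forall>x y h is. x \<noteq> y \<and> norm h \<le> dist x y / 2 \<and> length is \<le> m \<longrightarrow>
          norm (pds is (K x) y - pds is (K (x + h)) y)
            \<le> CK * norm h powr \<delta> * dist x y powr (- (real CARD('n) + (real m + \<delta>)))" and
    k4: "\<forall>x y h is. x \<noteq> y \<and> norm h \<le> dist x y / 2 \<and> length is = m \<longrightarrow>
          norm (pds is (K x) y - pds is (K x) (y + h))
            \<le> CK * norm h powr \<delta> * dist x y powr (- (real CARD('n) + (real m + \<delta>)))"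
    using Z unfolding CZO_def by blast
  interpret cz_op m \<delta> CK K T B
  proof (unfold_locales)
    fix x y h :: "real^'n" and "is" :: "'n list"
    show "x \<noteq> y \<Longrightarrow> norm h \<le> dist x y / 2 \<Longrightarrow> length is = m \<Longrightarrow> norm (pds is (K x) y - pds is (K (x + h)) y)
            \<le> CK * norm h powr \<delta> * dist x y powr (- (real CARD('n) + (real m + \<delta>)))"
      using k3 by simp
  qed (use \<delta> CK B lin k1 k2 k4 in blast)+
  from sparse_domination
  show "\<exists>C>0. \<forall>f Q0. Linfc f \<and> is_cube Q0 \<and> (\<forall>y. y \<notin> Q0 \<longrightarrow> f y = 0) \<longrightarrow>
          (\<exists>S. S \<subseteq> dyadic_sub Q0 \<and> half_sparse S \<and>
             (AE x in lebesgue. x \<in> Q0 \<longrightarrow>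
                ennreal (cmod (T f x)) \<le>
                  ennreal C * esum S (\<lambda>Q. Pr ((1 / 2) ^ (CARD('n) + 6)) Q (maxf m \<delta> (triple Q) f) * indicator Q x)))"
    unfolding quant_def rr_def .
  qed
qed

end
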